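(* A nonnegative function $f \in L^2(\mathbb{S}^2)$ is a global maximizer for the adjoint Fourier restriction inequality $\|\widehat{f\sigma}\|_{L^4(\mathbb{R}^3)} \le C \|f\|_{L^2(\mathbb{S}^2)}$ (that is, $f \neq 0$ and $\|\widehat{f\sigma}\|_{L^4(\mathbb{R}^3)} = \mathcal{R}\,\|f\|_{L^2(\mathbb{S}^2)}$) if and only if $f$ is a nonzero constant, and moreover $$\mathcal{R} = \frac{\|\widehat{\mathbf{1}\sigma}\|_{L^4(\mathbb{R}^3)}}{\|\mathbf{1}\|_{L^2(\mathbb{S}^2)}} = 2\pi,$$ where $\mathbf{1}$ is the constant function equal to $1$ on $\mathbb{S}^2$ and $\mathcal{R}$ is the optimal constant $$\mathcal{R} := \sup_{f \in L^2(\mathbb{S}^2),\, f \neq 0} \frac{\|\widehat{f\sigma}\|_{L^4(\mathbb{R}^3)}}{\|f\|_{L^2(\mathbb{S}^2)}}.$$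
   Context: $\mathbb{S}^2 = \{x \in \mathbb{R}^3 : |x| = 1\}$ is the unit sphere with its natural surface measure $\sigma$ induced by Lebesgue measure on $\mathbb{R}^3$ (not normalized, so $\sigma(\mathbb{S}^2) = 4\pi$), and $L^2(\mathbb{S}^2) = L^2(\mathbb{S}^2,\sigma)$ consists of complex-valued functions, identified when equal almost everywhere. For $f$ integrable on $\mathbb{S}^2$ and $x \in \mathbb{R}^3$, $\widehat{f\sigma}(x) = \int_{\mathbb{S}^2} e^{-i x\cdot\omega} f(\omega)\, d\sigma_\omega$. The norm on $L^4(\mathbb{R}^3)$ is taken with respect to Lebesgue measure. *)

theory Defs
  imports "HOL-Analysis.Analysis"
begin

text \<open>
  Surface measure of the unit sphere, induced by Lebesgue measure through the polar coordinate
  formula: with \<open>n = DIM('a)\<close>, the surface measure of \<open>E\<close> is \<open>n\<close> times the volume of the cone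
  \<open>{r \<omega> | 0 < r < 1, \<omega> \<in> E}\<close> over \<open>E\<close>, since that volume is the integral of \<open>r ^ (n - 1)\<close> over
  \<open>0 < r < 1\<close> times the measure of \<open>E\<close>.  Here \<open>sgn x = x / |x|\<close>.
\<close>

definition sphere_measure :: "'a::euclidean_space measure" where
  "sphere_measure =
     scale_measure (of_nat DIM('a))
       (distr (restrict_space lborel (ball 0 1 - {0})) (restrict_space borel (sphere 0 1)) sgn)"

abbreviation \<sigma> :: "(real^3) measure" where
  "\<sigma> \<equiv> sphere_measure"

text \<open>
  Norms take values in \<open>ennreal\<close>, so that a function outside \<open>L\<^sup>p\<close> has norm \<open>\<infinity>\<close>.  (The Bochner
  integral would assign such a function the junk value 0.)
\<close>

definition Lp_norm :: "real \<Rightarrow> 'a measure \<Rightarrow> ('a \<Rightarrow> complex) \<Rightarrow> ennreal" where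
  "Lp_norm p M f =
     (let I = (\<integral>\<^sup>+ x. ennreal (norm (f x) powr p) \<partial>M)
      in if I = \<infinity> then \<infinity> else ennreal (enn2real I powr (1 / p)))"

text \<open>
  Elements of \<open>L\<^sup>2\<close> are represented by functions; their identification almost everywhere is made
  explicit by \<open>AE\<close> in what follows.
\<close>

definition L2 :: "'a measure \<Rightarrow> ('a \<Rightarrow> complex) set" where
  "L2 M = {f \<in> borel_measurable M. Lp_norm 2 M f < \<infinity>}"

definition L2_nonzero :: "'a measure \<Rightarrow> ('a \<Rightarrow> complex) set" where
  "L2_nonzero M = {f \<in> L2 M. \<not> (AE x in M. f x = 0)}"

definition fourier_ext :: "(real^3 \<Rightarrow> complex) \<Rightarrow> real^3 \<Rightarrow> complex" where
  "fourier_ext f x = (LINT \<omega>|\<sigma>. exp (- \<i> * complex_of_real (x \<bullet> \<omega>)) * f \<omega>)"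

definition restriction_ratio :: "(real^3 \<Rightarrow> complex) \<Rightarrow> ennreal" where
  "restriction_ratio f = Lp_norm 4 lborel (fourier_ext f) / Lp_norm 2 \<sigma> f"

definition optimal_const :: ennreal where
  "optimal_const = (SUP f \<in> L2_nonzero \<sigma>. restriction_ratio f)"

definition global_maximizer :: "(real^3 \<Rightarrow> complex) \<Rightarrow> bool" where
  "global_maximizer f \<longleftrightarrow>
     f \<in> L2_nonzero \<sigma> \<and>
     Lp_norm 4 lborel (fourier_ext f) = optimal_const * Lp_norm 2 \<sigma> f"

definition nonneg_ae :: "'a measure \<Rightarrow> ('a \<Rightarrow> complex) \<Rightarrow> bool" where
  "nonneg_ae M f \<longleftrightarrow> (AE x in M. f x \<in> \<real>\<^sub>\<ge>\<^sub>0)"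

text \<open>The normalization: the total mass is the surface area \<open>4 \<pi>\<close>.\<close>

lemma sgn_measurable_sphere:
  "sgn \<in> measurable (restrict_space lborel (ball 0 1 - {0::'a::euclidean_space}))
                    (restrict_space borel (sphere 0 1))"
proof (rule measurable_restrict_space2)
  show "sgn \<in> space (restrict_space lborel (ball 0 1 - {0::'a})) \<rightarrow> sphere 0 1"
    by (auto simp: space_restrict_space norm_sgn)
  have "(\<lambda>x::'a. x /\<^sub>R norm x) \<in> borel_measurable borel" by measurable
  then show "sgn \<in> borel_measurable (restrict_space lborel (ball 0 1 - {0::'a}))"
    unfolding sgn_div_norm[abs_def] by (intro measurable_restrict_space1) simp
qed

lemma space_sphere_measure: "space (sphere_measure :: 'a::euclidean_space measure) = sphere 0 1"
  by (simp add: sphere_measure_def space_scale_measure space_restrict_space)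

lemma emeasure_sphere_total: "emeasure \<sigma> (sphere 0 1) = ennreal (4 * pi)"
proof -
  let ?B = "ball 0 1 - {0::real^3}"
  have v: "sgn -` sphere 0 1 \<inter> ?B = ?B"
    by (auto simp: norm_sgn)
  have "emeasure \<sigma> (sphere 0 1) = 3 * emeasure lborel ?B"
    unfolding sphere_measure_def
    by (subst emeasure_scale_measure, subst emeasure_distr[OF sgn_measurable_sphere])
       (auto simp: space_restrict_space sets_restrict_space emeasure_restrict_space v)
  also have "emeasure lborel ?B = emeasure lborel (ball 0 1 :: (real^3) set)"
    by (subst emeasure_Diff) auto
  also have "\<dots> = ennreal (4 / 3 * pi)"
    by (subst emeasure_ball) (auto simp: unit_ball_vol_3)
  also have "3 * ennreal (4 / 3 * pi) = ennreal (4 * pi)"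
    by (subst ennreal_numeral[symmetric], subst ennreal_mult[symmetric]) auto
  finally show ?thesis .
qed

end

theory Submission
  imports Defs "HOL-Probability.Probability"
begin

text \<open>
  Write \<open>F\<close> for the extension \<open>fourier_ext f\<close>.  Formally \<open>\<integral> |F|\<^sup>4\<close> is \<open>(2\<pi>)\<^sup>3\<close> times the integral of
  \<open>f(a) f(b) cnj (f(c)) cnj (f(d))\<close> over the quadruples of unit vectors with \<open>a + b = c + d\<close>, so it
  only grows when \<open>f\<close> is replaced by \<open>|f|\<close>.  The following observations, due to Foschi, then give
  the sharp bound.

  \<^item> If \<open>a + b = c + d\<close>, then \<open>|a + b| |c + d| + |a - c| |b - d| + |a - d| |b - c| = 4\<close>
    (\<open>four_chords\<close>).  Inserting this weight splits the integral into three.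
  \<^item> In each part the product of four values is separated by the inequality of the means, for example
    \<open>2 f(a) f(b) f(c) f(d) \<le> f(a)\<^sup>2 f(b)\<^sup>2 + f(c)\<^sup>2 f(d)\<^sup>2\<close>.  The sum of two independent points has a
    density proportional to \<open>1 / |x|\<close> on \<open>|x| < 2\<close>, so that the factor \<open>|c + d|\<close> is exactly the one
    for which the two remaining variables integrate to a constant (\<open>smoothed_diff_le\<close>).
  \<^item> What is left is the energy \<open>\<integral>\<integral> g(a) g(b) (2 |a - b| + |a + b|)\<close> of \<open>g = |f|\<^sup>2\<close>.  As a function of
    \<open>t = a \<bullet> b\<close> the kernel is \<open>\<surd>2 (2 \<surd>(1 - t) + \<surd>(1 + t))\<close>, in whose power series every coefficient
    but the constant one is negative, whereas each kernel \<open>(a \<bullet> b)\<^sup>k\<close> is positive semidefinite.  Hence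
    at given mass the energy is largest when \<open>g\<close> is constant.  In the case of equality all the forms
    \<open>(a \<bullet> b)\<^sup>k\<close> vanish on \<open>h = g - mean\<close>, thus all polynomial moments of \<open>h\<close> vanish, and \<open>h = 0\<close> by
    the Stone-Weierstrass theorem (\<open>chord_energy_le\<close>, \<open>chord_energy_ge_imp_const\<close>).

  The equation \<open>a + b = c + d\<close> is made rigorous with a Gaussian: \<open>\<integral> |F(x)|\<^sup>4 exp (- s\<^sup>2 |x|\<^sup>2 / 2)\<close> is, by
  Fubini, the integral over all quadruples against the Gaussian \<open>gauss_hat s (a + b - c - d)\<close>.  The
  identity of the four chords then holds up to an error \<open>8 |a + b - c - d|\<close>, and because
  \<open>|y| gauss_hat s y \<le> 4 s gauss_hat (\<surd>2 s) y\<close> this error is at most \<open>32 s\<close> times the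
  integral of the same kind for \<open>\<surd>2 s\<close> (\<open>quad_self_improving\<close>).  The latter is no larger than the
  integral for \<open>s\<close>, as its weight on the Fourier side is smaller, so the error is absorbed in the
  left-hand side before \<open>s\<close> tends to \<open>0\<close>.  For \<open>f = 1\<close> nothing is lost in any step in the limit, so the constant \<open>2\<pi>\<close> is attained
  (\<open>fourier_ext_one_L4_ge\<close>).  Since equality for a general \<open>f\<close> forces equality in the energy
  inequality, \<open>|f|\<close> is constant for every maximizer.
\<close>

section \<open>The surface measure on the ambient space and its rotation invariance\<close>

text \<open>
  Lebesgue measure is determined by its values on boxes, so the invariance of the volume of
  measurable sets under orthogonal images is enough.
\<close>
lemma distr_lborel_orthogonal_transformation:
  fixes R :: "real^3 \<Rightarrow> real^3"
  assumes R: "orthogonal_transformation R"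
  shows "distr lborel borel R = lborel"
proof (rule lborel_eqI[symmetric])
  have lin: "linear R" and bij: "bij R"
    using R by (auto simp: orthogonal_transformation_linear orthogonal_transformation_bij)
  have [measurable]: "R \<in> borel_measurable borel"
    using lin by (intro borel_measurable_continuous_onI linear_continuous_on) (simp add: linear_linear)
  fix l u :: "real^3" assume lu: "\<And>b. b \<in> Basis \<Longrightarrow> l \<bullet> b \<le> u \<bullet> b"
  let ?V = "R -` box l u"
  have V: "?V = inv R ` box l u"
    using bij by (rule bij_vimage_eq_inv_image)
  have oi: "orthogonal_transformation (inv R)"
    using R orthogonal_transformation_inv by blast
  have "?V \<in> lmeasurable" "measure lebesgue ?V = measure lebesgue (box l u)"
    unfolding V using measurable_orthogonal_image[OF oi, of "box l u"] measure_orthogonal_image[OF oi, of "box l u"]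
    by auto
  moreover have "?V \<in> sets borel"
    using measurable_sets[of R borel borel "box l u"] by simp
  moreover have "emeasure lborel A = ennreal (measure lebesgue A)"
    if "A \<in> lmeasurable" "A \<in> sets borel" for A :: "(real^3) set"
    using that by (metis emeasure_eq_measure2 main_part sets_lborel emeasure_completion sets_completionI_sets)
  ultimately have "emeasure lborel ?V = emeasure lborel (box l u)"
    by (metis borel_open open_box lmeasurable_box)
  with lu show "emeasure (distr lborel borel R) (box l u) = (\<Prod>b\<in>Basis. (u - l) \<bullet> b)"
    by (simp add: emeasure_distr emeasure_lborel_box)
qed simp

text \<open>
  The surface measure regarded as a measure on all Borel sets of the ambient space, concentrated
  on the sphere.  Measurability then never refers to the trace of the Borel sets on the sphere.
\<close>
definition surf :: "(real^3) measure" where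
  "surf = distr \<sigma> borel (\<lambda>x. x)"

lemma sets_surf [simp, measurable_cong]: "sets surf = sets borel"
  and space_surf [simp]: "space surf = UNIV"
  by (simp_all add: surf_def)

lemma sets_sphere_measure: "sets \<sigma> = sets (restrict_space borel (sphere 0 1))"
  by (simp add: sphere_measure_def)

lemma id_measurable_sphere: "(\<lambda>x. x) \<in> borel_measurable \<sigma>"
  by (subst measurable_cong_sets[OF sets_sphere_measure refl])
     (auto intro: measurable_restrict_space1)

lemma emeasure_surf:
  assumes [measurable]: "A \<in> sets borel"
  shows "emeasure surf A = 3 * emeasure lborel {x \<in> ball 0 1 - {0}. sgn x \<in> A}"
proof -
  have S: "A \<inter> sphere 0 1 \<in> sets (restrict_space borel (sphere 0 1))"
    by (auto simp: sets_restrict_space)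
  have "emeasure surf A = emeasure \<sigma> (A \<inter> sphere 0 1)"
    by (simp add: surf_def emeasure_distr space_sphere_measure id_measurable_sphere)
  also have "\<dots> = 3 * emeasure (restrict_space lborel (ball 0 1 - {0::real^3}))
      (sgn -` (A \<inter> sphere 0 1) \<inter> (ball 0 1 - {0}))"
    unfolding sphere_measure_def using S
    by (subst emeasure_scale_measure, subst emeasure_distr[OF sgn_measurable_sphere])
       (auto simp: space_restrict_space)
  also have "sgn -` (A \<inter> sphere 0 1) \<inter> (ball 0 1 - {0}) = {x \<in> ball 0 1 - {0}. sgn x \<in> A}"
    by (auto simp: norm_sgn)
  finally show ?thesis
    by (subst (asm) emeasure_restrict_space) auto
qed

lemma emeasure_surf_UNIV: "emeasure surf UNIV = ennreal (4 * pi)"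
  using emeasure_sphere_total
  by (simp add: surf_def emeasure_distr space_sphere_measure id_measurable_sphere)

lemma finite_measure_surf: "finite_measure surf"
  by (rule finite_measureI) (simp add: emeasure_surf_UNIV)

interpretation surf: finite_measure surf by (rule finite_measure_surf)
interpretation surf_pair: pair_sigma_finite surf surf ..

lemma AE_surf_norm: "AE x in surf. norm x = 1"
  unfolding surf_def
  by (subst AE_distr_iff) (auto simp: space_sphere_measure id_measurable_sphere)

lemma nn_integral_surf_mono:
  assumes "\<And>x. norm x = 1 \<Longrightarrow> u x \<le> v x"
  shows "(\<integral>\<^sup>+x. u x \<partial>surf) \<le> (\<integral>\<^sup>+x. v x \<partial>surf)"
  using AE_surf_norm by (intro nn_integral_mono_AE) (auto elim!: eventually_mono intro: assms)

lemma nn_integral_surf_cong: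
  assumes "\<And>x. norm x = 1 \<Longrightarrow> u x = v x"
  shows "(\<integral>\<^sup>+x. u x \<partial>surf) = (\<integral>\<^sup>+x. v x \<partial>surf)"
  using assms by (intro antisym nn_integral_surf_mono) auto

lemma sgn_vimage_measurable:
  assumes A [measurable]: "A \<in> sets borel"
  shows "{x \<in> ball 0 1 - {0::real^3}. sgn x \<in> A} \<in> sets borel"
proof -
  have [measurable]: "(\<lambda>x::real^3. x /\<^sub>R norm x) \<in> borel_measurable borel"
    by measurable
  have "{x \<in> ball 0 1 - {0}. sgn x \<in> A} = (ball 0 1 - {0}) \<inter> (\<lambda>x::real^3. x /\<^sub>R norm x) -` A"
    by (auto simp: sgn_div_norm)
  also have "\<dots> \<in> sets borel"
    using measurable_sets[OF _ A, of "\<lambda>x::real^3. x /\<^sub>R norm x" borel] by auto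
  finally show ?thesis .
qed

lemma distr_surf_orthogonal_transformation:
  assumes R: "orthogonal_transformation R"
  shows "distr surf borel R = surf"
proof (rule measure_eqI)
  have lin: "linear R"
    using R by (auto simp: orthogonal_transformation_linear)
  have Rm [measurable]: "R \<in> borel_measurable borel"
    using lin by (intro borel_measurable_continuous_onI linear_continuous_on) (simp add: linear_linear)
  have n [simp]: "norm (R x) = norm x" for x
    using R by (simp add: orthogonal_transformation_norm)
  have s: "sgn (R x) = R (sgn x)" for x
    using lin by (simp add: sgn_div_norm linear_cmul)
  have z: "R x = 0 \<longleftrightarrow> x = 0" for x
    using n[of x] by (metis norm_eq_zero)
  fix A assume "A \<in> sets (distr surf borel R)"
  then have A [measurable]: "A \<in> sets borel" by simp
  have RA [measurable]: "R -` A \<in> sets borel"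
    using measurable_sets[OF Rm A] by simp
  have "emeasure (distr surf borel R) A = emeasure surf (R -` A)"
    using emeasure_distr[of R surf borel A] by simp
  also have "\<dots> = 3 * emeasure lborel {x \<in> ball 0 1 - {0}. sgn x \<in> R -` A}"
    by (rule emeasure_surf) measurable
  also have "{x \<in> ball 0 1 - {0}. sgn x \<in> R -` A} = R -` {x \<in> ball 0 1 - {0}. sgn x \<in> A}"
    by (auto simp: s z)
  also have "emeasure lborel \<dots> = emeasure (distr lborel borel R) {x \<in> ball 0 1 - {0}. sgn x \<in> A}"
    by (subst emeasure_distr) (simp_all add: sgn_vimage_measurable)
  also have "3 * \<dots> = emeasure surf A"
    by (simp add: distr_lborel_orthogonal_transformation[OF R] emeasure_surf)
  finally show "emeasure (distr surf borel R) A = emeasure surf A" .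
qed simp

lemma nn_integral_surf_orthogonal_transformation:
  assumes R: "orthogonal_transformation R" and [measurable]: "u \<in> borel_measurable borel"
  shows "(\<integral>\<^sup>+x. u (R x) \<partial>surf) = (\<integral>\<^sup>+x. u x \<partial>surf)"
proof -
  have [measurable]: "R \<in> borel_measurable borel"
    using orthogonal_transformation_linear[OF R]
    by (intro borel_measurable_continuous_onI linear_continuous_on) (simp add: linear_linear)
  have "(\<integral>\<^sup>+x. u x \<partial>surf) = (\<integral>\<^sup>+x. u x \<partial>distr surf borel R)"
    by (simp add: distr_surf_orthogonal_transformation[OF R])
  then show ?thesis
    by (simp add: nn_integral_distr[of R surf borel u])
qed

lemma nn_integral_surf_minus:
  assumes [measurable]: "u \<in> borel_measurable borel"
  shows "(\<integral>\<^sup>+x. u (- x) \<partial>surf) = (\<integral>\<^sup>+x. u x \<partial>surf)"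
  by (rule nn_integral_surf_orthogonal_transformation)
     (simp_all add: orthogonal_transformation_neg orthogonal_transformation_id[unfolded id_def])

section \<open>Areas of spherical caps\<close>

text \<open>
  Cylindrical coordinates around the first axis: a height and a point of the orthogonal plane.
  They allow volumes to be computed by integrating the areas of plane slices.
\<close>
definition cyl :: "real \<times> real \<times> real \<Rightarrow> real^3" where
  "cyl = (\<lambda>(h, a, b). h *\<^sub>R axis 1 1 + a *\<^sub>R axis 2 1 + b *\<^sub>R axis 3 1)"

lemma cyl_nth: "cyl (h, y) $ 1 = h" "cyl (h, y) $ 2 = fst y" "cyl (h, y) $ 3 = snd y"
  by (auto simp: cyl_def axis_def split: prod.splits)

lemma cyl_measurable [measurable]: "cyl \<in> borel_measurable borel"
  unfolding cyl_def borel_prod[symmetric] by measurable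

lemma norm_cyl: "norm (cyl (h, y)) = sqrt (h\<^sup>2 + (norm y)\<^sup>2)"
  by (cases y) (simp add: norm_vec_def L2_set_def sum_3 cyl_nth norm_Pair add.assoc)

lemma distr_lborel_cyl: "distr lborel borel cyl = lborel"
proof (rule lborel_eqI[symmetric])
  fix l u :: "real^3" assume lu: "\<And>b. b \<in> Basis \<Longrightarrow> l \<bullet> b \<le> u \<bullet> b"
  have le: "l $ i \<le> u $ i" for i
    using lu[of "axis i 1"] by (simp add: inner_axis axis_in_Basis_iff)
  have B: "(Basis :: (real^3) set) = (\<lambda>i. axis i 1) ` UNIV"
    by (auto simp: Basis_vec_def)
  have inj: "inj (\<lambda>i::3. axis i (1::real))"
    by (auto simp: inj_on_def axis_eq_axis)
  have "(\<Prod>b\<in>Basis. (u - l) \<bullet> b) = (\<Prod>i\<in>UNIV. (u - l) $ i)"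
    unfolding B prod.reindex[OF inj] by (simp add: inner_axis)
  then have P: "(\<Prod>b\<in>Basis. (u - l) \<bullet> b) = (u $ 1 - l $ 1) * ((u $ 2 - l $ 2) * (u $ 3 - l $ 3))"
    unfolding UNIV_3 by simp
  have "cyl -` box l u = {l$1<..<u$1} \<times> ({l$2<..<u$2} \<times> {l$3<..<u$3})"
    by (auto simp: mem_box_cart forall_3 cyl_nth)
  then have "emeasure (distr lborel borel cyl) (box l u)
      = emeasure (lborel \<Otimes>\<^sub>M (lborel \<Otimes>\<^sub>M lborel)) ({l$1<..<u$1} \<times> ({l$2<..<u$2} \<times> {l$3<..<u$3}))"
    by (simp add: emeasure_distr lborel_prod)
  also have "\<dots> = ennreal (u $ 1 - l $ 1) * (ennreal (u $ 2 - l $ 2) * ennreal (u $ 3 - l $ 3))"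
    by (subst lborel_prod, subst lborel.emeasure_pair_measure_Times)
       (simp_all add: lborel_prod[symmetric] lborel.emeasure_pair_measure_Times le)
  also have "\<dots> = ennreal (\<Prod>b\<in>Basis. (u - l) \<bullet> b)"
    unfolding P using le by (simp add: ennreal_mult)
  finally show "emeasure (distr lborel borel cyl) (box l u) = (\<Prod>b\<in>Basis. (u - l) \<bullet> b)" .
qed simp

lemma emeasure_lborel_slices:
  fixes A :: "(real^3) set"
  assumes [measurable]: "A \<in> sets borel"
  shows "emeasure lborel A = (\<integral>\<^sup>+h. emeasure lborel {y. cyl (h, y) \<in> A} \<partial>lborel)"
proof -
  have m: "cyl -` A \<in> sets borel"
    using measurable_sets[OF cyl_measurable assms] by simp
  have "emeasure lborel A = emeasure lborel (cyl -` A)"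
    by (subst distr_lborel_cyl[symmetric]) (simp add: emeasure_distr)
  also have "\<dots> = emeasure (lborel \<Otimes>\<^sub>M lborel) (cyl -` A)"
    by (simp add: lborel_prod)
  also have "\<dots> = (\<integral>\<^sup>+h. emeasure lborel (Pair h -` cyl -` A) \<partial>lborel)"
    using m by (intro lborel.emeasure_pair_measure_alt) (simp only: lborel_prod sets_lborel)
  finally show ?thesis
    by (simp add: vimage_def)
qed

lemma norm_less_iff_square: "0 \<le> r \<Longrightarrow> norm y < r \<longleftrightarrow> (norm y)\<^sup>2 < r\<^sup>2"
  by (meson norm_ge_zero power2_less_imp_less power_strict_mono zero_less_numeral)

lemma emeasure_ball_plane:
  "r \<ge> 0 \<Longrightarrow> emeasure lborel (ball (0::real \<times> real) r) = ennreal (pi * r\<^sup>2)"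
  by (subst emeasure_ball) (auto simp: unit_ball_vol_2 power2_eq_square)

text \<open>
  By definition the area of a cap is three times the volume of the sector of the unit ball over it.
  The slice of that sector at height \<open>h\<close> is a disc, bounded by the ball when \<open>h > t\<close> and by the
  cone when \<open>h < t\<close>.
\<close>
lemma emeasure_surf_axis_cap:
  assumes t: "0 \<le> t" "t < 1"
  shows "emeasure surf {x. x $ 1 > t} = ennreal (2 * pi * (1 - t))"
proof -
  let ?C = "{x \<in> ball 0 1 - {0::real^3}. sgn x \<in> {x. x $ 1 > t}}"
  have S [measurable]: "{x::real^3. x $ 1 > t} \<in> sets borel"
    by measurable
  have C: "cyl (h, y) \<in> ?C \<longleftrightarrow> 0 < h \<and> (norm y)\<^sup>2 < 1 - h\<^sup>2 \<and> t\<^sup>2 * (norm y)\<^sup>2 < (1 - t\<^sup>2) * h\<^sup>2" for h y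
  proof -
    have "cyl (h, y) \<in> ?C \<longleftrightarrow> cyl (h, y) \<noteq> 0 \<and> norm (cyl (h, y)) < 1 \<and> h > t * norm (cyl (h, y))"
      by (auto simp: sgn_div_norm cyl_nth field_simps)
    also have "\<dots> \<longleftrightarrow> 0 < h \<and> norm (cyl (h, y)) < 1 \<and> h > t * norm (cyl (h, y))"
    proof -
      have "0 < h" if "h > t * norm (cyl (h, y))"
        using that t by (meson le_less_trans mult_nonneg_nonneg norm_ge_zero)
      moreover have "cyl (h, y) \<noteq> 0" if "h > 0"
        using that cyl_nth(1)[of h y] by auto
      ultimately show ?thesis by auto
    qed
    also have "\<dots> \<longleftrightarrow> 0 < h \<and> (norm (cyl (h, y)))\<^sup>2 < 1\<^sup>2 \<and> (t * norm (cyl (h, y)))\<^sup>2 < h\<^sup>2"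
    proof -
      have "norm (cyl (h, y)) < 1 \<longleftrightarrow> (norm (cyl (h, y)))\<^sup>2 < 1\<^sup>2"
        by (simp add: abs_square_less_1)
      moreover have "t * norm (cyl (h, y)) < h \<longleftrightarrow> (t * norm (cyl (h, y)))\<^sup>2 < h\<^sup>2" if "0 < h"
        using that t by (meson mult_nonneg_nonneg norm_ge_zero less_imp_le power2_less_imp_less
            power_strict_mono zero_less_numeral)
      ultimately show ?thesis by blast
    qed
    also have "\<dots> \<longleftrightarrow> 0 < h \<and> (norm y)\<^sup>2 < 1 - h\<^sup>2 \<and> t\<^sup>2 * (norm y)\<^sup>2 < (1 - t\<^sup>2) * h\<^sup>2"
      by (auto simp: norm_cyl power_mult_distrib algebra_simps)
    finally show ?thesis .
  qed
  define D where "D h = {y. cyl (h, y) \<in> ?C}" for h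
  have slice: "emeasure lborel (D h) =
      ennreal (pi * (1 - h\<^sup>2)) * indicator {t..1} h + ennreal (pi * ((1 - t\<^sup>2) / t\<^sup>2 * h\<^sup>2)) * indicator {0..t} h"
    if h: "h \<noteq> 0" "h \<noteq> t" "h \<noteq> 1" for h
  proof -
    consider "h < 0" | "0 < h" "h < t" | "t < h" "0 < h" "h < 1" | "1 < h"
      using h t by linarith
    then show ?thesis
    proof cases
      case 2
      let ?r = "sqrt (1 - t\<^sup>2) / t * h"
      have t1: "t\<^sup>2 < 1" using t by (simp add: power_less_one_iff abs_square_less_1)
      have r2: "?r\<^sup>2 = (1 - t\<^sup>2) / t\<^sup>2 * h\<^sup>2"
        using t1 by (simp add: power_mult_distrib power_divide)
      have "(1 - t\<^sup>2) / t\<^sup>2 * h\<^sup>2 \<le> 1 - h\<^sup>2"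
      proof -
        have "h\<^sup>2 \<le> t\<^sup>2" using 2 by (intro power_mono) auto
        then have "(1 - t\<^sup>2) * h\<^sup>2 \<le> (1 - h\<^sup>2) * t\<^sup>2" by (simp add: algebra_simps)
        then show ?thesis using 2 by (simp add: field_simps)
      qed
      moreover have "t\<^sup>2 * (norm y)\<^sup>2 < (1 - t\<^sup>2) * h\<^sup>2 \<longleftrightarrow> (norm y)\<^sup>2 < (1 - t\<^sup>2) / t\<^sup>2 * h\<^sup>2" for y :: "real \<times> real"
        using 2 by (simp add: field_simps)
      moreover have r0: "?r \<ge> 0" using 2 t1 by simp
      ultimately have "cyl (h, y) \<in> ?C \<longleftrightarrow> y \<in> ball 0 ?r" for y
        unfolding C mem_ball_0 norm_less_iff_square[OF r0] r2 using \<open>0 < h\<close> by (meson less_le_trans)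
      then have "D h = ball 0 ?r"
        unfolding D_def by blast
      then show ?thesis
        using 2 r0 emeasure_ball_plane[of ?r] r2 by simp
    next
      case 3
      let ?r = "sqrt (1 - h\<^sup>2)"
      have h1: "h\<^sup>2 < 1" using 3 by (simp add: abs_square_less_1)
      have "t\<^sup>2 * (norm y)\<^sup>2 < (1 - t\<^sup>2) * h\<^sup>2" if "(norm y)\<^sup>2 < 1 - h\<^sup>2" for y :: "real \<times> real"
      proof -
        have "t\<^sup>2 < h\<^sup>2" using 3 t by (intro power_strict_mono) auto
        moreover have "t\<^sup>2 * (norm y)\<^sup>2 \<le> t\<^sup>2 * (1 - h\<^sup>2)" using that by (intro mult_left_mono) auto
        ultimately show ?thesis by (simp add: algebra_simps)
      qed
      moreover have "0 \<le> ?r" "?r\<^sup>2 = 1 - h\<^sup>2"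
        using h1 by simp_all
      ultimately have "cyl (h, y) \<in> ?C \<longleftrightarrow> y \<in> ball 0 ?r" for y
        unfolding C mem_ball_0 using 3 norm_less_iff_square[of ?r y] by metis
      then have "D h = ball 0 ?r"
        unfolding D_def by blast
      then show ?thesis
        using 3 h1 emeasure_ball_plane[of ?r] by simp
    next
      case 4
      have "1 < h\<^sup>2" using 4 by simp
      then have "cyl (h, y) \<notin> ?C" for y
        unfolding C using zero_le_power2[of "norm y"] by linarith
      then have "D h = {}" unfolding D_def by blast
      then show ?thesis using 4 t by simp
    next
      case 1
      then have "cyl (h, y) \<notin> ?C" for y
        unfolding C by linarith
      then have "D h = {}" unfolding D_def by blast
      then show ?thesis using 1 t by simp
    qed
  qed
  have [measurable]: "?C \<in> sets borel" by (rule sgn_vimage_measurable) simp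
  have "emeasure lborel ?C = (\<integral>\<^sup>+h. emeasure lborel (D h) \<partial>lborel)"
    unfolding D_def by (rule emeasure_lborel_slices) fact
  also have "\<dots> = (\<integral>\<^sup>+h. ennreal (pi * (1 - h\<^sup>2)) * indicator {t..1} h
      + ennreal (pi * ((1 - t\<^sup>2) / t\<^sup>2 * h\<^sup>2)) * indicator {0..t} h \<partial>lborel)"
    using AE_lborel_singleton[of 0] AE_lborel_singleton[of t] AE_lborel_singleton[of 1]
    by (intro nn_integral_cong_AE) (auto elim!: eventually_elim2 simp: slice)
  also have "\<dots> = (\<integral>\<^sup>+h. ennreal (pi * (1 - h\<^sup>2)) * indicator {t..1} h \<partial>lborel)
      + (\<integral>\<^sup>+h. ennreal (pi * ((1 - t\<^sup>2) / t\<^sup>2 * h\<^sup>2)) * indicator {0..t} h \<partial>lborel)"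
    by (rule nn_integral_add) measurable
  also have "(\<integral>\<^sup>+h. ennreal (pi * (1 - h\<^sup>2)) * indicator {t..1} h \<partial>lborel)
      = ennreal (pi * (1 - 1 ^ 3 / 3) - pi * (t - t ^ 3 / 3))"
    using t by (intro nn_integral_FTC_Icc[where F = "\<lambda>h. pi * (h - h ^ 3 / 3)"])
      (auto intro!: derivative_eq_intros mult_nonneg_nonneg mult_le_one simp: power2_eq_square)
  also have "(\<integral>\<^sup>+h. ennreal (pi * ((1 - t\<^sup>2) / t\<^sup>2 * h\<^sup>2)) * indicator {0..t} h \<partial>lborel)
      = ennreal (pi * ((1 - t\<^sup>2) / t\<^sup>2 * (t ^ 3 / 3)) - pi * ((1 - t\<^sup>2) / t\<^sup>2 * (0 ^ 3 / 3)))"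
  proof -
    have "(1 - t\<^sup>2) / t\<^sup>2 \<ge> 0"
      using t by (simp add: abs_square_le_1)
    moreover define c where "c = (1 - t\<^sup>2) / t\<^sup>2"
    ultimately show ?thesis
      unfolding c_def[symmetric] using t
      by (intro nn_integral_FTC_Icc[where F = "\<lambda>h. pi * (c * (h ^ 3 / 3))"])
        (auto intro!: derivative_eq_intros simp: power2_eq_square)
  qed
  also have "ennreal (pi * (1 - 1 ^ 3 / 3) - pi * (t - t ^ 3 / 3)) +
      ennreal (pi * ((1 - t\<^sup>2) / t\<^sup>2 * (t ^ 3 / 3)) - pi * ((1 - t\<^sup>2) / t\<^sup>2 * (0 ^ 3 / 3)))
      = ennreal (2 / 3 * pi * (1 - t))"
  proof -
    have a: "(1 - t\<^sup>2) / t\<^sup>2 * (t ^ 3 / 3) = (t - t ^ 3) / 3"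
      by (cases "t = 0") (auto simp: field_simps power2_eq_square power3_eq_cube)
    have b: "pi * (1 - 1 ^ 3 / 3) - pi * (t - t ^ 3 / 3) = pi * ((1 - t)\<^sup>2 * (t + 2) / 3)"
      by (simp add: power2_eq_square power3_eq_cube field_simps)
    have c: "pi * ((t - t ^ 3) / 3) - pi * ((1 - t\<^sup>2) / t\<^sup>2 * (0 ^ 3 / 3)) = pi * (t * (1 - t) * (1 + t) / 3)"
      by (simp add: power3_eq_cube field_simps)
    have d: "pi * ((1 - t)\<^sup>2 * (t + 2) / 3) + pi * (t * (1 - t) * (1 + t) / 3) = 2 / 3 * pi * (1 - t)"
      by (simp add: power2_eq_square field_simps)
    show ?thesis unfolding a b c d[symmetric] using t
      by (intro ennreal_plus[symmetric]) auto
  qed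
  finally have "emeasure lborel ?C = ennreal (2 / 3 * pi * (1 - t))" .
  then show ?thesis
    by (subst emeasure_surf)
       (use t in \<open>auto simp: ennreal_mult[symmetric] simp flip: ennreal_numeral\<close>)
qed

lemma ex_orthogonal_transformation_axis:
  fixes e :: "real^3" assumes "norm e = 1"
  shows "\<exists>R :: real^3 \<Rightarrow> real^3. orthogonal_transformation R \<and> (\<forall>x. R x \<bullet> e = x $ 1)"
proof -
  obtain R :: "real^3 \<Rightarrow> real^3" where R: "orthogonal_transformation R" "R (axis 1 1) = e"
    by (rule orthogonal_transformation_exists[of "axis 1 1 :: real^3" e]) (auto simp: assms)
  have "R x \<bullet> e = x $ 1" for x
    using R by (metis orthogonal_transformation_def inner_axis inner_real_def mult.right_neutral)
  with R show ?thesis by blast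
qed

text \<open>
  Archimedes: the height above any plane through the centre is uniformly distributed.  Rotations
  reduce a cap of at most half the sphere to the preceding lemma.  A larger cap is the complement of
  a closed cap of the opposite pole, which is squeezed between open caps.
\<close>
lemma emeasure_surf_cap:
  assumes e: "norm e = 1" and t: "-1 \<le> t" "t \<le> 1"
  shows "emeasure surf {x. x \<bullet> e > t} = ennreal (2 * pi * (1 - t))"
proof -
  have pos: "emeasure surf {x. x \<bullet> e > t} = ennreal (2 * pi * (1 - t))"
    if t: "0 \<le> t" "t < 1" and e: "norm e = 1" for t and e :: "real^3"
  proof -
    obtain R :: "real^3 \<Rightarrow> real^3" where R: "orthogonal_transformation R" "\<And>x. R x \<bullet> e = x $ 1"
      using ex_orthogonal_transformation_axis[OF e] by blast
    have [measurable]: "R \<in> borel_measurable borel"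
      using orthogonal_transformation_linear[OF R(1)]
      by (intro borel_measurable_continuous_onI linear_continuous_on) (simp add: linear_linear)
    have "emeasure surf {x. x \<bullet> e > t} = emeasure (distr surf borel R) {x. x \<bullet> e > t}"
      by (simp only: distr_surf_orthogonal_transformation[OF R(1)])
    also have "\<dots> = emeasure surf (R -` {x. x \<bullet> e > t} \<inter> space surf)"
      by (rule emeasure_distr) measurable
    also have "R -` {x. x \<bullet> e > t} \<inter> space surf = {x. x $ 1 > t}"
      by (simp add: vimage_def R(2))
    finally show ?thesis using emeasure_surf_axis_cap[OF t] by simp
  qed
  have meas [measurable]: "{x. x \<bullet> f > t} \<in> sets borel" "{x. x \<bullet> f \<ge> t} \<in> sets borel" for f :: "real^3" and t
    by measurable
  have one: "emeasure surf {x. x \<bullet> e > 1} = 0"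
  proof -
    have "AE x in surf. \<not> x \<bullet> e > 1"
      using AE_surf_norm by eventually_elim (metis e mult.right_neutral norm_cauchy_schwarz not_less)
    then show ?thesis by (subst (asm) AE_iff_measurable[OF _ refl]) auto
  qed
  consider "t = 1" | "0 \<le> t" "t < 1" | "t < 0"
    using t by linarith
  then show ?thesis
  proof cases
    case 1 then show ?thesis using one by simp
  next
    case 2 then show ?thesis by (rule pos[OF _ _ e])
  next
    case 3
    let ?D = "{x. x \<bullet> (- e) \<ge> - t}"
    have ge: "measure surf ?D \<le> 2 * pi * (1 + t) + \<epsilon>" if "\<epsilon> > 0" for \<epsilon>
    proof -
      define d where "d = \<epsilon> / (2 * pi)"
      have d: "d > 0" "\<epsilon> = 2 * pi * d" using that by (auto simp: d_def)
      define u where "u = max 0 (- t - d)"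
      have u: "0 \<le> u" "u < - t" "u < 1" "- t - u \<le> d"
        using 3 t d by (auto simp: u_def)
      have "emeasure surf ?D \<le> emeasure surf {x. x \<bullet> (- e) > u}"
        using u by (intro emeasure_mono) auto
      also have "\<dots> = ennreal (2 * pi * (1 - u))"
        using u e by (intro pos) auto
      finally have "measure surf ?D \<le> 2 * pi * (1 - u)"
        using u by (simp add: surf.emeasure_eq_measure)
      also have "\<dots> \<le> 2 * pi * (1 + t) + \<epsilon>"
        using mult_left_mono[OF u(4), of "2 * pi"] by (simp add: d(2) algebra_simps)
      finally show ?thesis .
    qed
    have le: "2 * pi * (1 + t) \<le> measure surf ?D"
    proof (cases "t = -1")
      case False
      then have "ennreal (2 * pi * (1 - (- t))) = emeasure surf {x. x \<bullet> (- e) > - t}"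
        using 3 t e by (intro pos[symmetric]) auto
      also have "\<dots> \<le> emeasure surf ?D"
        by (intro emeasure_mono) auto
      finally show ?thesis by (simp add: surf.emeasure_eq_measure)
    qed simp
    have D: "measure surf ?D = 2 * pi * (1 + t)"
      by (rule antisym[OF field_le_epsilon[OF ge] le])
    have T: "measure surf UNIV = 4 * pi"
      using emeasure_surf_UNIV by (simp add: surf.emeasure_eq_measure)
    have "{x. x \<bullet> e > t} = UNIV - ?D" by auto
    then have "measure surf {x. x \<bullet> e > t} = 4 * pi - 2 * pi * (1 + t)"
      using surf.finite_measure_compl[of ?D] D T by simp
    also have "\<dots> = 2 * pi * (1 - t)"
      by (simp add: algebra_simps)
    finally show ?thesis
      by (simp add: surf.emeasure_eq_measure)
  qed
qed


lemma norm_diff_unit_sq: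
  fixes x y :: "'a :: real_inner" assumes "norm x = 1" "norm y = 1"
  shows "(norm (x - y))\<^sup>2 = 2 - 2 * (x \<bullet> y)"
  using assms by (simp add: power2_norm_eq_inner inner_diff inner_commute norm_eq_1)

text \<open>
  The theorem of Archimedes in terms of the chord \<open>r = |\<omega> - e|\<close>: since \<open>r\<^sup>2 = 2 - 2 \<omega> \<bullet> e\<close>, the
  points with chord less than \<open>r\<close> form a cap of area \<open>\<pi> r\<^sup>2\<close>.  In this form every later surface integral
  that depends on one distance only becomes an integral over \<open>0 \<le> r \<le> 2\<close> that can be written down in
  closed form.
\<close>
lemma distr_surf_chord:
  fixes e :: "real^3" assumes e: "norm e = 1"
  shows "distr surf borel (\<lambda>\<omega>. norm (\<omega> - e)) = density lborel (\<lambda>r. ennreal (2 * pi * r) * indicator {0..2} r)"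
    (is "?M = ?N")
proof (rule measure_eqI_lessThan)
  fix x :: real
  show "emeasure ?M {x<..} < \<infinity>"
    by (subst emeasure_distr) (auto simp: surf.emeasure_eq_measure)
  have M: "emeasure ?M {x<..} = emeasure surf {\<omega>. norm (\<omega> - e) > x}"
    by (subst emeasure_distr) (auto simp: vimage_def)
  define y where "y = max 0 (min x 2)"
  have y: "0 \<le> y" "y \<le> 2" by (auto simp: y_def)
  have "emeasure ?N {x<..} = (\<integral>\<^sup>+r. ennreal (2 * pi * r) * indicator {0..2} r * indicator {x<..} r \<partial>lborel)"
    by (subst emeasure_density) (auto simp: mult.assoc)
  also have "\<dots> = (\<integral>\<^sup>+r. ennreal (2 * pi * r) * indicator {y..2} r \<partial>lborel)"
    using AE_lborel_singleton[of x] AE_lborel_singleton[of 2]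
    by (intro nn_integral_cong_AE, eventually_elim) (auto simp: y_def indicator_def)
  also have "\<dots> = ennreal (pi * 2\<^sup>2 - pi * y\<^sup>2)"
    using y by (intro nn_integral_FTC_Icc[where F = "\<lambda>r. pi * r\<^sup>2"]) (auto intro!: derivative_eq_intros)
  finally have N: "emeasure ?N {x<..} = ennreal (pi * 2\<^sup>2 - pi * y\<^sup>2)" .
  show "emeasure ?M {x<..} = emeasure ?N {x<..}"
  proof (cases "x < 0")
    case True
    then have "{\<omega>. norm (\<omega> - e) > x} = UNIV"
      by (auto intro: less_le_trans)
    then show ?thesis
      unfolding M N using True by (simp add: emeasure_surf_UNIV y_def)
  next
    case False
    have D: "norm (\<omega> - e) > x \<longleftrightarrow> \<omega> \<bullet> (- e) > y\<^sup>2 / 2 - 1" if \<omega>: "norm \<omega> = 1" for \<omega>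
    proof -
      have "norm (\<omega> - e) \<le> 2"
        using \<omega> e norm_triangle_ineq4[of \<omega> e] by auto
      then have "norm (\<omega> - e) > x \<longleftrightarrow> norm (\<omega> - e) > y"
        using False by (auto simp: y_def)
      also have "\<dots> \<longleftrightarrow> (norm (\<omega> - e))\<^sup>2 > y\<^sup>2"
        using y(1) by (meson norm_ge_zero power2_less_imp_less power_strict_mono zero_less_numeral)
      also have "\<dots> \<longleftrightarrow> \<omega> \<bullet> (- e) > y\<^sup>2 / 2 - 1"
        by (auto simp: norm_diff_unit_sq[OF \<omega> e])
      finally show ?thesis .
    qed
    have "emeasure surf {\<omega>. norm (\<omega> - e) > x} = emeasure surf {\<omega>. \<omega> \<bullet> (- e) > y\<^sup>2 / 2 - 1}"
      using AE_surf_norm by (intro emeasure_eq_AE) (auto elim!: eventually_mono simp: D)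
    also have "\<dots> = ennreal (2 * pi * (1 - (y\<^sup>2 / 2 - 1)))"
      using e y power_mono[OF y(2) y(1), of 2] by (intro emeasure_surf_cap) auto
    also have "2 * pi * (1 - (y\<^sup>2 / 2 - 1)) = pi * 2\<^sup>2 - pi * y\<^sup>2"
      by (simp add: field_simps)
    finally show ?thesis unfolding M N .
  qed
qed simp_all

lemma nn_integral_surf_chord:
  fixes e :: "real^3" assumes e: "norm e = 1" and [measurable]: "u \<in> borel_measurable borel"
  shows "(\<integral>\<^sup>+\<omega>. u (norm (\<omega> - e)) \<partial>surf) = (\<integral>\<^sup>+r. ennreal (2 * pi * r) * indicator {0..2} r * u r \<partial>lborel)"
proof -
  have "(\<integral>\<^sup>+\<omega>. u (norm (\<omega> - e)) \<partial>surf) = (\<integral>\<^sup>+r. u r \<partial>distr surf borel (\<lambda>\<omega>. norm (\<omega> - e)))"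
    by (rule nn_integral_distr[symmetric]) measurable
  then show ?thesis
    by (simp add: distr_surf_chord[OF e] nn_integral_density)
qed

section \<open>Gaussian-weighted square norms of oscillatory integrals\<close>

text \<open>
  The Fourier transform of \<open>exp (- s\<^sup>2 |x|\<^sup>2 / 2)\<close> on \<open>\<real>\<^sup>3\<close>.  It has total mass \<open>(2\<pi>)\<^sup>3\<close> and concentrates
  at the origin as \<open>s\<close> tends to \<open>0\<close>.
\<close>
definition gauss_hat :: "real \<Rightarrow> real^3 \<Rightarrow> real" where
  "gauss_hat s y = (sqrt (2 * pi) / s) ^ 3 * exp (- (norm y)\<^sup>2 / (2 * s\<^sup>2))"

lemma gauss_hat_measurable [measurable]: "gauss_hat s \<in> borel_measurable borel"
  unfolding gauss_hat_def[abs_def] by measurable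

lemma gauss_hat_pos: "s > 0 \<Longrightarrow> gauss_hat s y > 0"
  by (simp add: gauss_hat_def)

text \<open>
  Rescaling reduces this to the characteristic function of the standard normal distribution.
\<close>
lemma fourier_gaussian_real:
  fixes y s :: real assumes s: "s > 0"
  shows "integrable lborel (\<lambda>x. exp (- \<i> * complex_of_real (x * y)) * complex_of_real (exp (- s\<^sup>2 * x\<^sup>2 / 2)))"
    and "(LINT x|lborel. exp (- \<i> * complex_of_real (x * y)) * complex_of_real (exp (- s\<^sup>2 * x\<^sup>2 / 2)))
      = complex_of_real (sqrt (2 * pi) / s * exp (- y\<^sup>2 / (2 * s\<^sup>2)))"
proof -
  let ?g = "\<lambda>x. exp (- \<i> * complex_of_real (x * y)) * complex_of_real (exp (- s\<^sup>2 * x\<^sup>2 / 2))"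
  let ?h = "\<lambda>x. complex_of_real (std_normal_density x) * iexp ((- y / s) * x)"
  have "char std_normal_distribution (- y / s) = complex_of_real (exp (- (- y / s)\<^sup>2 / 2))"
    by (simp add: char_std_normal_distribution)
  then have h: "(LINT x|lborel. ?h x) = complex_of_real (exp (- (- y / s)\<^sup>2 / 2))"
    unfolding char_def by (subst (asm) integral_density) (auto simp: scaleR_conv_of_real)
  have hi: "integrable lborel ?h"
    by (rule Bochner_Integration.integrable_bound[OF integrable_std_normal_moment[of 0]])
       (auto simp: norm_mult)
  have gh: "?g x = complex_of_real (sqrt (2 * pi)) * ?h (0 + s * x)" for x
    using s by (simp add: normal_density_def power_mult_distrib exp_of_real algebra_simps flip: of_real_mult)
  have "integrable lborel (\<lambda>x. ?h (0 + s * x))"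
    using hi s by (intro lborel_integrable_real_affine) auto
  then show "integrable lborel ?g"
    unfolding gh by (rule integrable_mult_right)
  have "(LINT x|lborel. ?h x) = \<bar>s\<bar> *\<^sub>R (LINT x|lborel. ?h (0 + s * x))"
    using s by (intro lborel_integral_real_affine) auto
  then show "(LINT x|lborel. ?g x) = complex_of_real (sqrt (2 * pi) / s * exp (- y\<^sup>2 / (2 * s\<^sup>2)))"
    unfolding gh integral_mult_right_zero
    using s h by (simp add: scaleR_conv_of_real field_simps power_divide)
qed

text \<open>
  Fubini's theorem for products of functions of one coordinate, obtained from the description of
  Lebesgue measure as a product measure over the basis.
\<close>
lemma lborel_vec_integral_prod:
  fixes f :: "3 \<Rightarrow> real \<Rightarrow> complex"
  assumes f: "\<And>i. integrable lborel (f i)"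
  shows "integrable lborel (\<lambda>x::real^3. \<Prod>i\<in>UNIV. f i (x $ i))"
    and "(LINT x|(lborel :: (real^3) measure). (\<Prod>i\<in>UNIV. f i (x $ i))) = (\<Prod>i\<in>UNIV. (LINT x|lborel. f i x))"
proof -
  interpret product_sigma_finite "\<lambda>_::real^3. lborel :: real measure" ..
  have [measurable]: "f i \<in> borel_measurable borel" for i
    using borel_measurable_integrable[OF f[of i]] by simp
  have inj: "inj (\<lambda>i::3. axis i (1::real))"
    by (auto simp: inj_on_def axis_eq_axis)
  have B: "(Basis :: (real^3) set) = range (\<lambda>i. axis i 1)"
    by (auto simp: Basis_vec_def)
  define g where "g b = f (inv (\<lambda>i::3. axis i (1::real)) b)" for b
  have g: "g (axis i 1) = f i" for i
    by (simp add: g_def inv_f_f[OF inj])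
  have gi: "integrable lborel (g b)" for b
    unfolding g_def by (rule f)
  have P: "(\<Prod>i\<in>UNIV. f i ((\<Sum>b\<in>Basis. z b *\<^sub>R b) $ i)) = (\<Prod>b\<in>Basis. g b (z b))" for z :: "real^3 \<Rightarrow> real"
  proof -
    have "(\<Sum>b\<in>Basis. z b *\<^sub>R b) $ i = z (axis i 1)" for i
    proof -
      have "(\<Sum>b\<in>Basis. z b *\<^sub>R b) $ i = (\<Sum>b\<in>Basis. z b *\<^sub>R b) \<bullet> axis i 1"
        by (simp add: inner_axis)
      also have "\<dots> = z (axis i 1)"
        by (rule inner_sum_left_Basis) (simp add: axis_in_Basis_iff)
      finally show ?thesis .
    qed
    then show ?thesis
      unfolding B prod.reindex[OF inj] by (simp add: g)
  qed
  have m: "(\<lambda>x::real^3. \<Prod>i\<in>UNIV. f i (x $ i)) \<in> borel_measurable borel"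
    by measurable
  have s: "(\<lambda>z. \<Sum>b\<in>(Basis::(real^3) set). z b *\<^sub>R b) \<in> (\<Pi>\<^sub>M b\<in>Basis. lborel) \<rightarrow>\<^sub>M borel"
    by measurable
  show "integrable lborel (\<lambda>x::real^3. \<Prod>i\<in>UNIV. f i (x $ i))"
    unfolding lborel_eq[where 'a="real^3"] integrable_distr_eq[OF s m] P
    by (intro product_integrable_prod gi) simp
  show "(LINT x|(lborel :: (real^3) measure). (\<Prod>i\<in>UNIV. f i (x $ i))) = (\<Prod>i\<in>UNIV. (LINT x|lborel. f i x))"
    unfolding lborel_eq[where 'a="real^3"] integral_distr[OF s m] P
    by (subst product_integral_prod[OF _ gi]) (simp_all add: B prod.reindex[OF inj] g)
qed

lemma fourier_gaussian:
  fixes y :: "real^3" and s :: real assumes s: "s > 0"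
  shows "integrable lborel (\<lambda>x. exp (- \<i> * complex_of_real (x \<bullet> y)) * complex_of_real (exp (- s\<^sup>2 * (norm x)\<^sup>2 / 2)))"
    and "(LINT x|lborel. exp (- \<i> * complex_of_real (x \<bullet> y)) * complex_of_real (exp (- s\<^sup>2 * (norm x)\<^sup>2 / 2)))
      = complex_of_real (gauss_hat s y)"
proof -
  have n: "(norm x)\<^sup>2 = (\<Sum>i\<in>UNIV. (x $ i)\<^sup>2)" for x :: "real^3"
    by (simp add: norm_vec_def L2_set_def sum_nonneg)
  have eq: "exp (- \<i> * complex_of_real (x \<bullet> y)) * complex_of_real (exp (- s\<^sup>2 * (norm x)\<^sup>2 / 2))
    = (\<Prod>i\<in>UNIV. exp (- \<i> * complex_of_real (x $ i * y $ i)) * complex_of_real (exp (- s\<^sup>2 * (x $ i)\<^sup>2 / 2)))" for x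
    unfolding prod.distrib of_real_prod[symmetric] exp_sum[OF finite, symmetric] n inner_vec_def
    by (simp add: sum_distrib_left sum_divide_distrib sum_negf)
  have "complex_of_real (gauss_hat s y) = (\<Prod>i\<in>UNIV. complex_of_real (sqrt (2 * pi) / s * exp (- (y $ i)\<^sup>2 / (2 * s\<^sup>2))))"
    unfolding of_real_prod[symmetric] prod.distrib exp_sum[OF finite, symmetric] gauss_hat_def n
    by (simp add: sum_divide_distrib sum_negf)
  then show "(LINT x|lborel. exp (- \<i> * complex_of_real (x \<bullet> y)) * complex_of_real (exp (- s\<^sup>2 * (norm x)\<^sup>2 / 2)))
      = complex_of_real (gauss_hat s y)"
    unfolding eq by (subst lborel_vec_integral_prod(2)) (simp_all only: fourier_gaussian_real[OF s])
  show "integrable lborel (\<lambda>x. exp (- \<i> * complex_of_real (x \<bullet> y)) * complex_of_real (exp (- s\<^sup>2 * (norm x)\<^sup>2 / 2)))"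
    unfolding eq by (intro lborel_vec_integral_prod(1) fourier_gaussian_real[OF s])
qed


lemma (in pair_sigma_finite) integrable_tensor:
  fixes f g :: "_ \<Rightarrow> 'c :: {real_normed_field, banach, second_countable_topology}"
  assumes f: "integrable M1 f" and g: "integrable M2 g"
  shows "integrable (M1 \<Otimes>\<^sub>M M2) (\<lambda>z. f (fst z) * g (snd z))"
    and "(LINT z|(M1 \<Otimes>\<^sub>M M2). f (fst z) * g (snd z)) = (LINT x|M1. f x) * (LINT y|M2. g y)"
proof -
  have [measurable]: "f \<in> borel_measurable M1" "g \<in> borel_measurable M2"
    using f g by auto
  show *: "integrable (M1 \<Otimes>\<^sub>M M2) (\<lambda>z. f (fst z) * g (snd z))"
  proof (rule Fubini_integrable)
    show "integrable M1 (\<lambda>x. LINT y|M2. norm (f (fst (x, y)) * g (snd (x, y))))"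
      using f by (simp add: norm_mult)
    show "AE x in M1. integrable M2 (\<lambda>y. f (fst (x, y)) * g (snd (x, y)))"
      using g by simp
  qed measurable
  show "(LINT z|(M1 \<Otimes>\<^sub>M M2). f (fst z) * g (snd z)) = (LINT x|M1. f x) * (LINT y|M2. g y)"
    using integral_fst'[OF *] by simp
qed

text \<open>
  A regularized form of Plancherel's identity.  Writing \<open>|U|\<^sup>2 = U cnj U\<close> as a double integral and
  integrating first in \<open>x\<close> turns the weight into its Fourier transform.  The Gaussian weight makes
  everything absolutely integrable, so that Fubini's theorem is the only tool.
\<close>
lemma gaussian_energy:
  fixes \<mu> :: "'a measure" and \<Phi> :: "'a \<Rightarrow> complex" and v :: "'a \<Rightarrow> real^3" and s :: real
  defines "U \<equiv> \<lambda>x. LINT p|\<mu>. exp (- \<i> * complex_of_real (x \<bullet> v p)) * \<Phi> p"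
  assumes sf: "sigma_finite_measure \<mu>" and \<Phi>: "integrable \<mu> \<Phi>" and [measurable]: "v \<in> borel_measurable \<mu>"
    and s: "s > 0"
  shows "integrable lborel (\<lambda>x. (norm (U x))\<^sup>2 * exp (- s\<^sup>2 * (norm x)\<^sup>2 / 2))"
    and "integrable (\<mu> \<Otimes>\<^sub>M \<mu>) (\<lambda>z. \<Phi> (fst z) * cnj (\<Phi> (snd z)) * complex_of_real (gauss_hat s (v (fst z) - v (snd z))))"
    and "complex_of_real (LINT x|lborel. (norm (U x))\<^sup>2 * exp (- s\<^sup>2 * (norm x)\<^sup>2 / 2))
      = (LINT z|(\<mu> \<Otimes>\<^sub>M \<mu>). \<Phi> (fst z) * cnj (\<Phi> (snd z)) * complex_of_real (gauss_hat s (v (fst z) - v (snd z))))"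
proof -
  interpret sigma_finite_measure \<mu> by fact
  interpret \<mu>: pair_sigma_finite \<mu> \<mu> ..
  interpret P: pair_sigma_finite "lborel :: (real^3) measure" "\<mu> \<Otimes>\<^sub>M \<mu>" ..
  have [measurable]: "\<Phi> \<in> borel_measurable \<mu>" using \<Phi> by auto
  have [measurable]: "cnj \<in> borel_measurable borel"
    by (intro borel_measurable_continuous_onI continuous_intros)
  let ?e = "\<lambda>x y. exp (- \<i> * complex_of_real (x \<bullet> y))"
  let ?g = "\<lambda>x::real^3. complex_of_real (exp (- s\<^sup>2 * (norm x)\<^sup>2 / 2))"
  let ?F = "\<lambda>z. \<Phi> (fst z) * cnj (\<Phi> (snd z))"
  have F: "integrable (\<mu> \<Otimes>\<^sub>M \<mu>) ?F"
    using \<Phi> by (intro \<mu>.integrable_tensor) auto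
  have g: "integrable lborel ?g"
    using fourier_gaussian(1)[OF s, of 0] by simp
  define W where "W = (\<lambda>(x, z). ?e x (v (fst z) - v (snd z)) * ?g x * ?F z)"
  have W: "integrable (lborel \<Otimes>\<^sub>M (\<mu> \<Otimes>\<^sub>M \<mu>)) W"
  proof (rule Bochner_Integration.integrable_bound[OF P.integrable_tensor(1)[OF g F]])
    show "W \<in> borel_measurable (lborel \<Otimes>\<^sub>M (\<mu> \<Otimes>\<^sub>M \<mu>))"
      unfolding W_def by measurable
    show "AE q in lborel \<Otimes>\<^sub>M (\<mu> \<Otimes>\<^sub>M \<mu>). norm (W q) \<le> norm (?g (fst q) * ?F (snd q))"
      by (auto simp: W_def norm_mult)
  qed
  have U: "complex_of_real ((norm (U x))\<^sup>2 * exp (- s\<^sup>2 * (norm x)\<^sup>2 / 2)) = (LINT z|(\<mu> \<Otimes>\<^sub>M \<mu>). W (x, z))" for x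
  proof -
    have i: "integrable \<mu> (\<lambda>p. ?e x (v p) * \<Phi> p)"
      by (rule Bochner_Integration.integrable_bound[OF \<Phi>]) (auto simp: norm_mult)
    have c: "cnj (U x) = (LINT p|\<mu>. cnj (?e x (v p) * \<Phi> p))"
      unfolding U_def by (rule Bochner_Integration.integral_cnj[symmetric])
    have "complex_of_real ((norm (U x))\<^sup>2) = U x * cnj (U x)"
      by (rule complex_norm_square)
    also have "\<dots> = (LINT z|(\<mu> \<Otimes>\<^sub>M \<mu>). (?e x (v (fst z)) * \<Phi> (fst z)) * cnj (?e x (v (snd z)) * \<Phi> (snd z)))"
      unfolding c unfolding U_def by (rule \<mu>.integrable_tensor(2)[OF i integrable_cnj[OF i], symmetric])
    also have "\<dots> = (LINT z|(\<mu> \<Otimes>\<^sub>M \<mu>). ?e x (v (fst z) - v (snd z)) * ?F z)"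
      by (intro Bochner_Integration.integral_cong)
         (simp_all add: exp_cnj inner_diff_right exp_diff exp_minus field_simps)
    finally show ?thesis
      by (simp add: W_def mult_ac flip: integral_mult_right_zero)
  qed
  have Wg: "(LINT x|lborel. W (x, z)) = ?F z * complex_of_real (gauss_hat s (v (fst z) - v (snd z)))" for z
    unfolding W_def prod.case Bochner_Integration.integral_mult_left_zero fourier_gaussian(2)[OF s]
    by (rule mult.commute)
  have "integrable lborel (\<lambda>x. complex_of_real ((norm (U x))\<^sup>2 * exp (- s\<^sup>2 * (norm x)\<^sup>2 / 2)))"
    unfolding U by (rule P.integrable_fst'[OF W])
  then show "integrable lborel (\<lambda>x. (norm (U x))\<^sup>2 * exp (- s\<^sup>2 * (norm x)\<^sup>2 / 2))"
    unfolding complex_of_real_integrable_eq .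
  show "integrable (\<mu> \<Otimes>\<^sub>M \<mu>) (\<lambda>z. ?F z * complex_of_real (gauss_hat s (v (fst z) - v (snd z))))"
    unfolding Wg[symmetric] using W by (intro P.integrable_snd) (simp add: case_prod_unfold)
  show "complex_of_real (LINT x|lborel. (norm (U x))\<^sup>2 * exp (- s\<^sup>2 * (norm x)\<^sup>2 / 2))
      = (LINT z|(\<mu> \<Otimes>\<^sub>M \<mu>). ?F z * complex_of_real (gauss_hat s (v (fst z) - v (snd z))))"
    unfolding integral_complex_of_real[symmetric] U Wg[symmetric]
    using W by (subst P.Fubini_integral[symmetric]) (simp_all add: case_prod_unfold)
qed

section \<open>Convolution of a Gaussian with the chord between two points\<close>

lemma gauss_hat_conv_normal:
  assumes s: "s > 0"
  shows "2 * pi * (sqrt (2 * pi) / s) ^ 3 * s\<^sup>2 * exp (- x\<^sup>2 / (2 * s\<^sup>2)) = (2 * pi) ^ 3 * normal_density 0 s x"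
proof -
  have "sqrt (2 * pi * s\<^sup>2) = sqrt (2 * pi) * s"
    using s by (simp add: real_sqrt_mult)
  moreover have "(2 * pi) ^ 3 = 2 * pi * (sqrt (2 * pi) ^ 3 * sqrt (2 * pi))"
    by (simp add: power3_eq_cube mult.assoc)
  ultimately show ?thesis
    using s by (simp add: normal_density_def power3_eq_cube power2_eq_square field_simps)
qed

lemma norm_scaled_unit_diff:
  fixes x y :: "'a :: real_inner" assumes "norm x = 1" "norm y = 1"
  shows "(norm (r *\<^sub>R x - q *\<^sub>R y))\<^sup>2 = (r - q)\<^sup>2 + r * q * (norm (x - y))\<^sup>2"
proof -
  have "(norm (r *\<^sub>R x - q *\<^sub>R y))\<^sup>2 = r\<^sup>2 + q\<^sup>2 - 2 * r * q * (x \<bullet> y)"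
    using assms unfolding power2_norm_eq_inner
    by (simp add: inner_diff inner_commute norm_eq_1 power2_eq_square algebra_simps)
  then show ?thesis
    unfolding norm_diff_unit_sq[OF assms] by (simp add: power2_eq_square algebra_simps)
qed

text \<open>
  Only the chord \<open>\<rho>\<close> between \<open>\<eta>\<close> and \<open>z / |z|\<close> enters, as
  \<open>|r \<eta> - z|\<^sup>2 = (r - |z|)\<^sup>2 + r |z| \<rho>\<^sup>2\<close>.  Its density \<open>2\<pi>\<rho>\<close> is, up to a constant, the inner
  derivative of the Gaussian, so the integral is elementary.  The factor \<open>|z|\<close> clears the denominator
  of the result.
\<close>
lemma sphere_mean_gauss_hat:
  fixes z :: "real^3"
  assumes r: "r > 0" and s: "s > 0"
  shows "(\<integral>\<^sup>+\<eta>. ennreal (norm z * gauss_hat s (r *\<^sub>R \<eta> - z)) \<partial>surf)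
    = ennreal ((2 * pi) ^ 3 / r * (normal_density 0 s (norm z - r) - normal_density 0 s (norm z + r)))"
proof (cases "z = 0")
  case True
  then show ?thesis by (simp add: normal_density_def)
next
  case False
  define q where "q = norm z"
  define e where "e = z /\<^sub>R q"
  have q: "q > 0" and e: "norm e = 1" and z: "z = q *\<^sub>R e"
    using False by (auto simp: q_def e_def)
  define C where "C = (sqrt (2 * pi) / s) ^ 3"
  have C: "C > 0" using s by (simp add: C_def)
  let ?u = "\<lambda>\<rho>. q * (C * exp (- ((r - q)\<^sup>2 + r * q * \<rho>\<^sup>2) / (2 * s\<^sup>2)))"
  let ?F = "\<lambda>\<rho>. - (2 * pi * C * s\<^sup>2 / r * exp (- ((r - q)\<^sup>2 + r * q * \<rho>\<^sup>2) / (2 * s\<^sup>2)))"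
  have "(\<integral>\<^sup>+\<eta>. ennreal (norm z * gauss_hat s (r *\<^sub>R \<eta> - z)) \<partial>surf)
      = (\<integral>\<^sup>+\<eta>. ennreal (?u (norm (\<eta> - e))) \<partial>surf)"
    unfolding gauss_hat_def q_def[symmetric]
    by (intro nn_integral_surf_cong) (simp add: z norm_scaled_unit_diff e C_def)
  also have "\<dots> = (\<integral>\<^sup>+\<rho>. ennreal (2 * pi * \<rho>) * indicator {0..2} \<rho> * ennreal (?u \<rho>) \<partial>lborel)"
    by (rule nn_integral_surf_chord[OF e]) measurable
  also have "\<dots> = (\<integral>\<^sup>+\<rho>. ennreal (2 * pi * \<rho> * ?u \<rho>) * indicator {0..2} \<rho> \<partial>lborel)"
    using q C by (intro nn_integral_cong) (auto simp: indicator_def ennreal_mult)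
  also have "\<dots> = ennreal (?F 2 - ?F 0)"
    using q C r s
    by (intro nn_integral_FTC_Icc[where F = ?F])
       (auto intro!: derivative_eq_intros simp: field_simps power2_eq_square)
  also have "?F 2 - ?F 0 = (2 * pi * C * s\<^sup>2 * exp (- (q - r)\<^sup>2 / (2 * s\<^sup>2)) - 2 * pi * C * s\<^sup>2 * exp (- (q + r)\<^sup>2 / (2 * s\<^sup>2))) / r"
  proof -
    have "(r - q)\<^sup>2 + r * q * 2\<^sup>2 = (q + r)\<^sup>2" "(r - q)\<^sup>2 + r * q * 0\<^sup>2 = (q - r)\<^sup>2"
      by (simp_all add: power2_eq_square algebra_simps)
    then show ?thesis by (simp add: diff_divide_distrib)
  qed
  also have "\<dots> = (2 * pi) ^ 3 / r * (normal_density 0 s (q - r) - normal_density 0 s (q + r))"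
    unfolding C_def gauss_hat_conv_normal[OF s] by (simp add: right_diff_distrib diff_divide_distrib)
  finally show ?thesis by (simp add: q_def)
qed

text \<open>
  For \<open>0 < r < 2\<close> this tends to \<open>r\<close> as \<open>s\<close> tends to \<open>0\<close>: the normal density around \<open>r\<close> picks the value
  \<open>q = r\<close>, and the other one has its peak outside the interval.
\<close>
definition chord_mass :: "real \<Rightarrow> real \<Rightarrow> ennreal" where
  "chord_mass s r = (\<integral>\<^sup>+q. ennreal (q * (normal_density 0 s (q - r) - normal_density 0 s (q + r))) * indicator {0..2} q \<partial>lborel)"

text \<open>
  The law of \<open>b - d\<close>, weighted by \<open>|b - d|\<close> and convolved with the Gaussian.  Without the convolution
  this would be the constant density \<open>2\<pi>\<close> on the ball of radius 2.
\<close>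
definition smoothed_diff :: "real \<Rightarrow> real^3 \<Rightarrow> ennreal" where
  "smoothed_diff s x = (\<integral>\<^sup>+b. (\<integral>\<^sup>+d. ennreal (norm (b - d) * gauss_hat s (x - (b - d))) \<partial>surf) \<partial>surf)"

lemma smoothed_diff_orthogonal:
  assumes R: "orthogonal_transformation R"
  shows "smoothed_diff s (R x) = smoothed_diff s x"
proof -
  have lin: "linear R" using R by (rule orthogonal_transformation_linear)
  have n: "norm (R x) = norm x" for x using R by (rule orthogonal_transformation_norm)
  have "smoothed_diff s (R x) = (\<integral>\<^sup>+b. (\<integral>\<^sup>+d. ennreal (norm (R b - d) * gauss_hat s (R x - (R b - d))) \<partial>surf) \<partial>surf)"
    unfolding smoothed_diff_def
    by (rule nn_integral_surf_orthogonal_transformation[OF R, symmetric]) measurable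
  also have "\<dots> = (\<integral>\<^sup>+b. (\<integral>\<^sup>+d. ennreal (norm (R b - R d) * gauss_hat s (R x - (R b - R d))) \<partial>surf) \<partial>surf)"
    by (intro nn_integral_cong nn_integral_surf_orthogonal_transformation[OF R, symmetric]) measurable
  also have "\<dots> = smoothed_diff s x"
    unfolding smoothed_diff_def gauss_hat_def by (simp add: linear_diff[OF lin, symmetric] n)
  finally show ?thesis .
qed

text \<open>
  By rotation invariance the value at \<open>x\<close> is its mean over the sphere of radius \<open>|x|\<close>.  Taking that
  mean first leaves a function of the chord \<open>|b - d|\<close> alone, whose density is known.
\<close>
lemma smoothed_diff_eq:
  assumes s: "s > 0"
  shows "ennreal (norm x) * smoothed_diff s x = ennreal ((2 * pi) ^ 4) * chord_mass s (norm x)"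
proof (cases "x = 0")
  case True
  then show ?thesis by (simp add: chord_mass_def)
next
  case False
  define r where "r = norm x"
  have r: "r > 0" using False by (simp add: r_def)
  let ?D = "\<lambda>q. normal_density 0 s (q - r) - normal_density 0 s (q + r)"
  \<comment> \<open>Any point of the sphere of radius \<open>r\<close> is the image of \<open>x\<close> under an orthogonal map.\<close>
  have const: "smoothed_diff s (r *\<^sub>R \<eta>) = smoothed_diff s x" if \<eta>: "norm \<eta> = 1" for \<eta>
  proof -
    obtain R :: "real^3 \<Rightarrow> real^3" where "orthogonal_transformation R" "R x = r *\<^sub>R \<eta>"
      by (rule orthogonal_transformation_exists[of x "r *\<^sub>R \<eta>"]) (auto simp: \<eta> r_def)
    then show ?thesis using smoothed_diff_orthogonal[of R s x] by simp
  qed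
  have "ennreal (4 * pi) * smoothed_diff s x = (\<integral>\<^sup>+\<eta>. smoothed_diff s x \<partial>surf)"
    by (simp add: emeasure_surf_UNIV mult.commute)
  also have "\<dots> = (\<integral>\<^sup>+\<eta>. smoothed_diff s (r *\<^sub>R \<eta>) \<partial>surf)"
    by (intro nn_integral_surf_cong) (simp add: const)
  also have "\<dots> = (\<integral>\<^sup>+b. (\<integral>\<^sup>+\<eta>. (\<integral>\<^sup>+d. ennreal (norm (b - d) * gauss_hat s (r *\<^sub>R \<eta> - (b - d))) \<partial>surf) \<partial>surf) \<partial>surf)"
    unfolding smoothed_diff_def by (rule surf_pair.Fubini') measurable
  also have "\<dots> = (\<integral>\<^sup>+b. (\<integral>\<^sup>+d. (\<integral>\<^sup>+\<eta>. ennreal (norm (b - d) * gauss_hat s (r *\<^sub>R \<eta> - (b - d))) \<partial>surf) \<partial>surf) \<partial>surf)"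
    by (intro nn_integral_cong surf_pair.Fubini') measurable
  also have "\<dots> = (\<integral>\<^sup>+b. (\<integral>\<^sup>+d. ennreal ((2 * pi) ^ 3 / r * ?D (norm (d - b))) \<partial>surf) \<partial>surf)"
    unfolding sphere_mean_gauss_hat[OF r s] by (simp add: norm_minus_commute)
  also have "\<dots> = (\<integral>\<^sup>+b. (\<integral>\<^sup>+q. ennreal (2 * pi * q) * indicator {0..2} q * ennreal ((2 * pi) ^ 3 / r * ?D q) \<partial>lborel) \<partial>surf)"
    by (intro nn_integral_surf_cong nn_integral_surf_chord) (simp, measurable)
  also have "(\<integral>\<^sup>+q. ennreal (2 * pi * q) * indicator {0..2} q * ennreal ((2 * pi) ^ 3 / r * ?D q) \<partial>lborel)
    = (\<integral>\<^sup>+q. ennreal ((2 * pi) ^ 4 / r) * (ennreal (q * ?D q) * indicator {0..2} q) \<partial>lborel)"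
  proof (intro nn_integral_cong)
    fix q :: real
    show "ennreal (2 * pi * q) * indicator {0..2} q * ennreal ((2 * pi) ^ 3 / r * ?D q)
      = ennreal ((2 * pi) ^ 4 / r) * (ennreal (q * ?D q) * indicator {0..2} q)"
    proof (cases "q \<in> {0..2}")
      case True
      then have "ennreal (2 * pi * q) * ennreal ((2 * pi) ^ 3 / r * ?D q) = ennreal (2 * pi * q * ((2 * pi) ^ 3 / r * ?D q))"
        by (intro ennreal_mult'[symmetric]) auto
      also have "2 * pi * q * ((2 * pi) ^ 3 / r * ?D q) = (2 * pi) ^ 4 / r * (q * ?D q)"
        by (simp add: power_numeral_reduce)
      also have "ennreal \<dots> = ennreal ((2 * pi) ^ 4 / r) * ennreal (q * ?D q)"
        using r by (intro ennreal_mult') auto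
      finally show ?thesis using True by simp
    qed simp
  qed
  also have "\<dots> = ennreal ((2 * pi) ^ 4 / r) * chord_mass s r"
    unfolding chord_mass_def by (rule nn_integral_cmult) measurable
  finally have "ennreal (4 * pi) * smoothed_diff s x = ennreal (4 * pi) * (ennreal ((2 * pi) ^ 4 / r) * chord_mass s r)"
    by (simp add: emeasure_surf_UNIV mult_ac)
  then have "smoothed_diff s x = ennreal ((2 * pi) ^ 4 / r) * chord_mass s r"
    by (subst (asm) ennreal_mult_cancel_left) auto
  then have "ennreal r * smoothed_diff s x = ennreal r * ennreal ((2 * pi) ^ 4 / r) * chord_mass s r"
    by (simp only: mult.assoc)
  also have "ennreal r * ennreal ((2 * pi) ^ 4 / r) = ennreal (r * ((2 * pi) ^ 4 / r))"
    using r by (intro ennreal_mult[symmetric]) auto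
  also have "r * ((2 * pi) ^ 4 / r) = (2 * pi) ^ 4"
    using r by simp
  finally show ?thesis
    by (simp only: r_def)
qed

lemma normal_density_shift:
  "normal_density 0 s (q - r) = normal_density r s q" "normal_density 0 s (q + r) = normal_density (- r) s q"
  by (simp_all add: normal_density_def)

lemma normal_density_antimono:
  assumes "s > 0" "0 \<le> r" "0 \<le> q"
  shows "normal_density 0 s (q + r) \<le> normal_density 0 s (q - r)"
proof -
  have "(q - r)\<^sup>2 \<le> (q + r)\<^sup>2"
    using assms by (simp add: power2_eq_square algebra_simps)
  then show ?thesis
    using assms by (simp add: normal_density_def divide_right_mono)
qed

text \<open>
  The integrand \<open>w\<close> of \<open>chord_mass\<close> is even and nonnegative, and its integral over the line is \<open>2 r\<close>, the
  difference of the means of the two normal densities.  So the integral over \<open>[0, 2]\<close> is at most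
  \<open>r\<close>, and what is missing is the tail beyond 2, which is bounded by a multiple of the variance \<open>s\<^sup>2\<close>
  of the density around \<open>r\<close>.
\<close>
lemma
  assumes s: "s > 0" and r: "0 \<le> r"
  shows chord_mass_le: "chord_mass s r \<le> ennreal r"
    and chord_mass_ge: "r < 2 \<Longrightarrow> ennreal r \<le> chord_mass s r + ennreal ((r / (2 - r)\<^sup>2 + 1 / (2 - r)) * s\<^sup>2)"
proof -
  define w where "w q = q * (normal_density 0 s (q - r) - normal_density 0 s (q + r))" for q
  have [measurable]: "w \<in> borel_measurable borel" unfolding w_def[abs_def] by measurable
  have even: "w (- q) = w q" for q
    by (simp add: w_def normal_density_def power2_commute algebra_simps power2_eq_square)
  have nonneg_pos: "w q \<ge> 0" if "q \<ge> 0" for q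
    using normal_density_antimono[OF s r that] that by (simp add: w_def)
  have nonneg: "w q \<ge> 0" for q
    using nonneg_pos[of q] nonneg_pos[of "- q"] even[of q] by (cases "q \<ge> 0") auto
  have "has_bochner_integral lborel (\<lambda>q. normal_density r s q * q - normal_density (- r) s q * q) (r - (- r))"
    by (intro has_bochner_integral_diff normal_moment_nz_1 s)
  then have "has_bochner_integral lborel w (2 * r)"
    by (simp add: w_def[abs_def] normal_density_shift algebra_simps)
  then have total: "(\<integral>\<^sup>+q. ennreal (w q) \<partial>lborel) = ennreal (2 * r)"
    using nonneg by (metis (mono_tags, lifting) AE_I2 has_bochner_integral_iff nn_integral_eq_integral)
  have P: "chord_mass s r = (\<integral>\<^sup>+q. ennreal (w q) * indicator {0..2} q \<partial>lborel)"
    by (simp add: chord_mass_def w_def)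
  have refl: "(\<integral>\<^sup>+q. ennreal (w q) * indicator (uminus ` A) q \<partial>lborel) = (\<integral>\<^sup>+q. ennreal (w q) * indicator A q \<partial>lborel)"
    if [measurable]: "A \<in> sets borel" "uminus ` A \<in> sets borel" for A :: "real set"
    by (subst nn_integral_real_affine[where c = "-1" and t = 0])
       (auto simp: even indicator_def intro!: nn_integral_cong)
  show "chord_mass s r \<le> ennreal r"
  proof -
    have "2 * chord_mass s r = chord_mass s r + chord_mass s r" by (simp add: mult_2)
    also have "\<dots> = (\<integral>\<^sup>+q. ennreal (w q) * indicator {-2..0} q \<partial>lborel) + (\<integral>\<^sup>+q. ennreal (w q) * indicator {0..2} q \<partial>lborel)"
      using refl[of "{0..2}"] by (simp add: P)
    also have "\<dots> = (\<integral>\<^sup>+q. ennreal (w q) * indicator {-2..0} q + ennreal (w q) * indicator {0..2} q \<partial>lborel)"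
      by (rule nn_integral_add[symmetric]) measurable
    also have "\<dots> \<le> (\<integral>\<^sup>+q. ennreal (w q) \<partial>lborel)"
      using AE_lborel_singleton[of 0]
      by (intro nn_integral_mono_AE, eventually_elim) (auto simp: indicator_def)
    also have "\<dots> = 2 * ennreal r"
      unfolding total using r by (simp add: ennreal_mult)
    finally show ?thesis
      using ennreal_mult_le_mult_iff[of 2 "chord_mass s r" "ennreal r"] by simp
  qed
  show "ennreal r \<le> chord_mass s r + ennreal ((r / (2 - r)\<^sup>2 + 1 / (2 - r)) * s\<^sup>2)" if r2: "r < 2"
  proof -
    define K where "K = r / (2 - r)\<^sup>2 + 1 / (2 - r)"
    have K: "K \<ge> 0" using r r2 by (simp add: K_def)
    define Q where "Q = (\<integral>\<^sup>+q. ennreal (w q) * indicator {0..} q \<partial>lborel)"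
    have "2 * ennreal r = (\<integral>\<^sup>+q. ennreal (w q) \<partial>lborel)"
      unfolding total using r by (simp add: ennreal_mult)
    also have "\<dots> = (\<integral>\<^sup>+q. ennreal (w q) * indicator {..0} q + ennreal (w q) * indicator {0..} q \<partial>lborel)"
      using AE_lborel_singleton[of 0]
      by (intro nn_integral_cong_AE, eventually_elim) (auto simp: indicator_def)
    also have "\<dots> = (\<integral>\<^sup>+q. ennreal (w q) * indicator {..0} q \<partial>lborel) + Q"
      unfolding Q_def by (rule nn_integral_add) measurable
    also have "(\<integral>\<^sup>+q. ennreal (w q) * indicator {..0} q \<partial>lborel) = Q"
      using refl[of "{0..}"] by (simp add: Q_def)
    finally have "2 * ennreal r = 2 * Q" by (simp add: mult_2)
    then have rQ: "ennreal r = Q"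
      by (simp add: ennreal_mult_cancel_left)
    \<comment> \<open>Beyond 2 the distance \<open>q - r\<close> is at least \<open>2 - r\<close>, so \<open>q\<close> is dominated by a multiple of
      \<open>(q - r)\<^sup>2\<close> and the tail by the second moment.\<close>
    have tail: "w q \<le> K * (normal_density r s q * (q - r)\<^sup>2)" if "q > 2" for q
    proof -
      define d where "d = 2 - r"
      have d: "d > 0" "q - r \<ge> d" using r2 that by (auto simp: d_def)
      have 1: "d * (q - r) \<le> (q - r)\<^sup>2" "d\<^sup>2 \<le> (q - r)\<^sup>2"
        using d by (auto simp: power2_eq_square intro: mult_mono mult_right_mono)
      have "q = r + (q - r)" by simp
      also have "\<dots> \<le> r * ((q - r)\<^sup>2 / d\<^sup>2) + (q - r)\<^sup>2 / d"
        using d 1 r by (intro add_mono mult_left_le) (auto simp: field_simps intro: mult_left_mono)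
      also have "\<dots> = K * (q - r)\<^sup>2"
        by (simp add: K_def d_def field_simps)
      finally have "q * normal_density r s q \<le> K * (q - r)\<^sup>2 * normal_density r s q"
        by (intro mult_right_mono) auto
      moreover have "w q \<le> q * normal_density r s q"
        using that by (simp add: w_def normal_density_shift algebra_simps)
      ultimately show ?thesis by (simp add: mult_ac)
    qed
    have mom: "has_bochner_integral lborel (\<lambda>q. normal_density r s q * (q - r)\<^sup>2) (s\<^sup>2)"
      using normal_moment_even[OF s, of r 1] s by simp
    have "Q \<le> (\<integral>\<^sup>+q. ennreal (w q) * indicator {0..2} q + ennreal K * ennreal (normal_density r s q * (q - r)\<^sup>2) \<partial>lborel)"
      unfolding Q_def using K tail
      by (intro nn_integral_mono) (auto simp: indicator_def ennreal_mult'[symmetric] not_le intro!: ennreal_leI)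
    also have "\<dots> = chord_mass s r + ennreal K * (\<integral>\<^sup>+q. ennreal (normal_density r s q * (q - r)\<^sup>2) \<partial>lborel)"
      unfolding P by (subst nn_integral_add, measurable, subst nn_integral_cmult) auto
    also have "(\<integral>\<^sup>+q. ennreal (normal_density r s q * (q - r)\<^sup>2) \<partial>lborel) = ennreal (s\<^sup>2)"
      using mom by (subst nn_integral_eq_integral) (auto simp: has_bochner_integral_iff)
    also have "ennreal K * ennreal (s\<^sup>2) = ennreal (K * s\<^sup>2)"
      using K by (simp add: ennreal_mult')
    finally show ?thesis by (simp add: rQ K_def)
  qed
qed

text \<open>
  The bound holds for every \<open>s\<close>, not only in the limit, so that it can be used inside the
  integral against any square integrable function.  It is applied with \<open>x\<close> the sum or difference of two points, whose
  length \<open>|x|\<close> is the other factor of the product of chords.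
\<close>
lemma smoothed_diff_le:
  assumes "s > 0"
  shows "ennreal (norm x) * smoothed_diff s x \<le> ennreal ((2 * pi) ^ 4) * ennreal (norm x)"
  unfolding smoothed_diff_eq[OF assms] using assms
  by (intro mult_left_mono chord_mass_le) auto

section \<open>The quadrilinear form\<close>

text \<open>
  Integrals over four points of the sphere are kept in iterated form, where a permutation of the
  variables is a sequence of adjacent exchanges.
\<close>
definition surf4 :: "(real^3 \<Rightarrow> real^3 \<Rightarrow> real^3 \<Rightarrow> real^3 \<Rightarrow> ennreal) \<Rightarrow> ennreal" where
  "surf4 u = (\<integral>\<^sup>+a. (\<integral>\<^sup>+b. (\<integral>\<^sup>+c. (\<integral>\<^sup>+d. u a b c d \<partial>surf) \<partial>surf) \<partial>surf) \<partial>surf)"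

abbreviation meas4 :: "(real^3 \<Rightarrow> real^3 \<Rightarrow> real^3 \<Rightarrow> real^3 \<Rightarrow> ennreal) \<Rightarrow> bool" where
  "meas4 u \<equiv> (\<lambda>(a, b, c, d). u a b c d) \<in> borel_measurable (borel \<Otimes>\<^sub>M (borel \<Otimes>\<^sub>M (borel \<Otimes>\<^sub>M borel)))"

lemma meas4_compose:
  assumes "meas4 u" "f1 \<in> borel_measurable M" "f2 \<in> borel_measurable M" "f3 \<in> borel_measurable M" "f4 \<in> borel_measurable M"
  shows "(\<lambda>x. u (f1 x) (f2 x) (f3 x) (f4 x)) \<in> borel_measurable M"
proof -
  have "(\<lambda>x. (f1 x, f2 x, f3 x, f4 x)) \<in> M \<rightarrow>\<^sub>M (borel \<Otimes>\<^sub>M (borel \<Otimes>\<^sub>M (borel \<Otimes>\<^sub>M borel)))"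
    using assms(2-) by measurable
  from measurable_compose[OF this assms(1)] show ?thesis by simp
qed

lemma surf4_mono:
  assumes "\<And>a b c d. norm a = 1 \<Longrightarrow> norm b = 1 \<Longrightarrow> norm c = 1 \<Longrightarrow> norm d = 1 \<Longrightarrow> u a b c d \<le> v a b c d"
  shows "surf4 u \<le> surf4 v"
  unfolding surf4_def by (intro nn_integral_surf_mono assms)

lemma surf4_add:
  assumes "meas4 u" "meas4 v"
  shows "surf4 (\<lambda>a b c d. u a b c d + v a b c d) = surf4 u + surf4 v"
proof -
  note [measurable (raw)] = meas4_compose[OF assms(1)] meas4_compose[OF assms(2)]
  show ?thesis
    unfolding surf4_def
    by (subst nn_integral_add[symmetric], measurable, intro nn_integral_cong,
        subst nn_integral_add[symmetric], measurable, intro nn_integral_cong,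
        subst nn_integral_add[symmetric], measurable, intro nn_integral_cong nn_integral_add) measurable
qed

lemma surf4_cmult:
  assumes "meas4 u"
  shows "surf4 (\<lambda>a b c d. K * u a b c d) = K * surf4 u"
proof -
  note [measurable (raw)] = meas4_compose[OF assms]
  show ?thesis
    unfolding surf4_def
    by (subst nn_integral_cmult[symmetric], measurable, intro nn_integral_cong,
        subst nn_integral_cmult[symmetric], measurable, intro nn_integral_cong,
        subst nn_integral_cmult[symmetric], measurable, intro nn_integral_cong nn_integral_cmult) measurable
qed

lemma
  assumes "meas4 u"
  shows surf4_swap12: "surf4 (\<lambda>a b c d. u b a c d) = surf4 u"
    and surf4_swap23: "surf4 (\<lambda>a b c d. u a c b d) = surf4 u"
    and surf4_swap34: "surf4 (\<lambda>a b c d. u a b d c) = surf4 u"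
proof -
  note [measurable (raw)] = meas4_compose[OF assms]
  show "surf4 (\<lambda>a b c d. u b a c d) = surf4 u"
    unfolding surf4_def by (rule surf_pair.Fubini') measurable
  show "surf4 (\<lambda>a b c d. u a c b d) = surf4 u"
    unfolding surf4_def by (intro nn_integral_cong surf_pair.Fubini') measurable
  show "surf4 (\<lambda>a b c d. u a b d c) = surf4 u"
    unfolding surf4_def by (intro nn_integral_cong surf_pair.Fubini') measurable
qed

lemma surf4_swap_pairs:
  assumes "meas4 u"
  shows "surf4 (\<lambda>a b c d. u c d a b) = surf4 u"
proof -
  note [measurable (raw)] = meas4_compose[OF assms]
  have "surf4 (\<lambda>a b c d. u c d a b) = surf4 (\<lambda>a b c d. u b d a c)"
    by (rule surf4_swap23[of "\<lambda>a b c d. u b d a c"]) measurable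
  also have "\<dots> = surf4 (\<lambda>a b c d. u a d b c)"
    by (rule surf4_swap12[of "\<lambda>a b c d. u a d b c"]) measurable
  also have "\<dots> = surf4 (\<lambda>a b c d. u a c b d)"
    by (rule surf4_swap34[of "\<lambda>a b c d. u a c b d"]) measurable
  also have "\<dots> = surf4 u"
    by (rule surf4_swap23[OF assms])
  finally show ?thesis .
qed

text \<open>
  Put \<open>y = a + b - c - d\<close>.  If \<open>y = 0\<close>, the two factors of each product coincide, and the sum of the
  three squares is \<open>6 + 2 a \<bullet> (b - c - d) = 6 - 2 = 4\<close>.  In general the two factors of each product
  differ by at most \<open>|y|\<close> and are at most 2, and the sum of squares differs from 4 by \<open>2 a \<bullet> y\<close>.
\<close>
lemma four_chords:
  fixes a b c d :: "'a::real_inner"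
  assumes n: "norm a = 1" "norm b = 1" "norm c = 1" "norm d = 1"
  shows "\<bar>norm (a + b) * norm (c + d) + norm (a - c) * norm (b - d) + norm (a - d) * norm (b - c) - 4\<bar>
    \<le> 8 * norm (a + b - c - d)"
proof -
  define y where "y = a + b - c - d"
  have prod: "\<bar>norm u * norm v - (norm u)\<^sup>2\<bar> \<le> 2 * norm y" if "norm u \<le> 2" "\<bar>norm v - norm u\<bar> \<le> norm y" for u v :: 'a
  proof -
    have "\<bar>norm u * norm v - (norm u)\<^sup>2\<bar> = norm u * \<bar>norm v - norm u\<bar>"
      by (simp add: power2_eq_square abs_mult flip: right_diff_distrib)
    also have "\<dots> \<le> 2 * norm y"
      using that by (intro mult_mono) auto
    finally show ?thesis .
  qed
  have sq: "(norm (a + b))\<^sup>2 + (norm (a - c))\<^sup>2 + (norm (a - d))\<^sup>2 = 4 + 2 * (a \<bullet> y)"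
    using n by (simp add: power2_norm_eq_inner y_def inner_diff inner_add inner_commute norm_eq_1 algebra_simps)
  have ay: "\<bar>a \<bullet> y\<bar> \<le> norm y"
    using Cauchy_Schwarz_ineq2[of a y] n by simp
  have "\<bar>norm (c + d) - norm (a + b)\<bar> \<le> norm y"
    using norm_triangle_ineq3[of "a + b" "c + d"] by (simp add: y_def algebra_simps abs_minus_commute)
  moreover have "\<bar>norm (b - d) - norm (a - c)\<bar> \<le> norm y"
    using norm_triangle_ineq3[of "a - c" "d - b"] by (simp add: y_def algebra_simps abs_minus_commute norm_minus_commute)
  moreover have "\<bar>norm (b - c) - norm (a - d)\<bar> \<le> norm y"
    using norm_triangle_ineq3[of "a - d" "c - b"] by (simp add: y_def algebra_simps abs_minus_commute norm_minus_commute)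
  moreover have "norm (a + b) \<le> 2" "norm (a - c) \<le> 2" "norm (a - d) \<le> 2"
    using n norm_triangle_ineq[of a b] norm_triangle_ineq4[of a c] norm_triangle_ineq4[of a d] by auto
  ultimately have "\<bar>norm (a + b) * norm (c + d) - (norm (a + b))\<^sup>2\<bar> \<le> 2 * norm y"
      "\<bar>norm (a - c) * norm (b - d) - (norm (a - c))\<^sup>2\<bar> \<le> 2 * norm y"
      "\<bar>norm (a - d) * norm (b - c) - (norm (a - d))\<^sup>2\<bar> \<le> 2 * norm y"
    by (simp_all add: prod)
  with sq ay show ?thesis
    unfolding y_def[symmetric] by linarith
qed

lemma gauss_hat_minus: "gauss_hat s (- y) = gauss_hat s y"
  by (simp add: gauss_hat_def)

text \<open>
  Half of the exponent absorbs the factor \<open>|y|\<close>, because \<open>t exp (- t\<^sup>2 / 2) \<le> 1\<close>.  The other half is the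
  exponent of the wider Gaussian.
\<close>
lemma norm_mult_gauss_hat_le:
  assumes s: "s > 0"
  shows "norm y * gauss_hat s y \<le> 4 * s * gauss_hat (sqrt 2 * s) y"
proof -
  define t where "t = norm y / (sqrt 2 * s)"
  have t: "norm y = sqrt 2 * s * t" "t \<ge> 0" using s by (auto simp: t_def)
  have "t \<le> 1 + t\<^sup>2 / 2"
    using zero_le_power2[of "t - 1"] by (simp add: power2_eq_square algebra_simps)
  also have "\<dots> \<le> exp (t\<^sup>2 / 2)" by (rule exp_ge_add_one_self)
  finally have 1: "t * exp (- (t\<^sup>2 / 2)) \<le> 1"
    by (simp add: exp_minus field_simps)
  have n2: "(norm y)\<^sup>2 = 2 * s\<^sup>2 * t\<^sup>2" by (simp add: t power_mult_distrib)
  have G1: "gauss_hat s y = (sqrt (2 * pi) / s) ^ 3 * (exp (- (t\<^sup>2 / 2)) * exp (- (t\<^sup>2 / 2)))"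
    using s by (simp add: gauss_hat_def n2 exp_add[symmetric])
  have G2: "gauss_hat (sqrt 2 * s) y = (sqrt (2 * pi) / (sqrt 2 * s)) ^ 3 * exp (- (t\<^sup>2 / 2))"
    using s by (simp add: gauss_hat_def n2 power_mult_distrib)
  have r: "4 / sqrt 2 ^ 3 = sqrt (2::real)"
    by (simp add: power3_eq_cube real_div_sqrt)
  have "4 * s * gauss_hat (sqrt 2 * s) y = 4 / sqrt 2 ^ 3 * (s * ((sqrt (2 * pi) / s) ^ 3 * exp (- (t\<^sup>2 / 2))))"
    unfolding G2 by (simp add: power_divide power_mult_distrib)
  then have "4 * s * gauss_hat (sqrt 2 * s) y = sqrt 2 * s * (sqrt (2 * pi) / s) ^ 3 * exp (- (t\<^sup>2 / 2))"
    unfolding r by (simp only: mult.assoc)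
  moreover have "norm y * gauss_hat s y = sqrt 2 * s * (sqrt (2 * pi) / s) ^ 3 * exp (- (t\<^sup>2 / 2)) * (t * exp (- (t\<^sup>2 / 2)))"
    unfolding G1 t(1) by simp
  ultimately show ?thesis
    using 1 s by (simp add: mult_left_le)
qed

definition quad :: "real \<Rightarrow> (real^3 \<Rightarrow> real) \<Rightarrow> ennreal" where
  "quad s f = surf4 (\<lambda>a b c d. ennreal (f a * f b * f c * f d * gauss_hat s (a + b - c - d)))"

text \<open>
  The surface measure is invariant under \<open>d \<mapsto> - d\<close>, so sums and differences of two points have the
  same law.
\<close>
lemma smoothed_sum_eq:
  "(\<integral>\<^sup>+c. (\<integral>\<^sup>+d. ennreal (norm (c + d) * gauss_hat s (x - c - d)) \<partial>surf) \<partial>surf) = smoothed_diff s x"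
proof -
  have "(\<integral>\<^sup>+d. ennreal (norm (c + d) * gauss_hat s (x - c - d)) \<partial>surf)
      = (\<integral>\<^sup>+d. ennreal (norm (c - d) * gauss_hat s (x - (c - d))) \<partial>surf)" for c
    using nn_integral_surf_minus[of "\<lambda>d. ennreal (norm (c + d) * gauss_hat s (x - c - d))"] by (simp add: algebra_simps)
  then show ?thesis by (simp add: smoothed_diff_def)
qed

lemma smoothed_diff_minus_eq:
  "(\<integral>\<^sup>+b. (\<integral>\<^sup>+d. ennreal (norm (b - d) * gauss_hat s (x + b - d)) \<partial>surf) \<partial>surf) = smoothed_diff s x"
  unfolding smoothed_diff_def
  by (subst surf_pair.Fubini') (measurable, simp add: norm_minus_commute algebra_simps)

lemma surf4_sum_sum:
  assumes [measurable]: "g \<in> borel_measurable borel" and g: "\<And>x. g x \<ge> 0" and s: "s > 0"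
  shows "surf4 (\<lambda>a b c d. ennreal (g a * g b * (norm (a + b) * norm (c + d)) * gauss_hat s (a + b - c - d)))
    = (\<integral>\<^sup>+a. (\<integral>\<^sup>+b. ennreal (g a * g b) * (ennreal (norm (a + b)) * smoothed_diff s (a + b)) \<partial>surf) \<partial>surf)"
proof -
  have "ennreal (g a * g b * (norm (a + b) * norm (c + d)) * gauss_hat s (a + b - c - d))
     = ennreal (g a * g b * norm (a + b)) * ennreal (norm (c + d) * gauss_hat s (a + b - c - d))" for a b c d
    using g[of a] g[of b] gauss_hat_pos[OF s, of "a + b - c - d"] by (simp add: ennreal_mult[symmetric] mult_ac)
  then have "surf4 (\<lambda>a b c d. ennreal (g a * g b * (norm (a + b) * norm (c + d)) * gauss_hat s (a + b - c - d)))
    = (\<integral>\<^sup>+a. (\<integral>\<^sup>+b. ennreal (g a * g b * norm (a + b)) * smoothed_diff s (a + b) \<partial>surf) \<partial>surf)"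
    unfolding surf4_def smoothed_sum_eq[symmetric] by (simp add: nn_integral_cmult)
  then show ?thesis
    using g by (simp add: ennreal_mult mult.assoc)
qed

lemma surf4_diff_diff:
  assumes [measurable]: "g \<in> borel_measurable borel" and g: "\<And>x. g x \<ge> 0" and s: "s > 0"
  shows "surf4 (\<lambda>a b c d. ennreal (g a * g c * (norm (a - c) * norm (b - d)) * gauss_hat s (a + b - c - d)))
    = (\<integral>\<^sup>+a. (\<integral>\<^sup>+c. ennreal (g a * g c) * (ennreal (norm (a - c)) * smoothed_diff s (a - c)) \<partial>surf) \<partial>surf)"
proof -
  have eq: "ennreal (g a * g c * (norm (a - c) * norm (b - d)) * gauss_hat s (a + b - c - d))
     = ennreal (g a * g c * norm (a - c)) * ennreal (norm (b - d) * gauss_hat s ((a - c) + b - d))" for a b c d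
    using g[of a] g[of c] gauss_hat_pos[OF s, of "a + b - c - d"] by (simp add: ennreal_mult[symmetric] mult_ac algebra_simps)
  have "surf4 (\<lambda>a b c d. ennreal (g a * g c * (norm (a - c) * norm (b - d)) * gauss_hat s (a + b - c - d)))
    = surf4 (\<lambda>a c b d. ennreal (g a * g c * (norm (a - c) * norm (b - d)) * gauss_hat s (a + b - c - d)))"
    by (rule surf4_swap23[symmetric]) measurable
  also have "\<dots> = (\<integral>\<^sup>+a. (\<integral>\<^sup>+c. ennreal (g a * g c * norm (a - c)) * smoothed_diff s (a - c) \<partial>surf) \<partial>surf)"
    unfolding surf4_def smoothed_diff_minus_eq[symmetric] eq by (simp add: nn_integral_cmult)
  finally show ?thesis
    using g by (simp add: ennreal_mult mult.assoc)
qed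


text \<open>
  The difference occurs twice because two of the three products of chords pair a point \<open>a\<close> with a
  point that enters \<open>a + b - c - d\<close> with the opposite sign.
\<close>
definition chord_energy :: "(real^3 \<Rightarrow> real) \<Rightarrow> ennreal" where
  "chord_energy g = (\<integral>\<^sup>+a. (\<integral>\<^sup>+b. ennreal (g a * g b * (2 * norm (a - b) + norm (a + b))) \<partial>surf) \<partial>surf)"

lemma ennreal_le_of_twice_le: "2 * x \<le> y + y \<Longrightarrow> x \<le> (y :: ennreal)"
  using ennreal_mult_le_mult_iff[of 2 x y] by (simp add: mult_2)

text \<open>
  The identity of the four chords splits \<open>4 quad s f\<close> into \<open>T1 + T2 + T3\<close> and an error term.  In
  \<open>T1\<close> the pairs are \<open>(a, b)\<close> and \<open>(c, d)\<close>, in \<open>T2\<close> they are \<open>(a, c)\<close> and \<open>(b, d)\<close>.  The inequality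
  of the means separates the pairs, both summands contribute equally by symmetry, and the pair that no
  longer carries a value of \<open>f\<close> is integrated out with \<open>smoothed_diff_le\<close>.
\<close>
lemma quad_self_improving:
  assumes fm [measurable]: "f \<in> borel_measurable borel" and f: "\<And>x. f x \<ge> 0" and s: "s > 0"
  shows "4 * quad s f \<le> ennreal ((2 * pi) ^ 4) * chord_energy (\<lambda>x. (f x)\<^sup>2) + ennreal (32 * s) * quad (sqrt 2 * s) f"
proof -
  let ?g = "\<lambda>x. (f x)\<^sup>2"
  let ?G = "\<lambda>a b c d. gauss_hat s (a + b - c - d)"
  let ?f = "\<lambda>a b c d. f a * f b * f c * f d"
  have fp: "?f a b c d \<ge> 0" for a b c d using f by simp
  have G: "?G a b c d \<ge> 0" for a b c d using gauss_hat_pos[OF s, of "a + b - c - d"] by simp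
  define T1 where "T1 = surf4 (\<lambda>a b c d. ennreal (?f a b c d * (norm (a + b) * norm (c + d)) * ?G a b c d))"
  define T2 where "T2 = surf4 (\<lambda>a b c d. ennreal (?f a b c d * (norm (a - c) * norm (b - d)) * ?G a b c d))"
  define T3 where "T3 = surf4 (\<lambda>a b c d. ennreal (?f a b c d * (norm (a - d) * norm (b - c)) * ?G a b c d))"
  define E1 where "E1 = (\<integral>\<^sup>+a. (\<integral>\<^sup>+b. ennreal (?g a * ?g b * norm (a + b)) \<partial>surf) \<partial>surf)"
  define E2 where "E2 = (\<integral>\<^sup>+a. (\<integral>\<^sup>+b. ennreal (?g a * ?g b * norm (a - b)) \<partial>surf) \<partial>surf)"
  have amgm: "ennreal 2 * ennreal (?f a b c d * w * ?G a b c d)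
      \<le> ennreal (x\<^sup>2 * w * ?G a b c d) + ennreal (y\<^sup>2 * w * ?G a b c d)"
    if "w \<ge> 0" "?f a b c d = x * y" for a b c d w x y
  proof -
    have "2 * (?f a b c d) \<le> x\<^sup>2 + y\<^sup>2"
      unfolding that(2) using sum_squares_bound[of x y] by (simp add: mult.assoc)
    then have "2 * (?f a b c d) * (w * ?G a b c d) \<le> (x\<^sup>2 + y\<^sup>2) * (w * ?G a b c d)"
      using that(1) G by (intro mult_right_mono) auto
    then have "2 * (?f a b c d * w * ?G a b c d) \<le> x\<^sup>2 * w * ?G a b c d + y\<^sup>2 * w * ?G a b c d"
      by (simp add: algebra_simps)
    then have "ennreal (2 * (?f a b c d * w * ?G a b c d)) \<le> ennreal (x\<^sup>2 * w * ?G a b c d + y\<^sup>2 * w * ?G a b c d)"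
      by (rule ennreal_leI)
    moreover have "ennreal (2 * (?f a b c d * w * ?G a b c d)) = ennreal 2 * ennreal (?f a b c d * w * ?G a b c d)"
      by (rule ennreal_mult') simp
    moreover have "ennreal (x\<^sup>2 * w * ?G a b c d + y\<^sup>2 * w * ?G a b c d) = ennreal (x\<^sup>2 * w * ?G a b c d) + ennreal (y\<^sup>2 * w * ?G a b c d)"
      using that(1) G by (intro ennreal_plus mult_nonneg_nonneg) auto
    ultimately show ?thesis by simp
  qed
  have E: "(\<integral>\<^sup>+a. (\<integral>\<^sup>+b. ennreal (?g a * ?g b) * (ennreal (norm (h a b)) * smoothed_diff s (h a b)) \<partial>surf) \<partial>surf)
    \<le> ennreal ((2 * pi) ^ 4) * (\<integral>\<^sup>+a. (\<integral>\<^sup>+b. ennreal (?g a * ?g b * norm (h a b)) \<partial>surf) \<partial>surf)"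
    if [measurable]: "(\<lambda>(a, b). h a b) \<in> borel_measurable (borel \<Otimes>\<^sub>M borel)" for h :: "real^3 \<Rightarrow> real^3 \<Rightarrow> real^3"
  proof -
    have "(\<integral>\<^sup>+a. (\<integral>\<^sup>+b. ennreal (?g a * ?g b) * (ennreal (norm (h a b)) * smoothed_diff s (h a b)) \<partial>surf) \<partial>surf)
      \<le> (\<integral>\<^sup>+a. (\<integral>\<^sup>+b. ennreal (?g a * ?g b) * (ennreal ((2 * pi) ^ 4) * ennreal (norm (h a b))) \<partial>surf) \<partial>surf)"
      using s by (intro nn_integral_mono mult_left_mono smoothed_diff_le) auto
    also have "\<dots> = (\<integral>\<^sup>+a. (\<integral>\<^sup>+b. ennreal ((2 * pi) ^ 4) * ennreal (?g a * ?g b * norm (h a b)) \<partial>surf) \<partial>surf)"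
      by (simp add: ennreal_mult mult_ac)
    also have "\<dots> = ennreal ((2 * pi) ^ 4) * (\<integral>\<^sup>+a. (\<integral>\<^sup>+b. ennreal (?g a * ?g b * norm (h a b)) \<partial>surf) \<partial>surf)"
      by (simp add: nn_integral_cmult)
    finally show ?thesis .
  qed
  have T1: "T1 \<le> ennreal ((2 * pi) ^ 4) * E1"
  proof -
    let ?u = "\<lambda>a b c d. ennreal (?g a * ?g b * (norm (a + b) * norm (c + d)) * ?G a b c d)"
    have "ennreal 2 * T1 = surf4 (\<lambda>a b c d. ennreal 2 * ennreal (?f a b c d * (norm (a + b) * norm (c + d)) * ?G a b c d))"
      unfolding T1_def by (rule surf4_cmult[symmetric]) measurable
    also have "\<dots> \<le> surf4 (\<lambda>a b c d. ?u a b c d + ?u c d a b)"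
    proof (rule surf4_mono)
      fix a b c d :: "real^3"
      have "?u c d a b = ennreal ((f c * f d)\<^sup>2 * (norm (a + b) * norm (c + d)) * ?G a b c d)"
        using gauss_hat_minus[of s "a + b - c - d"] by (simp add: power_mult_distrib mult_ac algebra_simps)
      moreover have "?u a b c d = ennreal ((f a * f b)\<^sup>2 * (norm (a + b) * norm (c + d)) * ?G a b c d)"
        by (simp add: power_mult_distrib)
      ultimately show "ennreal 2 * ennreal (?f a b c d * (norm (a + b) * norm (c + d)) * ?G a b c d) \<le> ?u a b c d + ?u c d a b"
        by (simp only:) (rule amgm, simp_all)
    qed
    also have "\<dots> = surf4 ?u + surf4 (\<lambda>a b c d. ?u c d a b)"
      by (rule surf4_add) measurable
    also have "surf4 (\<lambda>a b c d. ?u c d a b) = surf4 ?u"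
      by (rule surf4_swap_pairs) measurable
    also have "surf4 ?u \<le> ennreal ((2 * pi) ^ 4) * E1"
    proof -
      have "surf4 ?u = (\<integral>\<^sup>+a. (\<integral>\<^sup>+b. ennreal (?g a * ?g b) * (ennreal (norm (a + b)) * smoothed_diff s (a + b)) \<partial>surf) \<partial>surf)"
        by (rule surf4_sum_sum[OF _ _ s]) simp_all
      also have "\<dots> \<le> ennreal ((2 * pi) ^ 4) * E1"
        unfolding E1_def by (rule E[of "\<lambda>a b. a + b"]) measurable
      finally show ?thesis .
    qed
    finally show ?thesis
      using ennreal_le_of_twice_le[of T1] by (simp add: add_mono)
  qed
  have T2: "T2 \<le> ennreal ((2 * pi) ^ 4) * E2"
  proof -
    let ?u = "\<lambda>a b c d. ennreal (?g a * ?g c * (norm (a - c) * norm (b - d)) * ?G a b c d)"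
    have "ennreal 2 * T2 = surf4 (\<lambda>a b c d. ennreal 2 * ennreal (?f a b c d * (norm (a - c) * norm (b - d)) * ?G a b c d))"
      unfolding T2_def by (rule surf4_cmult[symmetric]) measurable
    also have "\<dots> \<le> surf4 (\<lambda>a b c d. ?u a b c d + ?u b a d c)"
    proof (rule surf4_mono)
      fix a b c d :: "real^3"
      have "?u b a d c = ennreal ((f b * f d)\<^sup>2 * (norm (a - c) * norm (b - d)) * ?G a b c d)"
        by (simp add: power_mult_distrib mult_ac algebra_simps)
      moreover have "?u a b c d = ennreal ((f a * f c)\<^sup>2 * (norm (a - c) * norm (b - d)) * ?G a b c d)"
        by (simp add: power_mult_distrib)
      ultimately show "ennreal 2 * ennreal (?f a b c d * (norm (a - c) * norm (b - d)) * ?G a b c d) \<le> ?u a b c d + ?u b a d c"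
        by (simp only:) (rule amgm, simp_all)
    qed
    also have "\<dots> = surf4 ?u + surf4 (\<lambda>a b c d. ?u b a d c)"
      by (rule surf4_add) measurable
    also have "surf4 (\<lambda>a b c d. ?u b a d c) = surf4 (\<lambda>a b c d. ?u a b d c)"
      by (rule surf4_swap12[of "\<lambda>a b c d. ?u a b d c"]) measurable
    also have "\<dots> = surf4 ?u"
      by (rule surf4_swap34) measurable
    also have "surf4 ?u \<le> ennreal ((2 * pi) ^ 4) * E2"
    proof -
      have "surf4 ?u = (\<integral>\<^sup>+a. (\<integral>\<^sup>+b. ennreal (?g a * ?g b) * (ennreal (norm (a - b)) * smoothed_diff s (a - b)) \<partial>surf) \<partial>surf)"
        by (rule surf4_diff_diff[OF _ _ s]) simp_all
      also have "\<dots> \<le> ennreal ((2 * pi) ^ 4) * E2"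
        unfolding E2_def by (rule E[of "\<lambda>a b. a - b"]) measurable
      finally show ?thesis .
    qed
    finally show ?thesis
      using ennreal_le_of_twice_le[of T2] by (simp add: add_mono)
  qed
  have T3: "T3 = T2"
  proof -
    have "T3 = surf4 (\<lambda>a b c d. ennreal (?f a b d c * (norm (a - d) * norm (b - c)) * ?G a b d c))"
      unfolding T3_def by (simp add: algebra_simps)
    also have "\<dots> = T2"
      unfolding T2_def by (rule surf4_swap34) measurable
    finally show ?thesis .
  qed
  let ?e = "\<lambda>a b c d. ennreal (?f a b c d * gauss_hat (sqrt 2 * s) (a + b - c - d))"
  have "4 * quad s f = surf4 (\<lambda>a b c d. 4 * ennreal (?f a b c d * ?G a b c d))"
    unfolding quad_def by (rule surf4_cmult[symmetric]) measurable
  also have "\<dots> \<le> surf4 (\<lambda>a b c d. ennreal (?f a b c d * (norm (a + b) * norm (c + d)) * ?G a b c d)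
      + (ennreal (?f a b c d * (norm (a - c) * norm (b - d)) * ?G a b c d)
      + (ennreal (?f a b c d * (norm (a - d) * norm (b - c)) * ?G a b c d)
      + ennreal (32 * s) * ?e a b c d)))"
  proof (rule surf4_mono)
    fix a b c d :: "real^3" assume n: "norm a = 1" "norm b = 1" "norm c = 1" "norm d = 1"
    let ?S = "norm (a + b) * norm (c + d) + norm (a - c) * norm (b - d) + norm (a - d) * norm (b - c)"
    have "4 * ?G a b c d \<le> (?S + 8 * norm (a + b - c - d)) * ?G a b c d"
      using four_chords[OF n] G by (intro mult_right_mono) auto
    also have "\<dots> \<le> ?S * ?G a b c d + 32 * s * gauss_hat (sqrt 2 * s) (a + b - c - d)"
      using norm_mult_gauss_hat_le[OF s, of "a + b - c - d"] by (simp add: algebra_simps)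
    finally have "?f a b c d * (4 * ?G a b c d) \<le> ?f a b c d * (?S * ?G a b c d + 32 * s * gauss_hat (sqrt 2 * s) (a + b - c - d))"
      by (rule mult_left_mono[OF _ fp])
    then have "4 * (?f a b c d * ?G a b c d) \<le> ?f a b c d * (?S * ?G a b c d + 32 * s * gauss_hat (sqrt 2 * s) (a + b - c - d))"
      by (simp only: mult.left_commute[of 4])
    also have "\<dots> = ?f a b c d * (norm (a + b) * norm (c + d)) * ?G a b c d + (?f a b c d * (norm (a - c) * norm (b - d)) * ?G a b c d
      + (?f a b c d * (norm (a - d) * norm (b - c)) * ?G a b c d + 32 * s * (?f a b c d * gauss_hat (sqrt 2 * s) (a + b - c - d))))"
      by (simp add: algebra_simps)
    finally have "ennreal (4 * (?f a b c d * ?G a b c d)) \<le> ennreal \<dots>"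
      by (rule ennreal_leI)
    also have "ennreal (4 * (?f a b c d * ?G a b c d)) = 4 * ennreal (?f a b c d * ?G a b c d)"
      using fp G by (subst ennreal_mult) auto
    finally show "4 * ennreal (?f a b c d * ?G a b c d) \<le> ennreal (?f a b c d * (norm (a + b) * norm (c + d)) * ?G a b c d)
      + (ennreal (?f a b c d * (norm (a - c) * norm (b - d)) * ?G a b c d)
      + (ennreal (?f a b c d * (norm (a - d) * norm (b - c)) * ?G a b c d)
      + ennreal (32 * s) * ?e a b c d))"
      using fp G s gauss_hat_pos[of "sqrt 2 * s" "a + b - c - d"]
      by (simp add: ennreal_plus ennreal_mult)
  qed
  also have "\<dots> = T1 + (T2 + (T3 + ennreal (32 * s) * quad (sqrt 2 * s) f))"
    unfolding T1_def T2_def T3_def quad_def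
    by (subst surf4_cmult[symmetric], measurable, subst surf4_add[symmetric], measurable,
        subst surf4_add[symmetric], measurable, rule surf4_add, measurable)
  also have "\<dots> \<le> ennreal ((2 * pi) ^ 4) * E1 + (ennreal ((2 * pi) ^ 4) * E2 + (ennreal ((2 * pi) ^ 4) * E2 + ennreal (32 * s) * quad (sqrt 2 * s) f))"
    using T1 T2 unfolding T3 by (intro add_mono) auto
  also have "\<dots> = ennreal ((2 * pi) ^ 4) * (E2 + E2 + E1) + ennreal (32 * s) * quad (sqrt 2 * s) f"
    by (simp add: algebra_simps)
  also have "E2 + E2 + E1 = chord_energy ?g"
    unfolding E1_def E2_def chord_energy_def
    by (simp add: nn_integral_add[symmetric] algebra_simps flip: ennreal_plus)
  finally show ?thesis .
qed

section \<open>Polynomial moments on the sphere\<close>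

text \<open>
  Polynomials are uniformly dense among the continuous functions on the sphere, and continuous
  functions decrease to indicators of closed sets.  Hence the integral of \<open>h\<close> vanishes over closed
  sets, thus over all Borel sets.
\<close>
lemma AE_surf_zero_if_polynomial_moments_zero:
  fixes h :: "real^3 \<Rightarrow> real"
  assumes h: "integrable surf h"
    and mom: "\<And>p. real_polynomial_function p \<Longrightarrow> (LINT x|surf. h x * p x) = 0"
  shows "AE x in surf. h x = 0"
proof -
  have [measurable]: "h \<in> borel_measurable borel" using borel_measurable_integrable[OF h] by simp
  have bdd: "integrable surf (\<lambda>x. h x * p x)"
    if [measurable]: "p \<in> borel_measurable borel" and B: "\<And>x. norm x = 1 \<Longrightarrow> \<bar>p x\<bar> \<le> B" for p B
  proof (rule Bochner_Integration.integrable_bound[where f = "\<lambda>x. B * h x"])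
    show "AE x in surf. norm (h x * p x) \<le> norm (B * h x)"
      using AE_surf_norm
    proof eventually_elim
      case (elim x)
      then have "\<bar>h x\<bar> * \<bar>p x\<bar> \<le> \<bar>h x\<bar> * B" using B by (intro mult_left_mono) auto
      also have "\<dots> \<le> \<bar>h x\<bar> * \<bar>B\<bar>" by (intro mult_left_mono) auto
      finally show ?case by (simp add: abs_mult mult.commute)
    qed
  qed (use h in auto)
  have cont: "(LINT x|surf. h x * \<phi> x) = 0" if \<phi>: "continuous_on UNIV \<phi>" for \<phi> :: "real^3 \<Rightarrow> real"
  proof -
    have [measurable]: "\<phi> \<in> borel_measurable borel" by (rule borel_measurable_continuous_onI[OF \<phi>])
    have "\<bar>LINT x|surf. h x * \<phi> x\<bar> \<le> e" if e: "e > 0" for e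
    proof -
      define I where "I = (LINT x|surf. \<bar>h x\<bar>)"
      have I: "I \<ge> 0" unfolding I_def by simp
      define \<epsilon> where "\<epsilon> = e / (I + 1)"
      have \<epsilon>: "\<epsilon> > 0" "\<epsilon> * I \<le> e" using e I by (auto simp: \<epsilon>_def field_simps)
      obtain p where p: "real_polynomial_function p" "\<And>x. x \<in> sphere 0 1 \<Longrightarrow> \<bar>\<phi> x - p x\<bar> < \<epsilon>"
        using Stone_Weierstrass_real_polynomial_function[OF compact_sphere continuous_on_subset[OF \<phi> subset_UNIV] \<epsilon>(1)] by blast
      have pc: "continuous_on UNIV p"
        using p(1) by (intro continuous_on_polymonial_function) (simp add: real_polynomial_function_eq)
      have [measurable]: "p \<in> borel_measurable borel" by (rule borel_measurable_continuous_onI[OF pc])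
      have "compact (p ` sphere 0 1)" "compact (\<phi> ` sphere 0 1)"
        by (intro compact_continuous_image continuous_on_subset[OF pc] continuous_on_subset[OF \<phi>]; simp)+
      then obtain B1 B2 where B: "\<And>x. x \<in> sphere 0 1 \<Longrightarrow> \<bar>p x\<bar> \<le> B1" "\<And>x. x \<in> sphere 0 1 \<Longrightarrow> \<bar>\<phi> x\<bar> \<le> B2"
        using compact_imp_bounded by (metis bounded_iff imageI real_norm_def)
      have ip: "integrable surf (\<lambda>x. h x * p x)" "integrable surf (\<lambda>x. h x * \<phi> x)"
        using B by (auto intro!: bdd)
      have "(LINT x|surf. h x * \<phi> x) = (LINT x|surf. h x * \<phi> x - h x * p x)"
        using ip mom[OF p(1)] by simp
      also have "\<bar>\<dots>\<bar> \<le> (LINT x|surf. \<epsilon> * \<bar>h x\<bar>)"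
      proof (rule integral_abs_bound[THEN order_trans], rule integral_mono_AE)
        show "AE x in surf. \<bar>h x * \<phi> x - h x * p x\<bar> \<le> \<epsilon> * \<bar>h x\<bar>"
          using AE_surf_norm
        proof eventually_elim
          case (elim x)
          then have "\<bar>h x\<bar> * \<bar>\<phi> x - p x\<bar> \<le> \<bar>h x\<bar> * \<epsilon>"
            using p(2)[of x] by (intro mult_left_mono) auto
          moreover have "\<bar>h x * \<phi> x - h x * p x\<bar> = \<bar>h x\<bar> * \<bar>\<phi> x - p x\<bar>"
            by (simp add: abs_mult flip: right_diff_distrib)
          ultimately show ?case by (simp add: mult.commute[of \<epsilon>])
        qed
      qed (use ip h in auto)
      also have "\<dots> \<le> e" using \<epsilon>(2) by (simp add: I_def)
      finally show ?thesis .
    qed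
    then have "\<bar>LINT x|surf. h x * \<phi> x\<bar> \<le> 0 + e" if "e > 0" for e
      using that by simp
    then have "\<bar>LINT x|surf. h x * \<phi> x\<bar> \<le> 0" by (rule field_le_epsilon)
    then show ?thesis by simp
  qed
  have ind: "integrable surf (\<lambda>x. h x * indicator A x)" if [measurable]: "A \<in> sets borel" for A
    by (intro bdd[where B = 1]) (auto simp: indicator_def)
  have closed: "(LINT x|surf. h x * indicator A x) = 0" if A: "closed A" for A
  proof (cases "A = {}")
    case False
    have [measurable]: "A \<in> sets borel" using A by simp
    define \<phi> where "\<phi> n x = max 0 (1 - real n * infdist x A)" for n x
    have cphi: "continuous_on UNIV (\<phi> n)" for n
      unfolding \<phi>_def by (intro continuous_intros)
    have [measurable]: "\<phi> n \<in> borel_measurable borel" for n by (rule borel_measurable_continuous_onI[OF cphi])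
    have "(\<lambda>n. LINT x|surf. h x * \<phi> n x) \<longlonglongrightarrow> (LINT x|surf. h x * indicator A x)"
    proof (rule integral_dominated_convergence[where w = "\<lambda>x. \<bar>h x\<bar>"])
      show "AE x in surf. (\<lambda>n. h x * \<phi> n x) \<longlonglongrightarrow> h x * indicator A x"
      proof (rule AE_I2, intro tendsto_mult tendsto_const)
        fix x
        show "(\<lambda>n. \<phi> n x) \<longlonglongrightarrow> indicator A x"
        proof (cases "x \<in> A")
          case True
          then show ?thesis by (simp add: \<phi>_def)
        next
          case F: False
          then have pos: "infdist x A > 0"
            using A False infdist_nonneg[of x A] in_closed_iff_infdist_zero[of A x] by (auto simp: less_le)
          obtain N where N: "1 / infdist x A < real N" using reals_Archimedean2 by blast
          have "\<phi> n x = 0" if "n \<ge> N" for n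
          proof -
            have "1 / infdist x A \<le> real n" using N that by linarith
            then show ?thesis using pos by (simp add: \<phi>_def field_simps max_def)
          qed
          then have "\<forall>\<^sub>F n in sequentially. \<phi> n x = indicator A x"
            using F by (auto simp: eventually_sequentially)
          then show ?thesis by (rule tendsto_eventually)
        qed
      qed
      show "AE x in surf. norm (h x * \<phi> n x) \<le> \<bar>h x\<bar>" for n
        by (intro AE_I2) (auto simp: \<phi>_def abs_mult infdist_nonneg intro!: mult_left_le)
    qed (use h in auto)
    then show ?thesis
      by (simp add: cont[OF cphi] LIMSEQ_const_iff)
  qed simp
  have all: "(LINT x|surf. h x * indicator A x) = 0" if "A \<in> sets borel" for A
  proof -
    have "Int_stable (Collect closed :: (real^3) set set)" by (auto simp: Int_stable_def)
    moreover have "Collect closed \<subseteq> Pow (UNIV :: (real^3) set)" by simp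
    moreover have "A \<in> sigma_sets UNIV (Collect closed)"
      using that by (simp add: borel_eq_closed)
    ultimately show ?thesis
    proof (induction rule: sigma_sets_induct_disjoint)
      case (basic A) then show ?case by (simp add: closed)
    next
      case (compl A)
      then have [measurable]: "A \<in> sets borel" by (simp add: borel_eq_closed)
      have "(LINT x|surf. h x * indicator (UNIV - A) x) = (LINT x|surf. h x * indicator UNIV x - h x * indicator A x)"
        by (intro Bochner_Integration.integral_cong) (auto simp: indicator_def)
      also have "\<dots> = (LINT x|surf. h x * indicator UNIV x) - (LINT x|surf. h x * indicator A x)"
        by (intro Bochner_Integration.integral_diff ind) auto
      finally show ?case using compl closed[of UNIV] by simp
    next
      case (union A)
      then have [measurable]: "A i \<in> sets borel" for i by (auto simp: borel_eq_closed)
      have "(\<lambda>n. LINT x|surf. h x * indicator (\<Union>i<n. A i) x) \<longlonglongrightarrow> (LINT x|surf. h x * indicator (\<Union>i. A i) x)"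
      proof (rule integral_dominated_convergence[where w = "\<lambda>x. \<bar>h x\<bar>"])
        show "AE x in surf. (\<lambda>n. h x * indicator (\<Union>i<n. A i) x) \<longlonglongrightarrow> h x * indicator (\<Union>i. A i) x"
          by (intro AE_I2 tendsto_mult tendsto_const LIMSEQ_indicator_UN)
      qed (use h in \<open>auto simp: indicator_def\<close>)
      moreover have "(LINT x|surf. h x * indicator (\<Union>i<n. A i) x) = 0" for n
      proof -
        have "indicator (\<Union>i<n. A i) x = (\<Sum>i<n. indicator (A i) x :: real)" for x
          using union(1) by (intro indicator_UN_disjoint) (auto simp: disjoint_family_on_def)
        then have "(LINT x|surf. h x * indicator (\<Union>i<n. A i) x) = (LINT x|surf. (\<Sum>i<n. h x * indicator (A i) x))"
          by (simp add: sum_distrib_left)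
        also have "\<dots> = 0"
          using union by (subst Bochner_Integration.integral_sum) (auto intro!: ind)
        finally show ?thesis .
      qed
      ultimately show ?case by (simp add: LIMSEQ_const_iff)
    qed (simp_all)
  qed
  show ?thesis
  proof (rule density_unique_real[of surf h "\<lambda>_. 0"])
    show "set_lebesgue_integral surf A h = set_lebesgue_integral surf A (\<lambda>_. 0)" if "A \<in> sets surf" for A
      using all[of A] that by (simp add: set_lebesgue_integral_def mult.commute)
  qed (use h in auto)
qed

lemma AE_surf_pair_norm: "AE z in surf \<Otimes>\<^sub>M surf. norm (fst z) = 1 \<and> norm (snd z) = 1"
proof (rule surf_pair.AE_pair_measure)
  show "{z \<in> space (surf \<Otimes>\<^sub>M surf). norm (fst z) = 1 \<and> norm (snd z) = 1} \<in> sets (surf \<Otimes>\<^sub>M surf)"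
    by measurable
  show "AE x in surf. AE y in surf. norm (fst (x, y)) = 1 \<and> norm (snd (x, y)) = 1"
    using AE_surf_norm
  proof eventually_elim
    case (elim x)
    show ?case using AE_surf_norm by eventually_elim (simp add: elim)
  qed
qed

lemma integrable_surf_pair_kernel:
  assumes h: "integrable surf h" and g: "integrable surf g" and [measurable]: "k \<in> borel_measurable (surf \<Otimes>\<^sub>M surf)"
    and B: "\<And>x y. norm x = 1 \<Longrightarrow> norm y = 1 \<Longrightarrow> \<bar>k (x, y)\<bar> \<le> B"
  shows "integrable (surf \<Otimes>\<^sub>M surf) (\<lambda>z. h (fst z) * g (snd z) * k z :: real)"
proof (rule Bochner_Integration.integrable_bound[where f = "\<lambda>z. h (fst z) * g (snd z) * B"])
  have [measurable]: "h \<in> borel_measurable borel" "g \<in> borel_measurable borel"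
    using borel_measurable_integrable[OF h] borel_measurable_integrable[OF g] by simp_all
  show "integrable (surf \<Otimes>\<^sub>M surf) (\<lambda>z. h (fst z) * g (snd z) * B)"
    by (intro integrable_mult_left surf_pair.integrable_tensor h g)
  show "(\<lambda>z. h (fst z) * g (snd z) * k z) \<in> borel_measurable (surf \<Otimes>\<^sub>M surf)"
    by measurable
  show "AE z in surf \<Otimes>\<^sub>M surf. norm (h (fst z) * g (snd z) * k z) \<le> norm (h (fst z) * g (snd z) * B)"
    using AE_surf_pair_norm
  proof eventually_elim
    case (elim z)
    then have "\<bar>k z\<bar> \<le> \<bar>B\<bar>" using B[of "fst z" "snd z"] by simp
    then show ?case by (simp add: abs_mult mult_left_mono)
  qed
qed

lemma abs_inner_unit_le: "norm x = 1 \<Longrightarrow> norm y = 1 \<Longrightarrow> \<bar>x \<bullet> y\<bar> \<le> 1"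
  using Cauchy_Schwarz_ineq2[of x y] by simp

definition dot_moment :: "nat \<Rightarrow> (real^3 \<Rightarrow> real) \<Rightarrow> real" where
  "dot_moment k h = (LINT z|(surf \<Otimes>\<^sub>M surf). h (fst z) * h (snd z) * (fst z \<bullet> snd z) ^ k)"

lemma integrable_dot_moment:
  assumes "integrable surf h" "integrable surf g"
  shows "integrable (surf \<Otimes>\<^sub>M surf) (\<lambda>z. h (fst z) * g (snd z) * (fst z \<bullet> snd z) ^ k :: real)"
  by (rule integrable_surf_pair_kernel[OF assms, where B = 1])
     (auto simp: power_abs abs_inner_unit_le intro!: power_le_one)

lemma integrable_surf_coord:
  assumes h: "integrable surf h"
  shows "integrable surf (\<lambda>x. h x * x $ i :: real)"
proof (rule Bochner_Integration.integrable_bound[OF h])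
  show "(\<lambda>x. h x * x $ i) \<in> borel_measurable surf"
    using borel_measurable_integrable[OF h] by measurable
  show "AE x in surf. norm (h x * x $ i) \<le> norm (h x)"
    using AE_surf_norm
  proof eventually_elim
    case (elim x)
    then show ?case using component_le_norm_cart[of x i] by (simp add: abs_mult mult_left_le)
  qed
qed

lemma dot_moment_0:
  assumes "integrable surf h"
  shows "dot_moment 0 h = (LINT x|surf. h x)\<^sup>2"
  using surf_pair.integrable_tensor(2)[OF assms assms] by (simp add: dot_moment_def power2_eq_square)

text \<open>
  Expanding one factor \<open>x \<bullet> y\<close> in coordinates.  By induction this displays the form as a sum of
  squares of monomial moments.
\<close>
lemma dot_moment_Suc:
  assumes h: "integrable surf h"
  shows "dot_moment (Suc k) h = (\<Sum>i\<in>UNIV. dot_moment k (\<lambda>x. h x * x $ i))"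
proof -
  have "h x * h y * (x \<bullet> y) ^ Suc k = (\<Sum>i\<in>UNIV. (h x * x $ i) * (h y * y $ i) * (x \<bullet> y) ^ k)" for x y
    by (simp add: inner_vec_def[of x y] sum_distrib_left sum_distrib_right mult_ac)
  then have "dot_moment (Suc k) h = (LINT z|(surf \<Otimes>\<^sub>M surf).
      (\<Sum>i\<in>UNIV. (h (fst z) * fst z $ i) * (h (snd z) * snd z $ i) * (fst z \<bullet> snd z) ^ k))"
    unfolding dot_moment_def by simp
  also have "\<dots> = (\<Sum>i\<in>UNIV. dot_moment k (\<lambda>x. h x * x $ i))"
    unfolding dot_moment_def
    by (intro Bochner_Integration.integral_sum integrable_dot_moment integrable_surf_coord h)
  finally show ?thesis .
qed

lemma dot_moment_nonneg: "integrable surf h \<Longrightarrow> dot_moment k h \<ge> 0"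
proof (induction k arbitrary: h)
  case (Suc k)
  then show ?case
    by (simp add: dot_moment_Suc sum_nonneg integrable_surf_coord)
qed (simp add: dot_moment_0)

text \<open>
  Unlike the vanishing of all \<open>dot_moment\<close>s, this condition is visibly linear in \<open>h\<close>, which is needed
  for multiplication by a polynomial.
\<close>
definition monomials_vanish :: "(real^3 \<Rightarrow> real) \<Rightarrow> bool" where
  "monomials_vanish h \<longleftrightarrow> integrable surf h \<and> (\<forall>is. (LINT x|surf. h x * prod_list (map (($) x) is)) = 0)"

lemma integrable_surf_monomial:
  "integrable surf h \<Longrightarrow> integrable surf (\<lambda>x. h x * prod_list (map (($) x) is))"
proof (induction "is" arbitrary: h)
  case (Cons i "is")
  then show ?case
    using Cons.IH[OF integrable_surf_coord[OF Cons.prems, of i]] by (simp add: mult.assoc)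
qed simp

text \<open>
  If \<open>dot_moment (Suc k) h = 0\<close>, then each of the nonnegative summands of \<open>dot_moment_Suc\<close> vanishes, so
  the hypothesis passes from \<open>h\<close> to \<open>h\<close> times a coordinate.  The form of degree \<open>0\<close> is the square of the
  integral.
\<close>
lemma monomials_vanish_if_dot_moments_zero:
  assumes "integrable surf h" "\<And>k. dot_moment k h = 0"
  shows "monomials_vanish h"
proof -
  have "(LINT x|surf. h x * prod_list (map (($) x) is)) = 0"
    if "integrable surf h" "\<And>k. dot_moment k h = 0" for "is" h
    using that
  proof (induction "is" arbitrary: h)
    case Nil
    then show ?case using dot_moment_0[of h] Nil(2)[of 0] by simp
  next
    case (Cons i "is")
    have "dot_moment k (\<lambda>x. h x * x $ i) = 0" for k
      using Cons.prems(2)[of "Suc k"] dot_moment_nonneg[OF integrable_surf_coord[OF Cons.prems(1)], of k]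
      by (simp add: dot_moment_Suc[OF Cons.prems(1)] sum_nonneg_eq_0_iff)
    then show ?case
      using Cons.IH[of "\<lambda>x. h x * x $ i"] integrable_surf_coord[OF Cons.prems(1)] by (simp add: mult.assoc)
  qed
  then show ?thesis using assms by (simp add: monomials_vanish_def)
qed

lemma monomials_vanish_coord:
  assumes "monomials_vanish h" shows "monomials_vanish (\<lambda>x. h x * x $ i)"
  unfolding monomials_vanish_def
proof (intro conjI allI)
  show "(LINT x|surf. h x * x $ i * prod_list (map (($) x) is)) = 0" for "is"
    using assms by (auto simp: monomials_vanish_def mult.assoc dest: spec[where x = "i # is"])
qed (use assms in \<open>auto simp: monomials_vanish_def intro: integrable_surf_coord\<close>)

lemma monomials_vanish_cmult:
  "monomials_vanish h \<Longrightarrow> monomials_vanish (\<lambda>x. h x * c)"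
  by (simp add: monomials_vanish_def mult.commute[of _ c] mult.assoc)

lemma monomials_vanish_add:
  "monomials_vanish h \<Longrightarrow> monomials_vanish g \<Longrightarrow> monomials_vanish (\<lambda>x. h x + g x)"
  by (simp add: monomials_vanish_def distrib_right integrable_surf_monomial)

lemma monomials_vanish_polynomial:
  "real_polynomial_function p \<Longrightarrow> monomials_vanish h \<Longrightarrow> monomials_vanish (\<lambda>x. h x * p x)"
proof (induction p arbitrary: h rule: real_polynomial_function.induct)
  case (linear f)
  have f: "f x = x $ 1 * f (axis 1 1) + x $ 2 * f (axis 2 1) + x $ 3 * f (axis 3 1)" for x
  proof -
    have "x = x $ 1 *\<^sub>R axis 1 1 + x $ 2 *\<^sub>R axis 2 1 + x $ 3 *\<^sub>R axis 3 1"
      by (simp add: vec_eq_iff forall_3 axis_def)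
    then have "f x = f (x $ 1 *\<^sub>R axis 1 1 + x $ 2 *\<^sub>R axis 2 1 + x $ 3 *\<^sub>R axis 3 1)" by simp
    then show ?thesis
      using linear(1) by (simp add: linear_simps)
  qed
  have "h x * f x = h x * x $ 1 * f (axis 1 1) + h x * x $ 2 * f (axis 2 1) + h x * x $ 3 * f (axis 3 1)" for x
    by (subst f) (simp add: distrib_left)
  then show ?case
    by (simp only:) (intro monomials_vanish_add monomials_vanish_cmult monomials_vanish_coord linear(2))
next
  case (const c) then show ?case by (rule monomials_vanish_cmult)
next
  case (add p q) then show ?case by (simp add: distrib_left monomials_vanish_add)
next
  case (mult p q)
  from mult.IH(2)[OF mult.IH(1)[OF mult.prems]] show ?case by (simp add: mult.assoc)
qed

lemma polynomial_moments_zero_if_dot_moments_zero: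
  assumes "integrable surf h" "\<And>k. dot_moment k h = 0" "real_polynomial_function p"
  shows "(LINT x|surf. h x * p x) = 0"
  using monomials_vanish_polynomial[OF assms(3) monomials_vanish_if_dot_moments_zero[OF assms(1,2)]]
  by (auto simp: monomials_vanish_def dest: spec[where x = "[]"])

section \<open>The chord energy is maximal for constants\<close>

text \<open>
  The coefficients of the power series of \<open>2 \<surd>(1 - t) + \<surd>(1 + t)\<close> at \<open>0\<close>.
\<close>
definition dot_coeff :: "nat \<Rightarrow> real" where
  "dot_coeff k = (1 / 2 gchoose k) * (2 * (-1) ^ k + 1)"

text \<open>
  After the first term the binomial coefficients of exponent \<open>1/2\<close> alternate, because each step
  multiplies by \<open>1/2 - k < 0\<close>.
\<close>
lemma half_gchoose_Suc_sign: "(-1) ^ k * ((1 / 2 :: real) gchoose Suc k) > 0"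
proof (induction k)
  case (Suc k)
  have "real (Suc (Suc k)) * ((1 / 2) gchoose Suc (Suc k)) = (1 / 2 - real (Suc k)) * ((1 / 2) gchoose Suc k)"
    using gbinomial_mult_1[of "1 / 2 :: real" "Suc k"] by (simp add: algebra_simps)
  then have "(1 / 2 :: real) gchoose Suc (Suc k) = (1 / 2 - real (Suc k)) * ((1 / 2) gchoose Suc k) / real (Suc (Suc k))"
    by (simp add: field_simps)
  moreover have "(-1) ^ Suc k * ((a - b) * g / c) = ((b - a) / c) * ((-1) ^ k * g)" for a b c g :: real
    by (cases "c = 0") (simp_all add: field_simps)
  ultimately have "(-1) ^ Suc k * ((1 / 2 :: real) gchoose Suc (Suc k))
      = ((real (Suc k) - 1 / 2) / real (Suc (Suc k))) * ((-1) ^ k * ((1 / 2) gchoose Suc k))"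
    by (simp only:)
  also have "\<dots> > 0" by (rule mult_pos_pos[OF _ Suc]) simp
  finally show ?case .
qed simp

lemma dot_coeff_neg:
  assumes "k \<ge> 1" shows "dot_coeff k < 0"
proof -
  obtain j where k: "k = Suc j" using assms by (cases k) auto
  show ?thesis
  proof (cases "even j")
    case True
    then show ?thesis using half_gchoose_Suc_sign[of j] by (simp add: dot_coeff_def k)
  next
    case False
    then show ?thesis using half_gchoose_Suc_sign[of j] by (simp add: dot_coeff_def k)
  qed
qed

lemma dot_coeff_sums:
  assumes "\<bar>z\<bar> < 1"
  shows "(\<lambda>k. dot_coeff k * z ^ k) sums (2 * sqrt (1 - z) + sqrt (1 + z))"
    and "summable (\<lambda>k. \<bar>dot_coeff k\<bar> * \<bar>z\<bar> ^ k)"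
proof -
  have s: "(\<lambda>k. dot_coeff k * z ^ k) sums (2 * sqrt (1 - z) + sqrt (1 + z))" if "\<bar>z\<bar> < 1" for z
  proof -
    have "(\<lambda>k. 2 * ((1 / 2 gchoose k) * (- z) ^ k) + (1 / 2 gchoose k) * z ^ k) sums (2 * (1 + - z) powr (1 / 2) + (1 + z) powr (1 / 2))"
      using that by (intro sums_add sums_mult gen_binomial_real) auto
    moreover have "2 * ((1 / 2 gchoose k) * (- z) ^ k) + (1 / 2 gchoose k) * z ^ k = dot_coeff k * z ^ k" for k
      by (simp add: dot_coeff_def power_minus[of z] algebra_simps)
    ultimately show ?thesis using that by (simp add: powr_half_sqrt)
  qed
  show "(\<lambda>k. dot_coeff k * z ^ k) sums (2 * sqrt (1 - z) + sqrt (1 + z))" by (rule s) fact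
  define x where "x = (1 + \<bar>z\<bar>) / 2"
  have "\<bar>x\<bar> < 1" "norm z < norm x" using assms by (auto simp: x_def)
  then show "summable (\<lambda>k. \<bar>dot_coeff k\<bar> * \<bar>z\<bar> ^ k)"
    using powser_insidea[of dot_coeff x z] s[of x] by (simp add: sums_iff norm_mult power_abs abs_mult)
qed

text \<open>
  Integrating the series term by term, which is legitimate for \<open>r < 1\<close>, gives a sum of nonpositive
  terms, since the constant term vanishes with the mean of \<open>h\<close>.  It is bounded by any single term.
\<close>
lemma series_energy_le:
  assumes h: "integrable surf h" and h0: "(LINT x|surf. h x) = 0" and j: "j \<ge> 1" and r: "0 < r" "r < 1"
  shows "(LINT z|(surf \<Otimes>\<^sub>M surf). h (fst z) * h (snd z) *
      (2 * sqrt (1 - r * (fst z \<bullet> snd z)) + sqrt (1 + r * (fst z \<bullet> snd z)))) \<le> dot_coeff j * r ^ j * dot_moment j h"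
    (is "?L \<le> _")
proof -
  define f where "f = (\<lambda>k (z :: (real^3) \<times> (real^3)). h (fst z) * h (snd z) * (fst z \<bullet> snd z) ^ k * (dot_coeff k * r ^ k))"
  have i: "integrable (surf \<Otimes>\<^sub>M surf) (f k)" for k
    unfolding f_def by (intro integrable_mult_left integrable_dot_moment h)
  have fi: "(LINT z|(surf \<Otimes>\<^sub>M surf). f k z) = dot_coeff k * r ^ k * dot_moment k h" for k
    by (simp add: f_def dot_moment_def)
  have hh: "integrable (surf \<Otimes>\<^sub>M surf) (\<lambda>z. \<bar>h (fst z)\<bar> * \<bar>h (snd z)\<bar>)"
    using h by (intro surf_pair.integrable_tensor) auto
  have nf: "norm (f k z) \<le> \<bar>h (fst z)\<bar> * \<bar>h (snd z)\<bar> * (\<bar>dot_coeff k\<bar> * \<bar>r\<bar> ^ k)" if "norm (fst z) = 1" "norm (snd z) = 1" for k z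
  proof -
    have "\<bar>fst z \<bullet> snd z\<bar> ^ k \<le> 1" using abs_inner_unit_le[OF that] by (intro power_le_one) auto
    then have "\<bar>h (fst z)\<bar> * \<bar>h (snd z)\<bar> * (\<bar>dot_coeff k\<bar> * \<bar>r\<bar> ^ k) * \<bar>fst z \<bullet> snd z\<bar> ^ k \<le> \<bar>h (fst z)\<bar> * \<bar>h (snd z)\<bar> * (\<bar>dot_coeff k\<bar> * \<bar>r\<bar> ^ k)"
      by (intro mult_left_le) auto
    then show ?thesis by (simp add: f_def abs_mult power_abs mult_ac)
  qed
  have sr: "summable (\<lambda>k. \<bar>dot_coeff k\<bar> * \<bar>r\<bar> ^ k)" using r by (intro dot_coeff_sums) auto
  have s1: "AE z in surf \<Otimes>\<^sub>M surf. summable (\<lambda>k. norm (f k z))"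
    using AE_surf_pair_norm
  proof eventually_elim
    case (elim z)
    show ?case
      by (rule summable_comparison_test'[OF summable_mult[OF sr, of "\<bar>h (fst z)\<bar> * \<bar>h (snd z)\<bar>"]]) (use nf elim in auto)
  qed
  have s2: "summable (\<lambda>k. LINT z|(surf \<Otimes>\<^sub>M surf). norm (f k z))"
  proof (rule summable_comparison_test'[OF summable_mult[OF sr, of "LINT z|(surf \<Otimes>\<^sub>M surf). \<bar>h (fst z)\<bar> * \<bar>h (snd z)\<bar>"]])
    fix k
    have "AE z in surf \<Otimes>\<^sub>M surf. norm (f k z) \<le> \<bar>h (fst z)\<bar> * \<bar>h (snd z)\<bar> * (\<bar>dot_coeff k\<bar> * \<bar>r\<bar> ^ k)"
      using AE_surf_pair_norm by eventually_elim (rule nf; blast)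
    then have "(LINT z|(surf \<Otimes>\<^sub>M surf). norm (f k z)) \<le> (LINT z|(surf \<Otimes>\<^sub>M surf). \<bar>h (fst z)\<bar> * \<bar>h (snd z)\<bar> * (\<bar>dot_coeff k\<bar> * \<bar>r\<bar> ^ k))"
      by (intro integral_mono_AE integrable_norm i integrable_mult_left hh)
    then show "norm (LINT z|(surf \<Otimes>\<^sub>M surf). norm (f k z)) \<le> (LINT z|(surf \<Otimes>\<^sub>M surf). \<bar>h (fst z)\<bar> * \<bar>h (snd z)\<bar>) * (\<bar>dot_coeff k\<bar> * \<bar>r\<bar> ^ k)"
      by simp
  qed
  have "(LINT z|(surf \<Otimes>\<^sub>M surf). (\<Sum>k. f k z)) = ?L"
  proof (rule integral_cong_AE)
    show "AE z in surf \<Otimes>\<^sub>M surf. (\<Sum>k. f k z) = h (fst z) * h (snd z) *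
      (2 * sqrt (1 - r * (fst z \<bullet> snd z)) + sqrt (1 + r * (fst z \<bullet> snd z)))"
      using AE_surf_pair_norm
    proof eventually_elim
      case (elim z)
      then have "\<bar>r * (fst z \<bullet> snd z)\<bar> \<le> r * 1"
        unfolding abs_mult using r abs_inner_unit_le[of "fst z" "snd z"] by (intro mult_mono) auto
      then have "\<bar>r * (fst z \<bullet> snd z)\<bar> < 1" using r by simp
      from sums_mult[OF dot_coeff_sums(1)[OF this], of "h (fst z) * h (snd z)"]
      have "(\<lambda>k. f k z) sums (h (fst z) * h (snd z) * (2 * sqrt (1 - r * (fst z \<bullet> snd z)) + sqrt (1 + r * (fst z \<bullet> snd z))))"
        by (simp add: f_def power_mult_distrib mult_ac)
      then show ?case by (simp add: sums_iff)
    qed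
    show "(\<lambda>z. \<Sum>k. f k z) \<in> borel_measurable (surf \<Otimes>\<^sub>M surf)"
      using i by (intro borel_measurable_suminf) auto
    show "(\<lambda>z. h (fst z) * h (snd z) * (2 * sqrt (1 - r * (fst z \<bullet> snd z)) + sqrt (1 + r * (fst z \<bullet> snd z)))) \<in> borel_measurable (surf \<Otimes>\<^sub>M surf)"
      using borel_measurable_integrable[OF h] by measurable
  qed
  moreover have "(\<lambda>k. dot_coeff k * r ^ k * dot_moment k h) sums (LINT z|(surf \<Otimes>\<^sub>M surf). (\<Sum>k. f k z))"
    using sums_integral[OF i s1 s2] by (simp only: fi)
  ultimately have sL: "(\<lambda>k. dot_coeff k * r ^ k * dot_moment k h) sums ?L" by simp
  have nonpos: "- (dot_coeff k * r ^ k * dot_moment k h) \<ge> 0" for k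
  proof (cases k)
    case 0 then show ?thesis by (simp add: dot_moment_0[OF h] h0)
  next
    case (Suc n)
    have "(- dot_coeff k) * r ^ k * dot_moment k h \<ge> 0"
      using dot_coeff_neg[of k] Suc r by (intro mult_nonneg_nonneg dot_moment_nonneg h) auto
    then show ?thesis by simp
  qed
  have "(\<Sum>k\<in>{j}. - (dot_coeff k * r ^ k * dot_moment k h)) \<le> - ?L"
    using sum_le_suminf[of "\<lambda>k. - (dot_coeff k * r ^ k * dot_moment k h)" "{j}"] sums_minus[OF sL] nonpos
    by (simp add: sums_iff)
  then show ?thesis by simp
qed


lemma norm_add_unit_sq:
  fixes x y :: "'a :: real_inner" assumes "norm x = 1" "norm y = 1"
  shows "(norm (x + y))\<^sup>2 = 2 + 2 * (x \<bullet> y)"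
  using norm_diff_unit_sq[of x "- y"] assms by simp

lemma chord_kernel_eq:
  fixes x y :: "'a :: real_inner" assumes "norm x = 1" "norm y = 1"
  shows "2 * norm (x - y) + norm (x + y) = sqrt 2 * (2 * sqrt (1 - x \<bullet> y) + sqrt (1 + x \<bullet> y))"
proof -
  have "norm (x - y) = sqrt 2 * sqrt (1 - x \<bullet> y)"
    using norm_diff_unit_sq[OF assms] by (simp add: real_sqrt_mult[symmetric] real_sqrt_unique[symmetric] algebra_simps)
  moreover have "norm (x + y) = sqrt 2 * sqrt (1 + x \<bullet> y)"
    using norm_add_unit_sq[OF assms] by (simp add: real_sqrt_mult[symmetric] real_sqrt_unique[symmetric] algebra_simps)
  ultimately show ?thesis by (simp add: algebra_simps)
qed

abbreviation chord_kernel :: "(real^3) \<times> (real^3) \<Rightarrow> real" where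
  "chord_kernel z \<equiv> 2 * norm (fst z - snd z) + norm (fst z + snd z)"

lemma chord_kernel_le: "norm x = 1 \<Longrightarrow> norm y = 1 \<Longrightarrow> \<bar>chord_kernel (x, y)\<bar> \<le> 6"
  using norm_triangle_ineq4[of x y] norm_triangle_ineq[of x y] by simp

text \<open>
  The limit \<open>r \<rightarrow> 1\<close> of the preceding lemma.  Passing to the limit after dropping all terms but one
  avoids the convergence of the series at its radius of convergence.
\<close>
lemma mean_zero_energy_le:
  assumes h: "integrable surf h" and h0: "(LINT x|surf. h x) = 0" and j: "j \<ge> 1"
  shows "(LINT z|(surf \<Otimes>\<^sub>M surf). h (fst z) * h (snd z) * chord_kernel z) \<le> sqrt 2 * (dot_coeff j * dot_moment j h)"
proof -
  define r where "r n = 1 - 1 / (real n + 2)" for n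
  have r: "0 < r n" "r n < 1" for n by (auto simp: r_def field_simps)
  have rl: "r \<longlonglongrightarrow> 1" unfolding r_def by real_asymp
  have [measurable]: "h \<in> borel_measurable borel" using borel_measurable_integrable[OF h] by simp
  define K where "K q z = 2 * sqrt (1 - q * (fst z \<bullet> snd z)) + sqrt (1 + q * (fst z \<bullet> snd z))" for q and z :: "(real^3) \<times> (real^3)"
  have [measurable]: "K q \<in> borel_measurable (surf \<Otimes>\<^sub>M surf)" for q unfolding K_def[abs_def] by measurable
  have K6: "\<bar>K (r n) (x, y)\<bar> \<le> 6" if "norm x = 1" "norm y = 1" for n x y
  proof -
    have "\<bar>r n * (x \<bullet> y)\<bar> \<le> 1 * 1"
      unfolding abs_mult using r[of n] abs_inner_unit_le[OF that] by (intro mult_mono) auto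
    then have "0 \<le> 1 - r n * (x \<bullet> y)" "1 - r n * (x \<bullet> y) \<le> 2\<^sup>2" "0 \<le> 1 + r n * (x \<bullet> y)" "1 + r n * (x \<bullet> y) \<le> 2\<^sup>2"
      by auto
    then have "0 \<le> sqrt (1 - r n * (x \<bullet> y))" "sqrt (1 - r n * (x \<bullet> y)) \<le> 2" "0 \<le> sqrt (1 + r n * (x \<bullet> y))" "sqrt (1 + r n * (x \<bullet> y)) \<le> 2"
      by (auto intro: real_le_lsqrt)
    then show ?thesis by (simp add: K_def)
  qed
  have lim: "(\<lambda>n. LINT z|(surf \<Otimes>\<^sub>M surf). h (fst z) * h (snd z) * K (r n) z) \<longlonglongrightarrow> (LINT z|(surf \<Otimes>\<^sub>M surf). h (fst z) * h (snd z) * K 1 z)"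
  proof (rule integral_dominated_convergence[where w = "\<lambda>z. \<bar>h (fst z)\<bar> * \<bar>h (snd z)\<bar> * 6"])
    show "integrable (surf \<Otimes>\<^sub>M surf) (\<lambda>z. \<bar>h (fst z)\<bar> * \<bar>h (snd z)\<bar> * 6)"
      using h by (intro integrable_mult_left surf_pair.integrable_tensor) auto
    show "AE z in surf \<Otimes>\<^sub>M surf. (\<lambda>n. h (fst z) * h (snd z) * K (r n) z) \<longlonglongrightarrow> h (fst z) * h (snd z) * K 1 z"
      unfolding K_def by (intro AE_I2 tendsto_intros rl)
    show "AE z in surf \<Otimes>\<^sub>M surf. norm (h (fst z) * h (snd z) * K (r n) z) \<le> \<bar>h (fst z)\<bar> * \<bar>h (snd z)\<bar> * 6" for n
      using AE_surf_pair_norm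
    proof eventually_elim
      case (elim z)
      then show ?case
        using mult_left_mono[OF K6[of "fst z" "snd z" n], of "\<bar>h (fst z)\<bar> * \<bar>h (snd z)\<bar>"] by (simp add: abs_mult)
    qed
  qed measurable
  have le: "(LINT z|(surf \<Otimes>\<^sub>M surf). h (fst z) * h (snd z) * K 1 z) \<le> dot_coeff j * 1 ^ j * dot_moment j h"
  proof (rule LIMSEQ_le[OF lim])
    show "(\<lambda>n. dot_coeff j * r n ^ j * dot_moment j h) \<longlonglongrightarrow> dot_coeff j * 1 ^ j * dot_moment j h"
      by (intro tendsto_intros rl)
    show "\<exists>N. \<forall>n\<ge>N. (LINT z|(surf \<Otimes>\<^sub>M surf). h (fst z) * h (snd z) * K (r n) z) \<le> dot_coeff j * r n ^ j * dot_moment j h"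
      unfolding K_def using series_energy_le[OF h h0 j r] by blast
  qed
  have "(LINT z|(surf \<Otimes>\<^sub>M surf). h (fst z) * h (snd z) * chord_kernel z)
    = (LINT z|(surf \<Otimes>\<^sub>M surf). sqrt 2 * (h (fst z) * h (snd z) * K 1 z))"
  proof (rule integral_cong_AE)
    show "AE z in surf \<Otimes>\<^sub>M surf. h (fst z) * h (snd z) * chord_kernel z = sqrt 2 * (h (fst z) * h (snd z) * K 1 z)"
      using AE_surf_pair_norm by eventually_elim (simp add: chord_kernel_eq K_def)
  qed measurable
  also have "\<dots> = sqrt 2 * (LINT z|(surf \<Otimes>\<^sub>M surf). h (fst z) * h (snd z) * K 1 z)"
    by (rule Bochner_Integration.integral_mult_right_zero)
  also have "\<dots> \<le> sqrt 2 * (dot_coeff j * dot_moment j h)"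
    using le by (intro mult_left_mono) auto
  finally show ?thesis .
qed

lemma mean_zero_energy_nonpos:
  assumes h: "integrable surf h" and h0: "(LINT x|surf. h x) = 0"
  shows "(LINT z|(surf \<Otimes>\<^sub>M surf). h (fst z) * h (snd z) * chord_kernel z) \<le> 0"
proof -
  have "dot_coeff 1 * dot_moment 1 h \<le> 0"
    using dot_coeff_neg[of 1] dot_moment_nonneg[OF h, of 1] by (simp add: mult_nonpos_nonneg)
  then have "sqrt 2 * (dot_coeff 1 * dot_moment 1 h) \<le> 0"
    using mult_nonneg_nonpos[of "sqrt 2"] by simp
  then show ?thesis using mean_zero_energy_le[OF h h0, of 1] by simp
qed

lemma mean_zero_energy_eq_0:
  assumes h: "integrable surf h" and h0: "(LINT x|surf. h x) = 0"
    and "(LINT z|(surf \<Otimes>\<^sub>M surf). h (fst z) * h (snd z) * chord_kernel z) \<ge> 0"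
  shows "AE x in surf. h x = 0"
proof -
  have "dot_moment k h = 0" for k
  proof (cases "k = 0")
    case True then show ?thesis by (simp add: dot_moment_0[OF h] h0)
  next
    case False
    then have k: "k \<ge> 1" by simp
    have "0 \<le> sqrt 2 * (dot_coeff k * dot_moment k h)"
      using mean_zero_energy_le[OF h h0 k] assms(3) by linarith
    then have "0 \<le> dot_coeff k * dot_moment k h"
      by (simp add: zero_le_mult_iff)
    then show ?thesis
      using dot_coeff_neg[OF k] dot_moment_nonneg[OF h, of k] by (simp add: zero_le_mult_iff)
  qed
  then show ?thesis
    by (intro AE_surf_zero_if_polynomial_moments_zero[OF h] polynomial_moments_zero_if_dot_moments_zero[OF h])
qed

text \<open>
  The potential of the uniform distribution is constant on the sphere; therefore the constant part
  of a function does not interact with the part of mean zero.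
\<close>
lemma LINT_surf_chord_kernel:
  assumes x: "norm x = 1"
  shows "(LINT y|surf. chord_kernel (x, y)) = 16 * pi"
proof -
  have d: "(\<integral>\<^sup>+y. ennreal (norm (y - x)) \<partial>surf) = ennreal (16 / 3 * pi)" if x: "norm x = 1" for x :: "real^3"
  proof -
    have "(\<integral>\<^sup>+y. ennreal (norm (y - x)) \<partial>surf) = (\<integral>\<^sup>+r. ennreal (2 * pi * r) * indicator {0..2} r * ennreal r \<partial>lborel)"
      by (rule nn_integral_surf_chord[OF x]) measurable
    also have "\<dots> = (\<integral>\<^sup>+r. ennreal (2 * pi * r * r) * indicator {0..2} r \<partial>lborel)"
      by (intro nn_integral_cong) (auto simp: indicator_def ennreal_mult)
    also have "\<dots> = ennreal (2 * pi * (2 ^ 3 / 3) - 2 * pi * (0 ^ 3 / 3))"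
      by (intro nn_integral_FTC_Icc[where F = "\<lambda>r. 2 * pi * (r ^ 3 / 3)"])
         (auto intro!: derivative_eq_intros simp: power2_eq_square)
    finally show ?thesis by simp
  qed
  have "(\<integral>\<^sup>+y. ennreal (chord_kernel (x, y)) \<partial>surf) = (\<integral>\<^sup>+y. 2 * ennreal (norm (y - x)) + ennreal (norm (y - (- x))) \<partial>surf)"
    by (intro nn_integral_cong) (simp add: ennreal_mult norm_minus_commute add.commute)
  also have "\<dots> = 2 * (\<integral>\<^sup>+y. ennreal (norm (y - x)) \<partial>surf) + (\<integral>\<^sup>+y. ennreal (norm (y - (- x))) \<partial>surf)"
    by (subst nn_integral_add) (simp_all add: nn_integral_cmult)
  also have "\<dots> = 2 * ennreal (16 / 3 * pi) + ennreal (16 / 3 * pi)"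
    using x by (simp only: d norm_minus_cancel)
  also have "\<dots> = ennreal (16 * pi)"
    by (subst ennreal_numeral[symmetric], subst ennreal_mult[symmetric], simp, simp, subst ennreal_plus[symmetric]) auto
  finally show ?thesis
    by (intro integral_eq_nn_integral[THEN trans]) auto
qed


lemma integrable_chord_kernel:
  assumes "integrable surf h" "integrable surf g"
  shows "integrable (surf \<Otimes>\<^sub>M surf) (\<lambda>z. h (fst z) * g (snd z) * chord_kernel z)"
proof (rule integrable_surf_pair_kernel[OF assms])
  show "\<bar>chord_kernel (x, y)\<bar> \<le> 6" if "norm x = 1" "norm y = 1" for x y
    using chord_kernel_le[OF that] .
qed measurable

lemma chord_kernel_const_left:
  assumes h: "integrable surf h"
  shows "(LINT z|(surf \<Otimes>\<^sub>M surf). h (fst z) * m * chord_kernel z) = 16 * pi * m * (LINT x|surf. h x)"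
proof -
  have [measurable]: "h \<in> borel_measurable borel" using borel_measurable_integrable[OF h] by simp
  have "(LINT z|(surf \<Otimes>\<^sub>M surf). h (fst z) * m * chord_kernel z)
      = (LINT x|surf. (LINT y|surf. h (fst (x, y)) * m * chord_kernel (x, y)))"
    by (rule surf_pair.integral_fst'[symmetric]) (intro integrable_chord_kernel[of h "\<lambda>_. m"] h, simp)
  also have "\<dots> = (LINT x|surf. 16 * pi * m * h x)"
  proof (rule integral_cong_AE)
    show "AE x in surf. (LINT y|surf. h (fst (x, y)) * m * chord_kernel (x, y)) = 16 * pi * m * h x"
      using AE_surf_norm
    proof eventually_elim
      case (elim x)
      have "(LINT y|surf. h (fst (x, y)) * m * chord_kernel (x, y)) = h x * m * (LINT y|surf. chord_kernel (x, y))"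
        unfolding fst_conv by (rule Bochner_Integration.integral_mult_right_zero)
      then show ?case unfolding LINT_surf_chord_kernel[OF elim] by simp
    qed
  qed measurable
  also have "\<dots> = 16 * pi * m * (LINT x|surf. h x)"
    by (rule Bochner_Integration.integral_mult_right_zero)
  finally show ?thesis .
qed

lemma chord_kernel_const_right:
  assumes h: "integrable surf h"
  shows "(LINT z|(surf \<Otimes>\<^sub>M surf). m * h (snd z) * chord_kernel z) = 16 * pi * m * (LINT x|surf. h x)"
proof -
  have [measurable]: "h \<in> borel_measurable borel" using borel_measurable_integrable[OF h] by simp
  have "(LINT z|(surf \<Otimes>\<^sub>M surf). m * h (snd z) * chord_kernel z)
      = (LINT (x, y)|(surf \<Otimes>\<^sub>M surf). h (fst (y, x)) * m * chord_kernel (y, x))"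
    by (intro Bochner_Integration.integral_cong)
       (auto simp: norm_minus_commute add.commute case_prod_unfold)
  also have "\<dots> = (LINT z|(surf \<Otimes>\<^sub>M surf). h (fst z) * m * chord_kernel z)"
    by (rule surf_pair.integral_product_swap) measurable
  finally show ?thesis by (simp only: chord_kernel_const_left[OF h])
qed

text \<open>
  Splitting \<open>g\<close> into its mean \<open>m\<close> and \<open>h = g - m\<close>, the energy of \<open>m\<close> is \<open>4 (\<integral> g)\<^sup>2\<close>, the mixed terms
  vanish, and the energy of \<open>h\<close> is nonpositive.
\<close>
lemma
  fixes g :: "real^3 \<Rightarrow> real"
  assumes g: "integrable surf g" and g0: "\<And>x. g x \<ge> 0"
  defines "m \<equiv> (LINT x|surf. g x) / (4 * pi)"
  shows chord_energy_le: "chord_energy g \<le> ennreal (4 * (LINT x|surf. g x)\<^sup>2)"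
    and chord_energy_ge_imp_const: "ennreal (4 * (LINT x|surf. g x)\<^sup>2) \<le> chord_energy g \<Longrightarrow> AE x in surf. g x = m"
proof -
  have [measurable]: "g \<in> borel_measurable borel" using borel_measurable_integrable[OF g] by simp
  have mu: "measure surf UNIV = 4 * pi"
    using emeasure_surf_UNIV by (simp add: surf.emeasure_eq_measure)
  define h where "h x = g x - m" for x
  have ic: "integrable surf (\<lambda>_. c)" for c :: real by simp
  have h: "integrable surf h" unfolding h_def using g ic by (rule Bochner_Integration.integrable_diff)
  have "(LINT x|surf. h x) = (LINT x|surf. g x) - (LINT x|surf. m)"
    unfolding h_def using g ic by (rule Bochner_Integration.integral_diff)
  then have h0: "(LINT x|surf. h x) = 0"
    by (simp add: mu m_def)
  let ?B = "\<lambda>u v. (LINT z|(surf \<Otimes>\<^sub>M surf). u (fst z) * v (snd z) * chord_kernel z)"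
  have "?B g g = (LINT z|(surf \<Otimes>\<^sub>M surf). (m * m * chord_kernel z + h (fst z) * m * chord_kernel z)
      + (m * h (snd z) * chord_kernel z + h (fst z) * h (snd z) * chord_kernel z))"
    by (intro Bochner_Integration.integral_cong refl) (simp add: h_def algebra_simps)
  also have "\<dots> = ((LINT z|(surf \<Otimes>\<^sub>M surf). m * m * chord_kernel z) + (LINT z|(surf \<Otimes>\<^sub>M surf). h (fst z) * m * chord_kernel z))
      + ((LINT z|(surf \<Otimes>\<^sub>M surf). m * h (snd z) * chord_kernel z) + ?B h h)"
    using integrable_chord_kernel[OF ic[of m] ic[of m]] integrable_chord_kernel[OF h ic[of m]]
      integrable_chord_kernel[OF ic[of m] h] integrable_chord_kernel[OF h h]
    by (simp only: Bochner_Integration.integral_add Bochner_Integration.integrable_add)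
  also have "\<dots> = 64 * pi\<^sup>2 * m\<^sup>2 + ?B h h"
    using chord_kernel_const_left[OF ic[of m], of m] chord_kernel_const_left[OF h, of m] chord_kernel_const_right[OF h, of m]
    by (simp add: h0 mu power2_eq_square)
  also have "64 * pi\<^sup>2 * m\<^sup>2 = 4 * (LINT x|surf. g x)\<^sup>2"
    by (simp add: m_def power_divide power_mult_distrib)
  finally have B: "?B g g = 4 * (LINT x|surf. g x)\<^sup>2 + ?B h h" .
  have nn: "g (fst z) * g (snd z) * chord_kernel z \<ge> 0" for z using g0 by simp
  have E: "chord_energy g = ennreal (?B g g)"
  proof -
    have "chord_energy g = (\<integral>\<^sup>+z. ennreal (g (fst z) * g (snd z) * chord_kernel z) \<partial>(surf \<Otimes>\<^sub>M surf))"
    proof -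
      have "(\<lambda>z. ennreal (g (fst z) * g (snd z) * chord_kernel z)) \<in> borel_measurable (surf \<Otimes>\<^sub>M surf)"
        by measurable
      from surf.nn_integral_fst[OF this] show ?thesis
        unfolding chord_energy_def by simp
    qed
    also have "\<dots> = ennreal (?B g g)"
      using nn by (intro nn_integral_eq_integral integrable_chord_kernel g) auto
    finally show ?thesis .
  qed
  show "chord_energy g \<le> ennreal (4 * (LINT x|surf. g x)\<^sup>2)"
    unfolding E B using mean_zero_energy_nonpos[OF h h0] by (intro ennreal_leI) simp
  assume "ennreal (4 * (LINT x|surf. g x)\<^sup>2) \<le> chord_energy g"
  moreover have "?B g g \<ge> 0"
    by (rule Bochner_Integration.integral_nonneg) (rule nn)
  ultimately have "4 * (LINT x|surf. g x)\<^sup>2 \<le> ?B g g"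
    unfolding E by (simp only: ennreal_le_iff)
  then have "?B h h \<ge> 0"
    unfolding B by simp
  from mean_zero_energy_eq_0[OF h h0 this] show "AE x in surf. g x = m"
    by eventually_elim (simp add: h_def)
qed

section \<open>The sharp inequality\<close>

interpretation surf2: pair_sigma_finite "surf \<Otimes>\<^sub>M surf" "surf \<Otimes>\<^sub>M surf" ..

lemma fourier_ext_surf:
  assumes [measurable]: "f \<in> borel_measurable borel"
  shows "fourier_ext f x = (LINT \<omega>|surf. exp (- \<i> * complex_of_real (x \<bullet> \<omega>)) * f \<omega>)"
  unfolding fourier_ext_def surf_def
  by (rule integral_distr[symmetric]) (auto simp: id_measurable_sphere)

lemma norm_power4: "norm z ^ 4 = (norm (z ^ 2))\<^sup>2" for z :: complex
  by (simp add: norm_power)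

lemma fourier_ext_sq:
  assumes f: "integrable surf f"
  shows "(fourier_ext f x)\<^sup>2 = (LINT p|(surf \<Otimes>\<^sub>M surf). exp (- \<i> * complex_of_real (x \<bullet> (fst p + snd p))) * (f (fst p) * f (snd p)))"
proof -
  have [measurable]: "f \<in> borel_measurable borel" using borel_measurable_integrable[OF f] by simp
  let ?e = "\<lambda>\<omega>. exp (- \<i> * complex_of_real (x \<bullet> \<omega>)) * f \<omega>"
  have i: "integrable surf ?e"
    by (rule Bochner_Integration.integrable_bound[OF f]) (auto simp: norm_mult)
  have "(fourier_ext f x)\<^sup>2 = (LINT p|(surf \<Otimes>\<^sub>M surf). ?e (fst p) * ?e (snd p))"
    unfolding fourier_ext_surf[OF \<open>f \<in> borel_measurable borel\<close>] power2_eq_square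
    by (rule surf_pair.integrable_tensor(2)[OF i i, symmetric])
  also have "\<dots> = (LINT p|(surf \<Otimes>\<^sub>M surf). exp (- \<i> * complex_of_real (x \<bullet> (fst p + snd p))) * (f (fst p) * f (snd p)))"
    by (intro Bochner_Integration.integral_cong) (simp_all add: inner_add_right algebra_simps exp_add[symmetric] exp_diff exp_minus field_simps)
  finally show ?thesis .
qed

lemma quad_pairs:
  assumes [measurable]: "f \<in> borel_measurable borel"
  shows "quad s f = (\<integral>\<^sup>+z. ennreal (f (fst (fst z)) * f (snd (fst z)) * (f (fst (snd z)) * f (snd (snd z)))
      * gauss_hat s (fst (fst z) + snd (fst z) - (fst (snd z) + snd (snd z)))) \<partial>((surf \<Otimes>\<^sub>M surf) \<Otimes>\<^sub>M (surf \<Otimes>\<^sub>M surf)))"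
    (is "_ = (\<integral>\<^sup>+z. ?u z \<partial>_)")
proof -
  have u: "?u \<in> borel_measurable ((surf \<Otimes>\<^sub>M surf) \<Otimes>\<^sub>M (surf \<Otimes>\<^sub>M surf))" by measurable
  have 1: "(\<lambda>p. \<integral>\<^sup>+q. ?u (p, q) \<partial>(surf \<Otimes>\<^sub>M surf)) \<in> borel_measurable (surf \<Otimes>\<^sub>M surf)"
    using surf_pair.P.borel_measurable_nn_integral_fst[OF u] .
  have 2: "(\<lambda>q. ?u ((a, b), q)) \<in> borel_measurable (surf \<Otimes>\<^sub>M surf)" for a b
    unfolding fst_conv snd_conv by measurable
  have "(\<integral>\<^sup>+z. ?u z \<partial>((surf \<Otimes>\<^sub>M surf) \<Otimes>\<^sub>M (surf \<Otimes>\<^sub>M surf))) = (\<integral>\<^sup>+p. (\<integral>\<^sup>+q. ?u (p, q) \<partial>(surf \<Otimes>\<^sub>M surf)) \<partial>(surf \<Otimes>\<^sub>M surf))"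
    by (rule surf_pair.P.nn_integral_fst[OF u, symmetric])
  also have "\<dots> = (\<integral>\<^sup>+a. (\<integral>\<^sup>+b. (\<integral>\<^sup>+q. ?u ((a, b), q) \<partial>(surf \<Otimes>\<^sub>M surf)) \<partial>surf) \<partial>surf)"
    by (rule surf.nn_integral_fst[OF 1, symmetric])
  also have "\<dots> = (\<integral>\<^sup>+a. (\<integral>\<^sup>+b. (\<integral>\<^sup>+c. (\<integral>\<^sup>+d. ?u ((a, b), (c, d)) \<partial>surf) \<partial>surf) \<partial>surf) \<partial>surf)"
    by (intro nn_integral_cong surf.nn_integral_fst[OF 2, symmetric])
  also have "\<dots> = quad s f"
    by (simp add: quad_def surf4_def mult.assoc algebra_simps)
  finally show ?thesis ..
qed

text \<open>
  The square of the extension of \<open>f\<close> is the oscillatory integral of \<open>f(a) f(b)\<close> with frequency \<open>a + b\<close>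
  over pairs of points.  So \<open>gaussian_energy\<close> applies to the product measure; replacing \<open>f\<close> by its
  modulus can only increase the resulting integral.
\<close>
lemma
  fixes f :: "real^3 \<Rightarrow> complex"
  assumes f: "integrable surf f" and s: "s > 0"
  shows weighted_L4_le_quad: "(\<integral>\<^sup>+x. ennreal (norm (fourier_ext f x) ^ 4 * exp (- s\<^sup>2 * (norm x)\<^sup>2 / 2)) \<partial>lborel) \<le> quad s (\<lambda>x. norm (f x))"
    and weighted_L4_eq_quad: "(\<And>x. f x \<in> \<real>\<^sub>\<ge>\<^sub>0) \<Longrightarrow>
      (\<integral>\<^sup>+x. ennreal (norm (fourier_ext f x) ^ 4 * exp (- s\<^sup>2 * (norm x)\<^sup>2 / 2)) \<partial>lborel) = quad s (\<lambda>x. norm (f x))"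
    and quad_finite: "quad s (\<lambda>x. norm (f x)) < \<infinity>"
proof -
  have [measurable]: "f \<in> borel_measurable borel" using borel_measurable_integrable[OF f] by simp
  let ?\<mu> = "surf \<Otimes>\<^sub>M surf"
  let ?\<Phi> = "\<lambda>p. f (fst p) * f (snd p)"
  let ?v = "\<lambda>p::(real^3) \<times> (real^3). fst p + snd p"
  have \<Phi>: "integrable ?\<mu> ?\<Phi>" by (rule surf_pair.integrable_tensor(1)[OF f f])
  have v: "?v \<in> borel_measurable ?\<mu>" by measurable
  note G = gaussian_energy[OF surf_pair.P.sigma_finite_measure_axioms \<Phi> v s, folded fourier_ext_sq[OF f] norm_power4]
  let ?w = "\<lambda>x. norm (fourier_ext f x) ^ 4 * exp (- s\<^sup>2 * (norm x)\<^sup>2 / 2)"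
  let ?H = "\<lambda>z. ?\<Phi> (fst z) * cnj (?\<Phi> (snd z)) * complex_of_real (gauss_hat s (?v (fst z) - ?v (snd z)))"
  have nH: "norm (?H z) = norm (f (fst (fst z))) * norm (f (snd (fst z))) * (norm (f (fst (snd z))) * norm (f (snd (snd z))))
      * gauss_hat s (fst (fst z) + snd (fst z) - (fst (snd z) + snd (snd z)))" for z
    using gauss_hat_pos[OF s, of "?v (fst z) - ?v (snd z)"] by (simp add: norm_mult)
  have Q: "quad s (\<lambda>x. norm (f x)) = ennreal (LINT z|(?\<mu> \<Otimes>\<^sub>M ?\<mu>). norm (?H z))"
    unfolding nH[symmetric] by (subst quad_pairs, measurable, unfold nH[symmetric])
      (intro nn_integral_eq_integral integrable_norm G(2), simp)
  have W: "(\<integral>\<^sup>+x. ennreal (?w x) \<partial>lborel) = ennreal (LINT x|lborel. ?w x)"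
    by (intro nn_integral_eq_integral G(1)) simp
  have W0: "(LINT x|lborel. ?w x) \<ge> 0"
    by (intro Bochner_Integration.integral_nonneg) simp
  show "quad s (\<lambda>x. norm (f x)) < \<infinity>" unfolding Q by simp
  have "(LINT x|lborel. ?w x) = norm (complex_of_real (LINT x|lborel. ?w x))"
    using W0 by simp
  also have "\<dots> \<le> (LINT z|(?\<mu> \<Otimes>\<^sub>M ?\<mu>). norm (?H z))"
    unfolding G(3) by (rule integral_norm_bound)
  finally show "(\<integral>\<^sup>+x. ennreal (?w x) \<partial>lborel) \<le> quad s (\<lambda>x. norm (f x))"
    unfolding W Q by (rule ennreal_leI)
  assume real: "\<And>x. f x \<in> \<real>\<^sub>\<ge>\<^sub>0"
  have fn: "f x = complex_of_real (norm (f x))" for x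
    using real[of x] by (metis nonneg_Reals_cases norm_of_real abs_of_nonneg)
  have "?H z = complex_of_real (norm (?H z))" for z
    unfolding nH of_real_mult fn[symmetric] using fn by (metis (no_types, lifting) complex_cnj_mult complex_cnj_complex_of_real mult.assoc diff_add_eq)
  then have "(LINT z|(?\<mu> \<Otimes>\<^sub>M ?\<mu>). ?H z) = complex_of_real (LINT z|(?\<mu> \<Otimes>\<^sub>M ?\<mu>). norm (?H z))"
    by (simp only: integral_complex_of_real[symmetric])
  then have "(LINT x|lborel. ?w x) = (LINT z|(?\<mu> \<Otimes>\<^sub>M ?\<mu>). norm (?H z))"
    using G(3) by (simp only: of_real_eq_iff)
  then show "(\<integral>\<^sup>+x. ennreal (?w x) \<partial>lborel) = quad s (\<lambda>x. norm (f x))"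
    unfolding W Q by simp
qed

lemma fourier_ext_measurable:
  assumes [measurable]: "f \<in> borel_measurable borel"
  shows "fourier_ext f \<in> borel_measurable borel"
  unfolding fourier_ext_surf[OF assms, abs_def] by measurable

text \<open>
  This monotonicity is not apparent from the definition; it comes from the Gaussian weight on the
  Fourier side.
\<close>
lemma quad_antimono:
  fixes f :: "real^3 \<Rightarrow> complex"
  assumes f: "integrable surf f" and s: "0 < s" "s \<le> t"
  shows "quad t (\<lambda>x. norm (f x)) \<le> quad s (\<lambda>x. norm (f x))"
proof -
  let ?f = "\<lambda>x. complex_of_real (norm (f x))"
  have i: "integrable surf ?f" using f by auto
  have n: "norm (?f x) = norm (f x)" for x by simp
  have "exp (- t\<^sup>2 * (norm x)\<^sup>2 / 2) \<le> exp (- s\<^sup>2 * (norm x)\<^sup>2 / 2)" for x :: "real^3"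
    using power_mono[OF s(2), of 2] s by (auto intro: mult_right_mono)
  then have "(\<integral>\<^sup>+x. ennreal (norm (fourier_ext ?f x) ^ 4 * exp (- t\<^sup>2 * (norm x)\<^sup>2 / 2)) \<partial>lborel)
    \<le> (\<integral>\<^sup>+x. ennreal (norm (fourier_ext ?f x) ^ 4 * exp (- s\<^sup>2 * (norm x)\<^sup>2 / 2)) \<partial>lborel)"
    by (intro nn_integral_mono ennreal_leI mult_left_mono) auto
  then show ?thesis
    using weighted_L4_eq_quad[OF i, of s] weighted_L4_eq_quad[OF i, of t] s unfolding n by simp
qed

lemma Liminf_ennreal_le:
  fixes u :: "nat \<Rightarrow> ennreal" and v :: "nat \<Rightarrow> real"
  assumes "\<And>n. u n \<le> ennreal (v n)" "v \<longlonglongrightarrow> l"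
  shows "liminf u \<le> ennreal l"
proof -
  have "liminf u \<le> liminf (\<lambda>n. ennreal (v n))"
    using assms(1) by (intro Liminf_mono) auto
  also have "\<dots> = ennreal l"
    using assms(2) by (intro lim_imp_Liminf tendsto_ennrealI) auto
  finally show ?thesis .
qed

text \<open>
  By monotonicity \<open>quad (\<surd>2 s)\<close> in the error term is at most \<open>quad s\<close>, which is finite, so the error is
  absorbed as soon as \<open>32 s < 4\<close>.  Fatou's lemma removes the weight as \<open>s\<close> tends to \<open>0\<close>.
\<close>
lemma fourier_ext_L4_le_chord_energy:
  fixes f :: "real^3 \<Rightarrow> complex"
  assumes fm: "f \<in> borel_measurable borel" and f2: "integrable surf (\<lambda>x. (norm (f x))\<^sup>2)"
  shows "4 * (\<integral>\<^sup>+x. ennreal (norm (fourier_ext f x) ^ 4) \<partial>lborel) \<le> ennreal ((2 * pi) ^ 4) * chord_energy (\<lambda>x. (norm (f x))\<^sup>2)"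
proof -
  note [measurable] = fm fourier_ext_measurable[OF fm]
  have f: "integrable surf f"
  proof (rule Bochner_Integration.integrable_bound[where f = "\<lambda>x. 1 + (norm (f x))\<^sup>2"])
    have "norm (f x) \<le> 1 + (norm (f x))\<^sup>2" for x
      using zero_le_power2[of "norm (f x) - 1 / 2"] by (simp add: power2_eq_square algebra_simps)
    then show "AE x in surf. norm (f x) \<le> norm (1 + (norm (f x))\<^sup>2)"
      by (intro AE_I2) (simp add: order_trans[OF _ abs_ge_self])
  qed (use f2 in auto)
  have "chord_energy (\<lambda>x. (norm (f x))\<^sup>2) < \<infinity>"
    using chord_energy_le[OF f2] by (rule le_less_trans) auto
  then obtain e where e: "e \<ge> 0" "chord_energy (\<lambda>x. (norm (f x))\<^sup>2) = ennreal e"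
    by (metis ennreal_cases infinity_ennreal_def less_irrefl)
  define K where "K = (2 * pi) ^ 4 * e"
  have K: "K \<ge> 0" using e by (simp add: K_def)
  have quad: "quad s (\<lambda>x. norm (f x)) \<le> ennreal (K / (4 - 32 * s))" if s: "0 < s" "32 * s < 4" for s
  proof -
    obtain q where q: "q \<ge> 0" "quad s (\<lambda>x. norm (f x)) = ennreal q"
      using quad_finite[OF f s(1)] by (metis ennreal_cases infinity_ennreal_def less_irrefl)
    have "4 * quad s (\<lambda>x. norm (f x)) \<le> ennreal ((2 * pi) ^ 4) * chord_energy (\<lambda>x. (norm (f x))\<^sup>2) + ennreal (32 * s) * quad (sqrt 2 * s) (\<lambda>x. norm (f x))"
      using s by (intro quad_self_improving) auto
    also have "\<dots> \<le> ennreal ((2 * pi) ^ 4) * chord_energy (\<lambda>x. (norm (f x))\<^sup>2) + ennreal (32 * s) * quad s (\<lambda>x. norm (f x))"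
      using s by (intro add_left_mono mult_left_mono quad_antimono f) auto
    also have "\<dots> = ennreal (K + 32 * s * q)"
      using s q e by (simp add: K_def ennreal_mult ennreal_plus)
    also have "4 * quad s (\<lambda>x. norm (f x)) = ennreal (4 * q)"
      using q by (simp add: ennreal_mult)
    finally have "4 * q \<le> K + 32 * s * q"
      using s q K by (subst (asm) ennreal_le_iff) auto
    then show ?thesis unfolding q(2) using s by (intro ennreal_leI) (simp add: field_simps)
  qed
  \<comment> \<open>The shift by 9 ensures \<open>32 * s n < 4\<close> from the start.\<close>
  define s where "s n = 1 / (real n + 9)" for n
  have s: "0 < s n" "32 * s n < 4" for n by (auto simp: s_def field_simps)
  have sl: "s \<longlonglongrightarrow> 0" unfolding s_def by real_asymp
  let ?w = "\<lambda>n x. ennreal (norm (fourier_ext f x) ^ 4 * exp (- (s n)\<^sup>2 * (norm x)\<^sup>2 / 2))"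
  have "(\<integral>\<^sup>+x. ennreal (norm (fourier_ext f x) ^ 4) \<partial>lborel) = (\<integral>\<^sup>+x. liminf (\<lambda>n. ?w n x) \<partial>lborel)"
  proof (intro nn_integral_cong)
    fix x :: "real^3"
    have "(\<lambda>n. norm (fourier_ext f x) ^ 4 * exp (- (s n)\<^sup>2 * (norm x)\<^sup>2 / 2)) \<longlonglongrightarrow> norm (fourier_ext f x) ^ 4 * exp (- 0\<^sup>2 * (norm x)\<^sup>2 / 2)"
      by (intro tendsto_intros sl) simp
    then have "(\<lambda>n. ?w n x) \<longlonglongrightarrow> ennreal (norm (fourier_ext f x) ^ 4)"
      by (intro tendsto_ennrealI) simp
    then show "ennreal (norm (fourier_ext f x) ^ 4) = liminf (\<lambda>n. ?w n x)"
      by (intro lim_imp_Liminf[symmetric]) auto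
  qed
  also have "\<dots> \<le> liminf (\<lambda>n. \<integral>\<^sup>+x. ?w n x \<partial>lborel)"
    by (rule nn_integral_liminf) measurable
  also have "\<dots> \<le> ennreal (K / (4 - 32 * 0))"
  proof (rule Liminf_ennreal_le)
    show "(\<integral>\<^sup>+x. ?w n x \<partial>lborel) \<le> ennreal (K / (4 - 32 * s n))" for n
      using weighted_L4_le_quad[OF f s(1)] quad[OF s] by (rule order_trans)
    show "(\<lambda>n. K / (4 - 32 * s n)) \<longlonglongrightarrow> K / (4 - 32 * 0)"
      by (intro tendsto_intros sl) simp
  qed
  finally have "4 * (\<integral>\<^sup>+x. ennreal (norm (fourier_ext f x) ^ 4) \<partial>lborel) \<le> 4 * ennreal (K / 4)"
    by (intro mult_left_mono) auto
  also have "\<dots> = ennreal (4 * (K / 4))"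
    using K by (subst ennreal_mult) auto
  also have "\<dots> = ennreal ((2 * pi) ^ 4) * chord_energy (\<lambda>x. (norm (f x))\<^sup>2)"
    unfolding e(2) using e(1) by (subst ennreal_mult[symmetric]) (auto simp: K_def)
  finally show ?thesis .
qed

section \<open>The constant function attains the constant\<close>

definition chord_mass_mean :: "real \<Rightarrow> ennreal" where
  "chord_mass_mean s = (\<integral>\<^sup>+r. ennreal (2 * pi * r) * indicator {0..2} r * chord_mass s r \<partial>lborel)"

lemma chord_mass_measurable [measurable]: "chord_mass s \<in> borel_measurable borel"
  unfolding chord_mass_def[abs_def] by measurable

text \<open>
  The computation of \<open>quad_self_improving\<close> in the opposite direction: for the constant function the
  inequality of the means is not needed, and \<open>smoothed_diff_eq\<close> gives the exact value of each of the
  three parts.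
\<close>
lemma chord_mass_mean_le_quad:
  assumes s: "s > 0"
  shows "ennreal (12 * pi * (2 * pi) ^ 4) * chord_mass_mean s \<le> 4 * quad s (\<lambda>_. 1) + ennreal (32 * s) * quad (sqrt 2 * s) (\<lambda>_. 1)"
proof -
  let ?G = "\<lambda>a b c d. gauss_hat s (a + b - c - d)"
  have G: "?G a b c d \<ge> 0" for a b c d using gauss_hat_pos[OF s, of "a + b - c - d"] by simp
  let ?t1 = "\<lambda>a b c d. ennreal (1 * 1 * (norm (a + b) * norm (c + d)) * ?G a b c d)"
  let ?t2 = "\<lambda>a b c d. ennreal (1 * 1 * (norm (a - c) * norm (b - d)) * ?G a b c d)"
  let ?t3 = "\<lambda>a b c d. ennreal (1 * 1 * (norm (a - d) * norm (b - c)) * ?G a b c d)"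
  have mass: "(\<integral>\<^sup>+b. chord_mass s (norm (b - a)) \<partial>surf) = chord_mass_mean s" if "norm a = 1" for a
    unfolding chord_mass_mean_def by (rule nn_integral_surf_chord[OF that]) measurable
  let ?R = "ennreal ((2 * pi) ^ 4) * (ennreal (4 * pi) * chord_mass_mean s)"
  have const: "(\<integral>\<^sup>+a. ennreal ((2 * pi) ^ 4) * chord_mass_mean s \<partial>surf) = ?R"
    by (simp add: emeasure_surf_UNIV mult_ac)
  have t1: "surf4 ?t1 = ?R"
  proof -
    have "surf4 ?t1 = (\<integral>\<^sup>+a. (\<integral>\<^sup>+b. ennreal (1 * 1) * (ennreal (norm (a + b)) * smoothed_diff s (a + b)) \<partial>surf) \<partial>surf)"
      by (rule surf4_sum_sum[OF _ _ s, of "\<lambda>_. 1"]) auto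
    also have "\<dots> = (\<integral>\<^sup>+a. (\<integral>\<^sup>+b. ennreal ((2 * pi) ^ 4) * chord_mass s (norm (b - (- a))) \<partial>surf) \<partial>surf)"
      unfolding smoothed_diff_eq[OF s] by (simp add: add.commute)
    also have "\<dots> = (\<integral>\<^sup>+a. ennreal ((2 * pi) ^ 4) * (\<integral>\<^sup>+b. chord_mass s (norm (b - (- a))) \<partial>surf) \<partial>surf)"
      by (intro nn_integral_cong nn_integral_cmult) measurable
    also have "\<dots> = (\<integral>\<^sup>+a. ennreal ((2 * pi) ^ 4) * chord_mass_mean s \<partial>surf)"
      by (intro nn_integral_surf_cong arg_cong2[where f = "(*)"] refl mass) simp
    finally show ?thesis unfolding const .
  qed
  have t2: "surf4 ?t2 = ?R"
  proof -
    have "surf4 ?t2 = (\<integral>\<^sup>+a. (\<integral>\<^sup>+b. ennreal (1 * 1) * (ennreal (norm (a - b)) * smoothed_diff s (a - b)) \<partial>surf) \<partial>surf)"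
      by (rule surf4_diff_diff[OF _ _ s, of "\<lambda>_. 1"]) auto
    also have "\<dots> = (\<integral>\<^sup>+a. (\<integral>\<^sup>+b. ennreal ((2 * pi) ^ 4) * chord_mass s (norm (b - a)) \<partial>surf) \<partial>surf)"
      unfolding smoothed_diff_eq[OF s] by (simp add: norm_minus_commute)
    also have "\<dots> = (\<integral>\<^sup>+a. ennreal ((2 * pi) ^ 4) * (\<integral>\<^sup>+b. chord_mass s (norm (b - a)) \<partial>surf) \<partial>surf)"
      by (intro nn_integral_cong nn_integral_cmult) measurable
    also have "\<dots> = (\<integral>\<^sup>+a. ennreal ((2 * pi) ^ 4) * chord_mass_mean s \<partial>surf)"
      by (intro nn_integral_surf_cong arg_cong2[where f = "(*)"] refl mass)
    finally show ?thesis unfolding const .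
  qed
  have t3: "surf4 ?t3 = ?R"
  proof -
    have "surf4 ?t3 = surf4 (\<lambda>a b c d. ?t2 a b d c)"
      by (simp add: algebra_simps)
    also have "\<dots> = surf4 ?t2" by (rule surf4_swap34) measurable
    finally show ?thesis unfolding t2 .
  qed
  have "ennreal (12 * pi * (2 * pi) ^ 4) * chord_mass_mean s = ennreal (3 * ((2 * pi) ^ 4 * (4 * pi))) * chord_mass_mean s"
    by (simp add: mult_ac)
  also have "ennreal (3 * ((2 * pi) ^ 4 * (4 * pi))) = 3 * (ennreal ((2 * pi) ^ 4) * ennreal (4 * pi))"
    by (subst ennreal_mult, simp, simp, subst ennreal_mult) auto
  also have "3 * (ennreal ((2 * pi) ^ 4) * ennreal (4 * pi)) * chord_mass_mean s = ?R + (?R + ?R)"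
  proof -
    have "(3::ennreal) = 1 + (1 + 1)" by simp
    then show ?thesis by (simp only: distrib_right mult_1 mult.assoc)
  qed
  also have "\<dots> = surf4 ?t1 + (surf4 ?t2 + surf4 ?t3)"
    by (simp only: t1 t2 t3)
  also have "\<dots> = surf4 (\<lambda>a b c d. ?t1 a b c d + (?t2 a b c d + ?t3 a b c d))"
    by (subst surf4_add[symmetric], measurable, rule surf4_add[symmetric], measurable)
  also have "\<dots> \<le> surf4 (\<lambda>a b c d. 4 * ennreal (1 * 1 * 1 * 1 * ?G a b c d)
      + ennreal (32 * s) * ennreal (1 * 1 * 1 * 1 * gauss_hat (sqrt 2 * s) (a + b - c - d)))"
  proof (rule surf4_mono)
    fix a b c d :: "real^3" assume n: "norm a = 1" "norm b = 1" "norm c = 1" "norm d = 1"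
    let ?S = "norm (a + b) * norm (c + d) + norm (a - c) * norm (b - d) + norm (a - d) * norm (b - c)"
    have "?S * ?G a b c d \<le> (4 + 8 * norm (a + b - c - d)) * ?G a b c d"
      using four_chords[OF n] G by (intro mult_right_mono) auto
    also have "\<dots> \<le> 4 * ?G a b c d + 32 * s * gauss_hat (sqrt 2 * s) (a + b - c - d)"
      using norm_mult_gauss_hat_le[OF s, of "a + b - c - d"] by (simp add: algebra_simps)
    finally have "ennreal (?S * ?G a b c d) \<le> ennreal (4 * ?G a b c d + 32 * s * gauss_hat (sqrt 2 * s) (a + b - c - d))"
      by (rule ennreal_leI)
    also have "\<dots> = 4 * ennreal (1 * 1 * 1 * 1 * ?G a b c d) + ennreal (32 * s) * ennreal (1 * 1 * 1 * 1 * gauss_hat (sqrt 2 * s) (a + b - c - d))"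
      using G s gauss_hat_pos[of "sqrt 2 * s" "a + b - c - d"] by (simp add: ennreal_plus ennreal_mult)
    also have "ennreal (?S * ?G a b c d) = ?t1 a b c d + (?t2 a b c d + ?t3 a b c d)"
      using G by (simp add: distrib_right ennreal_plus add.assoc)
    finally show "?t1 a b c d + (?t2 a b c d + ?t3 a b c d) \<le> 4 * ennreal (1 * 1 * 1 * 1 * ?G a b c d) + ennreal (32 * s) * ennreal (1 * 1 * 1 * 1 * gauss_hat (sqrt 2 * s) (a + b - c - d))" .
  qed
  also have "\<dots> = 4 * quad s (\<lambda>_. 1) + ennreal (32 * s) * quad (sqrt 2 * s) (\<lambda>_. 1)"
    unfolding quad_def
    by (subst surf4_cmult[symmetric], measurable, subst surf4_cmult[symmetric], measurable, rule surf4_add, measurable)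
  finally show ?thesis .
qed


lemma mult_liminf_le: "c * liminf u \<le> liminf (\<lambda>n. c * u n)" for c :: ennreal
  unfolding liminf_SUP_INF SUP_mult_left_ennreal
  by (intro SUP_mono' INF_greatest mult_left_mono INF_lower) auto

lemma liminf_chord_mass_ge:
  assumes s: "\<And>n. s n > 0" "s \<longlonglongrightarrow> 0" and r: "0 \<le> r" "r < 2"
  shows "ennreal r \<le> liminf (\<lambda>n. chord_mass (s n) r)"
proof -
  define K where "K = r / (2 - r)\<^sup>2 + 1 / (2 - r)"
  have K: "K \<ge> 0" using r by (simp add: K_def)
  have "ennreal (r - K * (s n)\<^sup>2) \<le> chord_mass (s n) r" for n
  proof -
    have "ennreal r - ennreal (K * (s n)\<^sup>2) \<le> chord_mass (s n) r"
      using chord_mass_ge[OF s(1) r(1) r(2), of n] unfolding K_def[symmetric]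
      by (subst ennreal_minus_le_iff) (auto simp: add.commute)
    then show ?thesis using K by (simp add: ennreal_minus)
  qed
  then have "liminf (\<lambda>n. ennreal (r - K * (s n)\<^sup>2)) \<le> liminf (\<lambda>n. chord_mass (s n) r)"
    by (intro Liminf_mono) auto
  moreover have "(\<lambda>n. ennreal (r - K * (s n)\<^sup>2)) \<longlonglongrightarrow> ennreal (r - K * 0\<^sup>2)"
    by (intro tendsto_ennrealI tendsto_intros s)
  then have "liminf (\<lambda>n. ennreal (r - K * (s n)\<^sup>2)) = ennreal r"
    by (intro lim_imp_Liminf) auto
  ultimately show ?thesis by simp
qed

lemma liminf_chord_mass_mean_ge:
  assumes s: "\<And>n. s n > 0" "s \<longlonglongrightarrow> 0"
  shows "ennreal (16 / 3 * pi) \<le> liminf (\<lambda>n. chord_mass_mean (s n))"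
proof -
  have "ennreal (16 / 3 * pi) = ennreal (2 * pi * (2 ^ 3 / 3) - 2 * pi * (0 ^ 3 / 3))"
    by simp
  also have "\<dots> = (\<integral>\<^sup>+r. ennreal (2 * pi * r * r) * indicator {0..2} r \<partial>lborel)"
    by (intro nn_integral_FTC_Icc[where F = "\<lambda>r. 2 * pi * (r ^ 3 / 3)", symmetric])
       (auto intro!: derivative_eq_intros simp: power2_eq_square)
  also have "\<dots> \<le> (\<integral>\<^sup>+r. liminf (\<lambda>n. ennreal (2 * pi * r) * indicator {0..2} r * chord_mass (s n) r) \<partial>lborel)"
  proof (intro nn_integral_mono_AE, use AE_lborel_singleton[of 2] in eventually_elim)
    fix r :: real assume "r \<noteq> 2"
    then consider "0 \<le> r" "r < 2" | "r \<notin> {0..2}" by fastforce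
    then show "ennreal (2 * pi * r * r) * indicator {0..2} r \<le> liminf (\<lambda>n. ennreal (2 * pi * r) * indicator {0..2} r * chord_mass (s n) r)"
    proof cases
      case 1
      have "ennreal (2 * pi * r * r) = ennreal (2 * pi * r) * ennreal r"
        using 1 by (intro ennreal_mult) auto
      also have "\<dots> \<le> ennreal (2 * pi * r) * liminf (\<lambda>n. chord_mass (s n) r)"
        using liminf_chord_mass_ge[OF s 1] by (rule mult_left_mono) simp
      also have "\<dots> \<le> liminf (\<lambda>n. ennreal (2 * pi * r) * chord_mass (s n) r)"
        by (rule mult_liminf_le)
      finally show ?thesis using 1 by simp
    qed simp
  qed
  also have "\<dots> \<le> liminf (\<lambda>n. chord_mass_mean (s n))"
    unfolding chord_mass_mean_def by (rule nn_integral_liminf) measurable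
  finally show ?thesis .
qed

text \<open>
  Both occurrences of \<open>quad\<close> in \<open>chord_mass_mean_le_quad\<close> are at most the integral \<open>I\<close> on the right.  As
  \<open>s\<close> tends to \<open>0\<close>, the limit inferior of the left-hand side there is at least
  \<open>12\<pi> (2\<pi>)\<^sup>4 \<cdot> 16\<pi>/3 = 4 (2\<pi>)\<^sup>4 (4\<pi>)\<^sup>2\<close>, and the right-hand side is at most \<open>(4 + 32 s) I\<close>.
\<close>
lemma fourier_ext_one_L4_ge:
  "ennreal ((2 * pi) ^ 4 * (4 * pi)\<^sup>2) \<le> (\<integral>\<^sup>+x. ennreal (norm (fourier_ext (\<lambda>_. 1) x) ^ 4) \<partial>lborel)" (is "_ \<le> ?I")
proof (cases "?I = \<infinity>")
  case False
  then obtain i where i: "i \<ge> 0" "?I = ennreal i"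
    by (metis ennreal_cases infinity_ennreal_def)
  define s where "s n = 1 / (real n + 1)" for n
  have s: "s n > 0" for n by (simp add: s_def)
  have sl: "s \<longlonglongrightarrow> 0" unfolding s_def by real_asymp
  have one: "integrable surf (\<lambda>_. 1 :: complex)" by simp
  have quad: "quad t (\<lambda>_. 1) \<le> ?I" if "t > 0" for t
  proof -
    have "quad t (\<lambda>_. 1) = (\<integral>\<^sup>+x. ennreal (norm (fourier_ext (\<lambda>_. 1) x) ^ 4 * exp (- t\<^sup>2 * (norm x)\<^sup>2 / 2)) \<partial>lborel)"
      using weighted_L4_eq_quad[OF one that] by simp
    also have "\<dots> \<le> ?I"
      by (intro nn_integral_mono ennreal_leI mult_left_le) auto
    finally show ?thesis .
  qed
  let ?c = "12 * pi * (2 * pi) ^ 4"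
  have "ennreal (?c * (16 / 3 * pi)) = ennreal ?c * ennreal (16 / 3 * pi)"
    by (rule ennreal_mult) auto
  also have "\<dots> \<le> ennreal ?c * liminf (\<lambda>n. chord_mass_mean (s n))"
    using liminf_chord_mass_mean_ge[OF s sl] by (rule mult_left_mono) simp
  also have "\<dots> \<le> liminf (\<lambda>n. ennreal ?c * chord_mass_mean (s n))"
    by (rule mult_liminf_le)
  also have "\<dots> \<le> ennreal (4 * i + 32 * 0 * i)"
  proof (rule Liminf_ennreal_le)
    fix n
    have "ennreal ?c * chord_mass_mean (s n) \<le> 4 * quad (s n) (\<lambda>_. 1) + ennreal (32 * s n) * quad (sqrt 2 * s n) (\<lambda>_. 1)"
      by (rule chord_mass_mean_le_quad[OF s])
    also have "\<dots> \<le> 4 * ?I + ennreal (32 * s n) * ?I"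
      using s[of n] by (intro add_mono mult_left_mono quad) auto
    also have "\<dots> = ennreal (4 * i + 32 * s n * i)"
      unfolding i(2) using i(1) s[of n] by (simp add: ennreal_mult ennreal_plus)
    finally show "ennreal ?c * chord_mass_mean (s n) \<le> ennreal (4 * i + 32 * s n * i)" .
    show "(\<lambda>n. 4 * i + 32 * s n * i) \<longlonglongrightarrow> 4 * i + 32 * 0 * i"
      by (intro tendsto_intros sl)
  qed
  finally have "?c * (16 / 3 * pi) \<le> 4 * i"
    using i(1) by (subst (asm) ennreal_le_iff) auto
  then show ?thesis
    unfolding i(2) by (intro ennreal_leI) (simp add: power2_eq_square mult_ac)
qed simp

section \<open>Norms, the optimal constant and the maximizers\<close>

lemma Lp_norm_cong_AE:
  assumes "AE x in M. f x = g x"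
  shows "Lp_norm p M f = Lp_norm p M g"
proof -
  have "(\<integral>\<^sup>+ x. ennreal (norm (f x) powr p) \<partial>M) = (\<integral>\<^sup>+ x. ennreal (norm (g x) powr p) \<partial>M)"
    using assms by (intro nn_integral_cong_AE) (auto elim!: eventually_mono)
  then show ?thesis by (simp add: Lp_norm_def)
qed

lemma Lp_norm_eq_powr:
  assumes "(\<integral>\<^sup>+ x. ennreal (norm (f x) powr p) \<partial>M) = ennreal a" "a \<ge> 0"
  shows "Lp_norm p M f = ennreal (a powr (1 / p))"
  using assms by (simp add: Lp_norm_def)

lemma Lp_norm_cmult:
  assumes p: "p > 0" and [measurable]: "f \<in> borel_measurable M" and c: "c \<noteq> 0"
  shows "Lp_norm p M (\<lambda>x. c * f x) = ennreal (norm c) * Lp_norm p M f"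
proof -
  let ?I = "\<integral>\<^sup>+ x. ennreal (norm (f x) powr p) \<partial>M"
  have eq: "(\<integral>\<^sup>+ x. ennreal (norm (c * f x) powr p) \<partial>M) = ennreal (norm c powr p) * ?I"
    by (simp add: norm_mult powr_mult ennreal_mult nn_integral_cmult)
  show ?thesis
  proof (cases "?I = \<infinity>")
    case True
    then show ?thesis
      using c unfolding Lp_norm_def eq by (simp add: Let_def ennreal_mult_top)
  next
    case False
    then obtain i where i: "i \<ge> 0" "?I = ennreal i"
      by (metis ennreal_cases infinity_ennreal_def)
    have "Lp_norm p M (\<lambda>x. c * f x) = ennreal ((norm c powr p * i) powr (1 / p))"
      by (rule Lp_norm_eq_powr) (use i eq in \<open>simp_all add: ennreal_mult\<close>)
    also have "(norm c powr p * i) powr (1 / p) = norm c * i powr (1 / p)"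
      using p i by (simp add: powr_mult powr_powr)
    finally show ?thesis
      using i Lp_norm_eq_powr[OF i(2,1)] by (simp add: ennreal_mult)
  qed
qed

lemma nn_integral_sphere_eq_surf:
  assumes [measurable]: "u \<in> borel_measurable borel"
  shows "(\<integral>\<^sup>+x. u x \<partial>\<sigma>) = (\<integral>\<^sup>+x. u x \<partial>surf)"
  unfolding surf_def by (rule nn_integral_distr[symmetric]) (simp_all add: id_measurable_sphere)

lemma AE_sphere_iff_surf:
  assumes "{x. P x} \<in> sets borel"
  shows "(AE x in \<sigma>. P x) \<longleftrightarrow> (AE x in surf. P x)"
  unfolding surf_def by (rule AE_distr_iff[symmetric]) (use assms in \<open>simp_all add: id_measurable_sphere\<close>)

text \<open>
  Elements of \<open>L2\<close> are measurable for the trace of the Borel sets on the sphere only, and are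
  unconstrained off the sphere; extension by \<open>0\<close> makes them Borel functions.
\<close>
lemma L2_borel_representative:
  assumes "f \<in> L2 \<sigma>"
  obtains g where "g \<in> borel_measurable borel" "\<And>x. x \<in> space \<sigma> \<Longrightarrow> f x = g x"
proof
  let ?g = "\<lambda>x. indicator (sphere 0 1) x *\<^sub>R f x"
  have "f \<in> borel_measurable (restrict_space borel (sphere 0 1))"
    using assms measurable_cong_sets[OF sets_sphere_measure refl] by (auto simp: L2_def)
  then show "?g \<in> borel_measurable borel"
    by (subst (asm) borel_measurable_restrict_space_iff) auto
  show "f x = ?g x" if "x \<in> space \<sigma>" for x
    using that by (simp add: space_sphere_measure)
qed

lemma fourier_ext_cong_AE:
  assumes [measurable]: "f \<in> borel_measurable \<sigma>" "g \<in> borel_measurable \<sigma>" and "AE x in \<sigma>. f x = g x"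
  shows "fourier_ext f = fourier_ext g"
proof
  fix x
  note id_measurable_sphere [measurable]
  have "(\<lambda>\<omega>. exp (- \<i> * complex_of_real (x \<bullet> \<omega>))) \<in> borel_measurable \<sigma>"
    by (rule measurable_compose[OF id_measurable_sphere]) measurable
  then show "fourier_ext f x = fourier_ext g x"
    unfolding fourier_ext_def using assms
    by (intro integral_cong_AE borel_measurable_times) (auto elim!: eventually_mono)
qed

lemma powr_4: "x \<ge> 0 \<Longrightarrow> x powr 4 = x ^ 4" for x :: real
  by (cases "x = 0") (simp_all add: powr_numeral)

lemma powr_2: "x \<ge> 0 \<Longrightarrow> x powr 2 = x\<^sup>2" for x :: real
  by (cases "x = 0") (simp_all add: powr_numeral)

lemma L4_bound_powr: "a \<ge> 0 \<Longrightarrow> ((2 * pi) ^ 4 * a\<^sup>2) powr (1 / 4) = 2 * pi * a powr (1 / 2)"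
proof -
  assume a: "a \<ge> 0"
  have eq: "(2 * pi) ^ 4 * a\<^sup>2 = (2 * pi * a powr (1 / 2)) powr 4"
    using a by (simp add: powr_mult powr_powr powr_4 powr_2)
  show ?thesis
    unfolding eq by (subst powr_powr) simp
qed

text \<open>
  The sharp inequality and its equality case in terms of the real numbers \<open>a = \<integral> |f|\<^sup>2\<close> and
  \<open>b = \<integral> |F|\<^sup>4\<close>, so that the later comparison of norms takes place in the reals.
\<close>
lemma L2_sharp_bound:
  assumes f: "f \<in> L2 \<sigma>"
  obtains a b where "a \<ge> 0" "Lp_norm 2 \<sigma> f = ennreal (a powr (1 / 2))"
    "b \<ge> 0" "Lp_norm 4 lborel (fourier_ext f) = ennreal (b powr (1 / 4))"
    "b \<le> (2 * pi) ^ 4 * a\<^sup>2"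
    "b = (2 * pi) ^ 4 * a\<^sup>2 \<longrightarrow> (AE x in \<sigma>. (norm (f x))\<^sup>2 = a / (4 * pi))"
proof -
  obtain g where gm [measurable]: "g \<in> borel_measurable borel" and fg: "\<And>x. x \<in> space \<sigma> \<Longrightarrow> f x = g x"
    using L2_borel_representative[OF f] by blast
  have fm: "f \<in> borel_measurable \<sigma>" using f by (simp add: L2_def)
  have gs: "g \<in> borel_measurable \<sigma>" by (rule measurable_compose[OF id_measurable_sphere gm])
  have FE: "fourier_ext f = fourier_ext g"
    by (rule fourier_ext_cong_AE[OF fm gs]) (simp add: fg)
  have LE: "Lp_norm 2 \<sigma> f = Lp_norm 2 \<sigma> g"
    by (rule Lp_norm_cong_AE) (simp add: fg)
  have I2: "(\<integral>\<^sup>+x. ennreal (norm (g x) powr 2) \<partial>\<sigma>) = (\<integral>\<^sup>+x. ennreal ((norm (g x))\<^sup>2) \<partial>surf)"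
    by (subst nn_integral_sphere_eq_surf) (simp_all add: powr_2)
  have "Lp_norm 2 \<sigma> g < \<infinity>" using f LE by (simp add: L2_def)
  then have "(\<integral>\<^sup>+x. ennreal ((norm (g x))\<^sup>2) \<partial>surf) \<noteq> \<infinity>"
    unfolding Lp_norm_def I2 by (auto simp: Let_def split: if_splits)
  then have g2: "integrable surf (\<lambda>x. (norm (g x))\<^sup>2)"
    by (intro integrableI_nonneg) (auto simp: less_top)
  define a where "a = (LINT x|surf. (norm (g x))\<^sup>2)"
  have a0: "a \<ge> 0" unfolding a_def by simp
  have na: "(\<integral>\<^sup>+x. ennreal ((norm (g x))\<^sup>2) \<partial>surf) = ennreal a"
    unfolding a_def by (rule nn_integral_eq_integral[OF g2]) simp
  have L2: "Lp_norm 2 \<sigma> f = ennreal (a powr (1 / 2))"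
    unfolding LE by (rule Lp_norm_eq_powr[OF _ a0]) (simp only: I2 na)
  let ?I = "\<integral>\<^sup>+x. ennreal (norm (fourier_ext g x) ^ 4) \<partial>lborel"
  let ?E = "chord_energy (\<lambda>x. (norm (g x))\<^sup>2)"
  have up: "4 * ?I \<le> ennreal ((2 * pi) ^ 4) * ?E"
    by (rule fourier_ext_L4_le_chord_energy[OF gm g2])
  have E: "?E \<le> ennreal (4 * a\<^sup>2)"
    unfolding a_def by (rule chord_energy_le[OF g2]) simp
  then obtain e where e: "e \<ge> 0" "?E = ennreal e"
    by (metis ennreal_cases ennreal_less_top leD top.not_eq_extremum neq_top_trans)
  have "4 * ?I \<le> ennreal ((2 * pi) ^ 4 * e)"
    using up e by (simp add: ennreal_mult)
  then have "?I \<noteq> \<infinity>"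
    by (auto simp: ennreal_mult_top top_unique)
  then obtain b where b: "b \<ge> 0" "?I = ennreal b"
    by (metis ennreal_cases infinity_ennreal_def)
  have "ennreal (4 * b) \<le> ennreal ((2 * pi) ^ 4 * e)"
    using \<open>4 * ?I \<le> ennreal ((2 * pi) ^ 4 * e)\<close> b by (simp add: ennreal_mult)
  then have be: "4 * b \<le> (2 * pi) ^ 4 * e"
    using e by (subst (asm) ennreal_le_iff) auto
  have ea: "e \<le> 4 * a\<^sup>2"
    using E unfolding e(2) by (subst (asm) ennreal_le_iff) auto
  have L4: "Lp_norm 4 lborel (fourier_ext f) = ennreal (b powr (1 / 4))"
    unfolding FE by (rule Lp_norm_eq_powr[OF _ b(1)]) (simp only: b(2)[symmetric] powr_4 norm_ge_zero)
  have "(2 * pi) ^ 4 * e \<le> (2 * pi) ^ 4 * (4 * a\<^sup>2)"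
    using ea by (intro mult_left_mono) auto
  then have ba: "b \<le> (2 * pi) ^ 4 * a\<^sup>2" using be by linarith
  have "AE x in \<sigma>. (norm (f x))\<^sup>2 = a / (4 * pi)" if "b = (2 * pi) ^ 4 * a\<^sup>2"
  proof -
    have "(2 * pi) ^ 4 * (4 * a\<^sup>2) \<le> (2 * pi) ^ 4 * e" using be that by simp
    then have "4 * a\<^sup>2 \<le> e" by (rule mult_left_le_imp_le) simp
    then have "ennreal (4 * a\<^sup>2) \<le> ?E" unfolding e(2) by (rule ennreal_leI)
    then have "AE x in surf. (norm (g x))\<^sup>2 = a / (4 * pi)"
      unfolding a_def by (intro chord_energy_ge_imp_const g2) auto
    then have "AE x in \<sigma>. (norm (g x))\<^sup>2 = a / (4 * pi)"
      by (subst AE_sphere_iff_surf) auto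
    then show ?thesis
      using AE_space by eventually_elim (simp add: fg)
  qed
  then show thesis using that[OF a0 L2 b(1) L4 ba] by blast
qed

lemma Lp_norm_one: "Lp_norm 2 \<sigma> (\<lambda>_. 1) = ennreal ((4 * pi) powr (1 / 2))"
  using emeasure_sphere_total by (intro Lp_norm_eq_powr) (simp_all add: space_sphere_measure)

lemma one_in_L2_nonzero: "(\<lambda>_. 1) \<in> L2_nonzero \<sigma>"
proof -
  have "\<not> (AE x in \<sigma>. (1::complex) = 0)"
  proof
    assume "AE x in \<sigma>. (1::complex) = 0"
    then have "emeasure \<sigma> (space \<sigma>) = 0" by (simp add: AE_iff_null null_setsD1)
    then show False using emeasure_sphere_total by (simp add: space_sphere_measure)
  qed
  then show ?thesis by (simp add: L2_nonzero_def L2_def Lp_norm_one)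
qed

text \<open>
  The sharp inequality bounds the left-hand side from above and \<open>fourier_ext_one_L4_ge\<close> bounds it from
  below.
\<close>
lemma L4_norm_one: "Lp_norm 4 lborel (fourier_ext (\<lambda>_. 1)) = ennreal (2 * pi) * Lp_norm 2 \<sigma> (\<lambda>_. 1)"
proof -
  have "(\<lambda>_. 1) \<in> L2 \<sigma>" using one_in_L2_nonzero by (simp add: L2_nonzero_def)
  then obtain a b where ab: "a \<ge> 0" "Lp_norm 2 \<sigma> (\<lambda>_. 1) = ennreal (a powr (1 / 2))"
    "b \<ge> 0" "Lp_norm 4 lborel (fourier_ext (\<lambda>_. 1)) = ennreal (b powr (1 / 4))" "b \<le> (2 * pi) ^ 4 * a\<^sup>2"
    by (rule L2_sharp_bound)
  have "a powr (1 / 2) = (4 * pi) powr (1 / 2)"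
    using ab(2) unfolding Lp_norm_one by simp
  then have "(a powr (1 / 2)) powr 2 = ((4 * pi) powr (1 / 2)) powr 2" by simp
  then have a: "a = 4 * pi" using ab(1) by (simp add: powr_powr)
  let ?I = "\<integral>\<^sup>+x. ennreal (norm (fourier_ext (\<lambda>_. 1) x) powr 4) \<partial>lborel"
  have I: "ennreal ((2 * pi) ^ 4 * (4 * pi)\<^sup>2) \<le> ?I"
    using fourier_ext_one_L4_ge by (simp add: powr_4)
  have "?I \<noteq> \<infinity>" using ab(4) by (auto simp: Lp_norm_def Let_def split: if_splits)
  then obtain i where i: "i \<ge> 0" "?I = ennreal i" by (metis ennreal_cases infinity_ennreal_def)
  have "ennreal (b powr (1 / 4)) = ennreal (i powr (1 / 4))"
    using Lp_norm_eq_powr[OF i(2,1)] ab(4) by simp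
  moreover have "(2 * pi) ^ 4 * a\<^sup>2 \<le> i"
    using I i unfolding a by (simp only: ennreal_le_iff)
  then have "((2 * pi) ^ 4 * a\<^sup>2) powr (1 / 4) \<le> i powr (1 / 4)"
    by (intro powr_mono2) auto
  moreover have "b powr (1 / 4) \<le> ((2 * pi) ^ 4 * a\<^sup>2) powr (1 / 4)"
    using ab by (intro powr_mono2) auto
  ultimately have "b powr (1 / 4) = 2 * pi * a powr (1 / 2)"
    using L4_bound_powr[OF ab(1)] by simp
  then show ?thesis
    unfolding ab(2,4) by (simp add: ennreal_mult)
qed

lemma L2_nonzero_norm_pos:
  assumes "f \<in> L2_nonzero \<sigma>"
  shows "Lp_norm 2 \<sigma> f \<noteq> 0"
proof
  assume z: "Lp_norm 2 \<sigma> f = 0"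
  have [measurable]: "f \<in> borel_measurable \<sigma>" using assms by (simp add: L2_nonzero_def L2_def)
  have "Lp_norm 2 \<sigma> f < \<infinity>" using assms by (simp add: L2_nonzero_def L2_def)
  then have "(\<integral>\<^sup>+x. ennreal (norm (f x) powr 2) \<partial>\<sigma>) = 0"
    using z unfolding Lp_norm_def by (auto simp: Let_def enn2real_eq_0_iff split: if_splits)
  then have "AE x in \<sigma>. ennreal (norm (f x) powr 2) = 0"
    by (subst (asm) nn_integral_0_iff_AE) auto
  then have "AE x in \<sigma>. f x = 0" by eventually_elim simp
  then show False using assms by (simp add: L2_nonzero_def)
qed

lemma L4_le_L2: "f \<in> L2 \<sigma> \<Longrightarrow> Lp_norm 4 lborel (fourier_ext f) \<le> ennreal (2 * pi) * Lp_norm 2 \<sigma> f"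
proof -
  assume "f \<in> L2 \<sigma>"
  then obtain a b where ab: "a \<ge> 0" "Lp_norm 2 \<sigma> f = ennreal (a powr (1 / 2))"
    "b \<ge> 0" "Lp_norm 4 lborel (fourier_ext f) = ennreal (b powr (1 / 4))" "b \<le> (2 * pi) ^ 4 * a\<^sup>2"
    by (rule L2_sharp_bound)
  have "b powr (1 / 4) \<le> 2 * pi * a powr (1 / 2)"
    unfolding L4_bound_powr[OF ab(1), symmetric] using ab by (intro powr_mono2) auto
  then have "ennreal (b powr (1 / 4)) \<le> ennreal (2 * pi * a powr (1 / 2))"
    by (rule ennreal_leI)
  then show ?thesis unfolding ab(2,4) by (simp add: ennreal_mult)
qed

lemma ratio_one: "restriction_ratio (\<lambda>_. 1) = ennreal (2 * pi)"
proof -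
  have "restriction_ratio (\<lambda>_. 1) = ennreal (2 * pi * (4 * pi) powr (1 / 2)) / ennreal ((4 * pi) powr (1 / 2))"
    unfolding restriction_ratio_def L4_norm_one Lp_norm_one by (simp add: ennreal_mult)
  also have "\<dots> = ennreal (2 * pi * (4 * pi) powr (1 / 2) / (4 * pi) powr (1 / 2))"
    by (rule divide_ennreal) auto
  finally show ?thesis by simp
qed

lemma optimal_const_eq: "optimal_const = ennreal (2 * pi)"
proof (rule antisym)
  show "optimal_const \<le> ennreal (2 * pi)"
    unfolding optimal_const_def
  proof (rule SUP_least)
    fix f assume f: "f \<in> L2_nonzero \<sigma>"
    then have "f \<in> L2 \<sigma>" by (simp add: L2_nonzero_def)
    have "restriction_ratio f \<le> ennreal (2 * pi) * Lp_norm 2 \<sigma> f / Lp_norm 2 \<sigma> f"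
      unfolding restriction_ratio_def by (intro divide_right_mono_ennreal L4_le_L2 \<open>f \<in> L2 \<sigma>\<close>)
    also have "\<dots> = ennreal (2 * pi)"
      using L2_nonzero_norm_pos[OF f] f by (intro ennreal_mult_divide_eq) (auto simp: L2_nonzero_def L2_def)
    finally show "restriction_ratio f \<le> ennreal (2 * pi)" .
  qed
  show "ennreal (2 * pi) \<le> optimal_const"
    unfolding optimal_const_def ratio_one[symmetric] by (rule SUP_upper[OF one_in_L2_nonzero])
qed

text \<open>
  Equality of the norms means \<open>b = (2\<pi>)\<^sup>4 a\<^sup>2\<close>, and then \<open>|f|\<^sup>2\<close> is constant; a nonnegative \<open>f\<close> is
  recovered from its modulus.
\<close>
lemma maximizer_imp_const:
  assumes f: "f \<in> L2 \<sigma>" "nonneg_ae \<sigma> f" and max: "global_maximizer f"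
  shows "\<exists>c. c \<noteq> 0 \<and> (AE \<omega> in \<sigma>. f \<omega> = c)"
proof -
  obtain a b where ab: "a \<ge> 0" "Lp_norm 2 \<sigma> f = ennreal (a powr (1 / 2))"
    "b \<ge> 0" "Lp_norm 4 lborel (fourier_ext f) = ennreal (b powr (1 / 4))" "b \<le> (2 * pi) ^ 4 * a\<^sup>2"
    "b = (2 * pi) ^ 4 * a\<^sup>2 \<longrightarrow> (AE x in \<sigma>. (norm (f x))\<^sup>2 = a / (4 * pi))"
    by (rule L2_sharp_bound[OF f(1)])
  have nz: "\<not> (AE x in \<sigma>. f x = 0)"
    using max by (simp add: global_maximizer_def L2_nonzero_def)
  have "ennreal (b powr (1 / 4)) = ennreal (2 * pi * a powr (1 / 2))"
    using max unfolding global_maximizer_def optimal_const_eq ab(2,4) by (simp add: ennreal_mult)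
  then have "b powr (1 / 4) = ((2 * pi) ^ 4 * a\<^sup>2) powr (1 / 4)"
    unfolding L4_bound_powr[OF ab(1)] using ab(1) by simp
  then have "(b powr (1 / 4)) powr 4 = (((2 * pi) ^ 4 * a\<^sup>2) powr (1 / 4)) powr 4" by simp
  then have "b = (2 * pi) ^ 4 * a\<^sup>2"
    using ab by (simp add: powr_powr)
  then have "AE x in \<sigma>. (norm (f x))\<^sup>2 = a / (4 * pi)" using ab(6) by blast
  moreover have "AE x in \<sigma>. f x \<in> \<real>\<^sub>\<ge>\<^sub>0" using f(2) by (simp add: nonneg_ae_def)
  ultimately have c: "AE x in \<sigma>. f x = complex_of_real (sqrt (a / (4 * pi)))"
  proof eventually_elim
    case (elim x)
    then have "norm (f x) = sqrt (a / (4 * pi))" by (metis norm_ge_zero real_sqrt_unique)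
    moreover have "f x = complex_of_real (norm (f x))"
      using elim(2) by (metis nonneg_Reals_cases norm_of_real abs_of_nonneg)
    ultimately show ?case by simp
  qed
  moreover have "complex_of_real (sqrt (a / (4 * pi))) \<noteq> 0"
    using c nz by metis
  ultimately show ?thesis by blast
qed

lemma const_imp_maximizer:
  assumes f: "f \<in> L2 \<sigma>" and c: "c \<noteq> 0" "AE \<omega> in \<sigma>. f \<omega> = c"
  shows "global_maximizer f"
proof -
  have fm: "f \<in> borel_measurable \<sigma>" using f by (simp add: L2_def)
  have "fourier_ext f = fourier_ext (\<lambda>_. c)"
    by (rule fourier_ext_cong_AE[OF fm _ c(2)]) simp
  also have "\<dots> = (\<lambda>x. c * fourier_ext (\<lambda>_. 1) x)"
    by (simp add: fourier_ext_def fun_eq_iff mult.commute)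
  finally have F: "Lp_norm 4 lborel (fourier_ext f) = ennreal (norm c) * Lp_norm 4 lborel (fourier_ext (\<lambda>_. 1))"
    using c(1) fourier_ext_measurable[of "\<lambda>_. 1"] by (simp add: Lp_norm_cmult)
  have L: "Lp_norm 2 \<sigma> f = ennreal (norm c) * Lp_norm 2 \<sigma> (\<lambda>_. 1)"
    using Lp_norm_cong_AE[OF c(2), of 2] Lp_norm_cmult[of 2 "\<lambda>_. 1" \<sigma> c] c(1) by simp
  have "\<not> (AE x in \<sigma>. f x = 0)"
  proof
    assume "AE x in \<sigma>. f x = 0"
    then have "AE x in \<sigma>. (1 :: complex) = 0"
      using c(2) by eventually_elim (use c(1) in simp)
    then show False using one_in_L2_nonzero by (simp add: L2_nonzero_def)
  qed
  then show ?thesis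
    unfolding global_maximizer_def optimal_const_eq F L L4_norm_one
    using f by (simp add: L2_nonzero_def mult_ac)
qed

theorem theorem1p1:
  shows "(\<forall>f \<in> L2 \<sigma>. nonneg_ae \<sigma> f \<longrightarrow>
            (global_maximizer f \<longleftrightarrow> (\<exists>c. c \<noteq> 0 \<and> (AE \<omega> in \<sigma>. f \<omega> = c))))
         \<and> optimal_const = Lp_norm 4 lborel (fourier_ext (\<lambda>_. 1)) / Lp_norm 2 \<sigma> (\<lambda>_. 1)
         \<and> Lp_norm 4 lborel (fourier_ext (\<lambda>_. 1)) / Lp_norm 2 \<sigma> (\<lambda>_. 1) = ennreal (2 * pi)"
  using maximizer_imp_const const_imp_maximizer optimal_const_eq ratio_one
  unfolding restriction_ratio_def by metis

end
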